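(* For any simply connected open sets $U,V\subset\mathbb{C}$ with $\overline U\subset V$ and any $\epsilon>0$, there exist $r>0$ and $\delta_0>0$ such that for all bounded simply connected domains $D_1,D_2$ with $V\subset D_1\cap D_2$ and such that the Hausdorff distance between $\partial D_1$ and $\partial D_2$ is less than $r$, and for all $\delta<\delta_0$, $$\nu_1\Big(1-\epsilon\le\frac{d\nu_1}{d\nu_2}\le1+\epsilon\Big)\ge1-\epsilon,\qquad \nu_2\Big(1-\epsilon\le\frac{d\nu_1}{d\nu_2}\le1+\epsilon\Big)\ge1-\epsilon,$$ where $\nu_1=\nu_1^{\#\delta}$ and $\nu_2=\nu_2^{\#\delta}$ are the laws of the restrictions to $U$ of the wired uniform spanning trees of $D_1^{\#\delta}$ and $D_2^{\#\delta}$.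
   Context: **Graphs.** $(G^{\#\delta})_{\delta>0}$ is a family of oriented, weighted planar graphs (self loops and multiple edges allowed). Weights are transition rates of a continuous time random walk $RW$ on $G^{\#\delta}$, whose law from $v$ is $\mathbb{P}_v$; $q(v\to v')$ denotes the weights normalised so that $\sum_{v'}q(v\to v')=1$. Assume: (i) Good embedding: edges are embedded in the plane as piecewise smooth curves that do not cross each other. (ii) Uniformly bounded density: there is $M>0$ such that for all $\delta>0$, $z\in\mathbb{C}$, the square $z+[0,\delta]^2$ contains at most $M$ vertices. (iii) Connected: for each $\delta$ and all vertices $u,v$ of $G^{\#\delta}$, $\mathbb{P}_u(RW_1=v)>0$. (iv) Uniform crossing: let $\mathcal{R}=[0,3]\times[0,1]$, $B_1=B((1/2,1/2),1/4)$, $B_2=B((5/2,1/2),1/4)$. There are $p_0>0$, $\delta_1>0$ such that for all $z\in\mathbb{C}$, $\eta>0$, $\delta\le\eta\delta_1$ and $v\in\eta B_1$ with $z+v$ a vertex of $G^{\#\delta}$, $\mathbb{P}_{z+v}(RW\text{ hits }\eta B_2+z\text{ before exiting }\eta\mathcal{R}+z)>p_0$; the same holds with $B_1,B_2$ exchanged, and for the vertical rectangle $[0,1]\times[0,3]$ with the corresponding balls. **Domains and trees.** A domain is a non-empty connected open set. For an open set $D$, $D^{\#\delta}$ is the subgraph of $G^{\#\delta}$ formed by the vertices and edges embedded inside $D$ (an edge with both ends in $D$ but meeting $\partial D$ is not included). Wired boundary condition: a cemetery vertex, denoted $\partial D$, with no outgoing transition is added, and every edge of $G^{\#\delta}$ starting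 in $D^{\#\delta}$ and touching $\partial D$ is replaced by an edge with the same starting point and weight leading to the cemetery. A wired spanning tree of $D^{\#\delta}$ is a set of oriented edges with no cycle in which every vertex other than the cemetery has exactly one outgoing edge (the cemetery has none). The wired uniform spanning tree (UST) is the law with $\mathbb{P}(\mathcal{T})\propto\prod_{(vv')\in\mathcal{T}}q(v\to v')$. Its restriction to $U$ is the set of its edges contained in $U$. The laws are on finite sets, so $d\nu_1/d\nu_2$ at a configuration is the ratio of its masses (with value $+\infty$ if only $\nu_2$ vanishes). *)

theory Defs
  imports "HOL-Probability.Probability" "Graph_Theory.Digraph_Component"
begin

section \<open>Embedded weighted planar graphs\<close>

text \<open>
  Vertices are points of the plane. A graph \<open>G\<close> comes with edge weights \<open>w\<close> and with
  parametrised curves \<open>c\<close> drawing its edges; edges are abstract labels, so that self loops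
  and multiple edges are possible.
\<close>

text \<open>
  The out-degrees are finite (all laws of wired trees in bounded domains live on finite sets)
  and positive (otherwise the weights could not be normalised to transition probabilities).
\<close>

definition weighted_graph :: "(complex, 'e) pre_digraph \<Rightarrow> ('e \<Rightarrow> real) \<Rightarrow> bool" where
  "weighted_graph G w \<longleftrightarrow> wf_digraph G \<and>
     (\<forall>v\<in>verts G. finite (out_arcs G v) \<and> out_arcs G v \<noteq> {}) \<and>
     (\<forall>e\<in>arcs G. w e > 0)"

definition total_rate :: "(complex, 'e) pre_digraph \<Rightarrow> ('e \<Rightarrow> real) \<Rightarrow> complex \<Rightarrow> real" where
  "total_rate G w v = (\<Sum>e\<in>out_arcs G v. w e)"

definition trans_prob :: "(complex, 'e) pre_digraph \<Rightarrow> ('e \<Rightarrow> real) \<Rightarrow> 'e \<Rightarrow> real" where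
  "trans_prob G w e = w e / total_rate G w (tail G e)"

text \<open>
  Curves that do not cross: distinct edges are disjoint except possibly at vertices, or they are
  drawn on top of each other, as for the two orientations of an unoriented edge.
\<close>

definition good_embedding ::
    "(complex, 'e) pre_digraph \<Rightarrow> ('e \<Rightarrow> real \<Rightarrow> complex) \<Rightarrow> bool" where
  "good_embedding G c \<longleftrightarrow>
     (\<forall>e\<in>arcs G. valid_path (c e) \<and> simple_path (c e) \<and>
        pathstart (c e) = tail G e \<and> pathfinish (c e) = head G e \<and>
        c e ` {0<..<1} \<inter> verts G = {}) \<and>
     (\<forall>e\<in>arcs G. \<forall>f\<in>arcs G. e \<noteq> f \<longrightarrow>
        c e ` {0<..<1} \<inter> c f ` {0<..<1} = {} \<or> path_image (c e) = path_image (c f))"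

definition uniformly_bounded_density :: "(real \<Rightarrow> (complex, 'e) pre_digraph) \<Rightarrow> bool" where
  "uniformly_bounded_density G \<longleftrightarrow>
     (\<exists>M::nat. M > 0 \<and> (\<forall>\<delta>>0. \<forall>z.
        finite (verts (G \<delta>) \<inter> cbox z (z + Complex \<delta> \<delta>)) \<and>
        card (verts (G \<delta>) \<inter> cbox z (z + Complex \<delta> \<delta>)) \<le> M))"


section \<open>Laws on finite sets given by weights\<close>

definition weighted_pmf :: "('a \<Rightarrow> real) \<Rightarrow> 'a set \<Rightarrow> 'a pmf" where
  "weighted_pmf f A = embed_pmf (\<lambda>x. if x \<in> A then f x / sum f A else 0)"

lemma pmf_weighted_pmf:
  assumes "finite A" "\<And>x. x \<in> A \<Longrightarrow> f x \<ge> 0" "sum f A > 0"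
  shows "pmf (weighted_pmf f A) x = (if x \<in> A then f x / sum f A else 0)"
  unfolding weighted_pmf_def
proof (rule pmf_embed_pmf)
  show "(if y \<in> A then f y / sum f A else 0) \<ge> 0" for y
    using assms by simp
  have "(\<integral>\<^sup>+ y. ennreal (if y \<in> A then f y / sum f A else 0) \<partial>count_space UNIV) =
      (\<Sum>y\<in>A. ennreal (f y / sum f A))"
    using assms by (subst nn_integral_count_space'[of A]) (auto intro!: sum.cong)
  also have "\<dots> = ennreal (\<Sum>y\<in>A. f y / sum f A)"
    using assms by (intro sum_ennreal) auto
  also have "(\<Sum>y\<in>A. f y / sum f A) = 1"
    using assms by (simp flip: sum_divide_distrib)
  finally show "(\<integral>\<^sup>+ y. ennreal (if y \<in> A then f y / sum f A else 0) \<partial>count_space UNIV) = 1"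
    by simp
qed


section \<open>The continuous time random walk\<close>

text \<open>
  The walk is driven by independent variables \<open>\<omega> (n, v)\<close>: if \<open>v\<close> is the position after \<open>n\<close> jumps,
  then the walk stays at \<open>v\<close> for the time \<open>fst (\<omega> (n, v))\<close>, exponential with the total rate of \<open>v\<close>,
  and then jumps along the edge \<open>snd (\<omega> (n, v))\<close>, chosen with the transition probabilities.
  Since the \<open>n\<close>-th jump only uses the variables of index \<open>n\<close>, this is the Markov jump process
  with the given transition rates.
\<close>

type_synonym 'e noise = "nat \<times> complex \<Rightarrow> real \<times> 'e"

definition noise_space ::
    "(complex, 'e) pre_digraph \<Rightarrow> ('e \<Rightarrow> real) \<Rightarrow> 'e noise measure" where
  "noise_space G w = PiM (UNIV \<times> verts G) (\<lambda>(n, v).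
     density lborel (\<lambda>t. ennreal (exponential_density (total_rate G w v) t))
       \<Otimes>\<^sub>M measure_pmf (weighted_pmf w (out_arcs G v)))"

primrec jump_chain ::
    "(complex, 'e) pre_digraph \<Rightarrow> complex \<Rightarrow> 'e noise \<Rightarrow> nat \<Rightarrow> complex" where
  "jump_chain G v \<omega> 0 = v"
| "jump_chain G v \<omega> (Suc n) = head G (snd (\<omega> (n, jump_chain G v \<omega> n)))"

definition jump_edge ::
    "(complex, 'e) pre_digraph \<Rightarrow> complex \<Rightarrow> 'e noise \<Rightarrow> nat \<Rightarrow> 'e" where
  "jump_edge G v \<omega> n = snd (\<omega> (n, jump_chain G v \<omega> n))"

definition jump_time ::
    "(complex, 'e) pre_digraph \<Rightarrow> complex \<Rightarrow> 'e noise \<Rightarrow> nat \<Rightarrow> real" where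
  "jump_time G v \<omega> n = (\<Sum>k<n. fst (\<omega> (k, jump_chain G v \<omega> k)))"

definition jump_count ::
    "(complex, 'e) pre_digraph \<Rightarrow> complex \<Rightarrow> 'e noise \<Rightarrow> real \<Rightarrow> nat" where
  "jump_count G v \<omega> t = (LEAST n. t < jump_time G v \<omega> (Suc n))"

text \<open>The value \<open>None\<close> means that infinitely many jumps took place before time \<open>t\<close>.\<close>

definition random_walk ::
    "(complex, 'e) pre_digraph \<Rightarrow> complex \<Rightarrow> 'e noise \<Rightarrow> real \<Rightarrow> complex option" where
  "random_walk G v \<omega> t =
     (if \<exists>n. t < jump_time G v \<omega> (Suc n) then Some (jump_chain G v \<omega> (jump_count G v \<omega> t)) else None)"

text \<open>
  The walk moves along the embedded edges: it has left a set as soon as it has used an edge whose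
  curve is not contained in that set. This is the convention that also determines which edges
  belong to \<open>D\<^sup>#\<^sup>\<delta>\<close>.
\<close>

definition walk_trace :: "(complex, 'e) pre_digraph \<Rightarrow> ('e \<Rightarrow> real \<Rightarrow> complex) \<Rightarrow>
    complex \<Rightarrow> 'e noise \<Rightarrow> real \<Rightarrow> complex set" where
  "walk_trace G c v \<omega> t =
     insert v (\<Union>k<jump_count G v \<omega> t. path_image (c (jump_edge G v \<omega> k)))"

definition hits_before_exit :: "(complex, 'e) pre_digraph \<Rightarrow> ('e \<Rightarrow> real \<Rightarrow> complex) \<Rightarrow>
    complex \<Rightarrow> 'e noise \<Rightarrow> complex set \<Rightarrow> complex set \<Rightarrow> bool" where
  "hits_before_exit G c v \<omega> B R \<longleftrightarrow>
     (\<exists>t\<ge>0. \<exists>x\<in>B. random_walk G v \<omega> t = Some x \<and> walk_trace G c v \<omega> t \<subseteq> R)"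

definition walk_connected :: "(complex, 'e) pre_digraph \<Rightarrow> ('e \<Rightarrow> real) \<Rightarrow> bool" where
  "walk_connected G w \<longleftrightarrow> (\<forall>u\<in>verts G. \<forall>v\<in>verts G.
     measure (noise_space G w)
       {\<omega> \<in> space (noise_space G w). random_walk G u \<omega> 1 = Some v} > 0)"

text \<open>Rectangle, starting ball, target ball.\<close>

definition crossings :: "(complex set \<times> complex set \<times> complex set) set" where
  "crossings =
     (let R = cbox 0 (Complex 3 1); R' = cbox 0 (Complex 1 3);
          B1 = ball (Complex (1/2) (1/2)) (1/4);
          B2 = ball (Complex (5/2) (1/2)) (1/4);
          B2' = ball (Complex (1/2) (5/2)) (1/4)
      in {(R, B1, B2), (R, B2, B1), (R', B1, B2'), (R', B2', B1)})"

definition uniform_crossing :: "(real \<Rightarrow> (complex, 'e) pre_digraph) \<Rightarrow>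
    (real \<Rightarrow> 'e \<Rightarrow> real) \<Rightarrow> (real \<Rightarrow> 'e \<Rightarrow> real \<Rightarrow> complex) \<Rightarrow> bool" where
  "uniform_crossing G w c \<longleftrightarrow>
     (\<exists>p\<^sub>0>0. \<exists>\<delta>\<^sub>1>0. \<forall>(R, A, B)\<in>crossings. \<forall>z. \<forall>\<eta>>0. \<forall>\<delta>. 0 < \<delta> \<and> \<delta> \<le> \<eta> * \<delta>\<^sub>1 \<longrightarrow>
        (let S = (\<lambda>X. (\<lambda>x. z + \<eta> *\<^sub>R x) ` X) in
         \<forall>v \<in> verts (G \<delta>) \<inter> S A.
           measure (noise_space (G \<delta>) (w \<delta>))
             {\<omega> \<in> space (noise_space (G \<delta>) (w \<delta>)).
                hits_before_exit (G \<delta>) (c \<delta>) v \<omega> (S B) (S R)} > p\<^sub>0))"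


section \<open>Wired uniform spanning trees\<close>

text \<open>
  \<open>None\<close> is the cemetery. An edge starting in \<open>D\<close> and touching the frontier keeps its label when
  it is redirected to the cemetery.
\<close>

definition wired_graph :: "(complex, 'e) pre_digraph \<Rightarrow> ('e \<Rightarrow> real \<Rightarrow> complex) \<Rightarrow>
    complex set \<Rightarrow> (complex option, 'e) pre_digraph" where
  "wired_graph G c D =
     \<lparr> verts = insert None (Some ` (verts G \<inter> D)),
       arcs = {e \<in> arcs G. path_image (c e) \<subseteq> D} \<union>
              {e \<in> arcs G. tail G e \<in> D \<and> path_image (c e) \<inter> frontier D \<noteq> {}},
       tail = (\<lambda>e. Some (tail G e)),
       head = (\<lambda>e. if path_image (c e) \<subseteq> D then Some (head G e) else None) \<rparr>"

definition wired_spanning_trees :: "(complex, 'e) pre_digraph \<Rightarrow>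
    ('e \<Rightarrow> real \<Rightarrow> complex) \<Rightarrow> complex set \<Rightarrow> 'e set set" where
  "wired_spanning_trees G c D =
     (let W = wired_graph G c D in
      {T. T \<subseteq> arcs W \<and> forest (W\<lparr>arcs := T\<rparr>) \<and>
          (\<forall>v\<in>verts W - {None}. \<exists>!e. e \<in> T \<and> tail W e = v)})"

definition wired_ust :: "(complex, 'e) pre_digraph \<Rightarrow> ('e \<Rightarrow> real) \<Rightarrow>
    ('e \<Rightarrow> real \<Rightarrow> complex) \<Rightarrow> complex set \<Rightarrow> 'e set pmf" where
  "wired_ust G w c D =
     weighted_pmf (\<lambda>T. \<Prod>e\<in>T. trans_prob G w e) (wired_spanning_trees G c D)"

definition restricted_ust :: "(complex, 'e) pre_digraph \<Rightarrow> ('e \<Rightarrow> real) \<Rightarrow>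
    ('e \<Rightarrow> real \<Rightarrow> complex) \<Rightarrow> complex set \<Rightarrow> complex set \<Rightarrow> 'e set pmf" where
  "restricted_ust G w c D U =
     map_pmf (\<lambda>T. {e \<in> T. path_image (c e) \<subseteq> U}) (wired_ust G w c D)"

text \<open>The quotient in \<open>ereal\<close> is \<open>\<infinity>\<close> where only the denominator vanishes.\<close>

definition pmf_ratio :: "'a pmf \<Rightarrow> 'a pmf \<Rightarrow> 'a \<Rightarrow> ereal" where
  "pmf_ratio \<mu> \<nu> x = ereal (pmf \<mu> x) / ereal (pmf \<nu> x)"


section \<open>Domains\<close>

definition bounded_sc_domain :: "complex set \<Rightarrow> bool" where
  "bounded_sc_domain D \<longleftrightarrow> D \<noteq> {} \<and> open D \<and> Topological_Spaces.connected D \<and> bounded D \<and> simply_connected D"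

text \<open>Meant for nonempty bounded sets, such as the frontiers of bounded domains.\<close>

definition hausdorff_distance :: "'a::metric_space set \<Rightarrow> 'a set \<Rightarrow> real" where
  "hausdorff_distance A B = max (SUP a\<in>A. infdist a B) (SUP b\<in>B. infdist b A)"

end

theory Submission
  imports Defs "HOL-Complex_Analysis.Complex_Analysis"
begin

text \<open>
  Each \<open>D\<^sub>i\<close> is compared with the open set \<open>D = D\<^sub>1 \<inter> D\<^sub>2\<close>: pointwise, the restricted law of \<open>D\<close> is at
  least \<open>1 - t\<close> times that of \<open>D\<^sub>i\<close>. Two laws with such a common minorant have a ratio close to 1
  outside an event of small probability.

  The mass of a restricted configuration is a quotient of sums over trees. Such a sum is affine
  in the out-edges of a vertex, with coefficients that are harmonic functions of the endpoint.
  Split the walk in \<open>D\<^sub>i\<close> into two layers, before and after it has used an edge that leaves \<open>D\<close>, and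
  let it drop back to the first layer when it returns to \<open>U\<close>. The trees of \<open>D\<^sub>i\<close> and of \<open>D\<close>
  correspond to keeping and to killing these returns. Killing arrows can only create trees, and
  keeping them costs at most the expected number of returns, once Harnack's inequality has removed
  the dependence on the starting point in \<open>U\<close>. A return is unlikely because the walk leaves \<open>D\<close>
  close to the frontier of \<open>D\<^sub>i\<close> (Beurling's estimate).

  Both estimates rest on circuits: by the crossing property, the walk has a probability bounded
  from below to surround a given point at a given scale. Such a circuit is not contained in a
  simply connected open set that misses the point, and by planarity it shares a vertex with any
  other walk that goes from the point to infinity.
\<close>

section \<open>Sums over rooted forests\<close>

text \<open>The obstacle is uniformity in the configuration: fixing the tree inside \<open>U\<close>
  changes the walk there in an arbitrary way. On the doubled chain a fixed configuration needs only
  the direction that is free, namely that killing creates trees. The quantitative bound is needed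
  for the unrestricted sum alone, which does not see the configuration. Comparing through the
  intersection makes the two domains nested, as this monotonicity requires, while Beurling's
  estimate is applied to the walk in \<open>D_i\<close>, the domain that is known to be simply
  connected.

  Hitting probabilities of killed walks are represented by forest sums, so they exist by definition
  and their relations are finite identities, valid also where a sum vanishes. For the walk in the
  whole plane all lower bounds concern finitely many steps; the noise space enters only to turn the
  crossing hypothesis into such bounds.\<close>

inductive ends :: "'a set \<Rightarrow> ('a \<Rightarrow> 'a option) \<Rightarrow> 'a option \<Rightarrow> 'a option \<Rightarrow> bool" for A F where
  stop: "t \<notin> Some ` A \<Longrightarrow> ends A F t t"
| step: "x \<in> A \<Longrightarrow> ends A F (F x) r \<Longrightarrow> ends A F (Some x) r"

lemma ends_outside: "t \<notin> Some ` A \<Longrightarrow> ends A F t r \<longleftrightarrow> r = t"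
  by (auto intro: ends.stop elim: ends.cases)

lemma ends_inside: "x \<in> A \<Longrightarrow> ends A F (Some x) r \<longleftrightarrow> ends A F (F x) r"
  by (auto intro: ends.step elim: ends.cases)

lemma ends_target: "ends A F t r \<Longrightarrow> r \<notin> Some ` A"
  by (induction rule: ends.induct) auto

lemma ends_unique: "ends A F t r \<Longrightarrow> ends A F t r' \<Longrightarrow> r = r'"
  by (induction rule: ends.induct) (auto simp: ends_outside ends_inside)

lemma ends_cong_imp:
  assumes "ends A F t r" "\<And>x. x \<in> A \<Longrightarrow> F x = F' x"
  shows "ends A F' t r"
  using assms by (induction rule: ends.induct) (auto intro: ends.intros)

lemma ends_cong:
  assumes "\<And>x. x \<in> A \<Longrightarrow> F x = F' x"
  shows "ends A F t r \<longleftrightarrow> ends A F' t r"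
  using ends_cong_imp[of A F t r F'] ends_cong_imp[of A F' t r F] assms by metis

lemma ends_insert_avoid: "ends A F t r \<Longrightarrow> r \<noteq> Some y \<Longrightarrow> ends (insert y A) F t r"
  by (induction rule: ends.induct) (auto intro: ends.intros)

lemma ends_insert_through:
  "ends A F t s \<Longrightarrow> s = Some y \<Longrightarrow> ends (insert y A) F (Some y) r \<Longrightarrow> ends (insert y A) F t r"
  by (induction rule: ends.induct) (auto intro: ends.intros)

lemma ends_insert_cases: "ends (insert y A) F t r \<Longrightarrow> ends A F t r \<or> ends A F t (Some y)"
proof (induction rule: ends.induct)
  case (stop t)
  then show ?case by (auto intro: ends.stop)
next
  case (step x r)
  show ?case
  proof (cases "x \<in> A")
    case True
    then show ?thesis using step by (auto intro: ends.step)
  next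
    case False
    then show ?thesis using step by (auto intro: ends.stop)
  qed
qed

text \<open>A finite derivation that reached \<open>y\<close> would have to continue from
  \<open>F y\<close>, which leads to \<open>y\<close> again; induction on the derivation excludes
  this.\<close>

lemma ends_no_loop:
  assumes "ends (insert y A) F t r" "y \<notin> A" "ends A F (F y) (Some y)"
  shows "\<not> ends A F t (Some y)"
  using assms(1)
proof (induction rule: ends.induct)
  case (stop t)
  then show ?case by (auto simp: ends_outside)
next
  case (step x r)
  show ?case
  proof (cases "x \<in> A")
    case True
    then show ?thesis using step by (auto simp: ends_inside)
  next
    case False
    then show ?thesis using step assms(3) by auto
  qed
qed

text \<open>Acyclicity in the form that every vertex leads to a root. Everything outside
  \<open>A\<close>, not only \<open>None\<close>, is a root: removing a vertex from \<open>A\<close>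
  makes it a root, which is what the inductions on \<open>A\<close> use.\<close>

definition acyc :: "'a set \<Rightarrow> ('a \<Rightarrow> 'a option) \<Rightarrow> bool" where
  "acyc A F \<longleftrightarrow> (\<forall>x\<in>A. \<exists>r. ends A F (Some x) r)"

lemma acyc_cong:
  assumes "\<And>x. x \<in> A \<Longrightarrow> F x = F' x"
  shows "acyc A F \<longleftrightarrow> acyc A F'"
proof -
  have "ends A F t r = ends A F' t r" for t r by (intro ends_cong assms)
  then show ?thesis by (simp add: acyc_def)
qed

lemma acyc_ends: "acyc A F \<Longrightarrow> \<exists>r. ends A F t r"
  unfolding acyc_def by (cases "t \<in> Some ` A") (auto intro: ends.stop)

text \<open>The new vertex was the root of a tree; its out-edge closes a cycle exactly if it leads
  back into that tree.\<close>

lemma acyc_insert: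
  assumes "y \<notin> A"
  shows "acyc (insert y A) F \<longleftrightarrow> acyc A F \<and> \<not> ends A F (F y) (Some y)"
proof
  assume L: "acyc (insert y A) F"
  then have "acyc A F"
    unfolding acyc_def using ends_insert_cases by (metis insertCI)
  moreover obtain r where "ends (insert y A) F (Some y) r"
    using L unfolding acyc_def by blast
  then have "\<not> ends A F (F y) (Some y)"
    using ends_no_loop[of y A F "Some y" r] assms by (auto simp: ends_outside image_iff)
  ultimately show "acyc A F \<and> \<not> ends A F (F y) (Some y)" by simp
next
  assume R: "acyc A F \<and> \<not> ends A F (F y) (Some y)"
  obtain s where s: "ends A F (F y) s" using acyc_ends R by metis
  then have y: "ends (insert y A) F (Some y) s"
    using R by (intro ends.step ends_insert_avoid) auto
  show "acyc (insert y A) F" unfolding acyc_def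
  proof
    fix x assume "x \<in> insert y A"
    obtain q where "ends A F (Some x) q" using acyc_ends R by metis
    then show "\<exists>r. ends (insert y A) F (Some x) r"
      using y ends_insert_avoid ends_insert_through by metis
  qed
qed

lemma ends_insert:
  assumes "y \<notin> A" "acyc (insert y A) F" "r \<noteq> Some y"
  shows "ends (insert y A) F t r \<longleftrightarrow> ends A F t r \<or> (ends A F t (Some y) \<and> ends A F (F y) r)"
proof
  have nl: "\<not> ends A F (F y) (Some y)" and ac: "acyc A F" using acyc_insert assms by metis+
  {
    assume L: "ends (insert y A) F t r"
    show "ends A F t r \<or> (ends A F t (Some y) \<and> ends A F (F y) r)"
    proof (cases "ends A F t r")
      case False
      then have t: "ends A F t (Some y)" using ends_insert_cases[OF L] by simp
      obtain s where s: "ends A F (F y) s" using acyc_ends ac by metis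
      then have "ends (insert y A) F (Some y) s"
        using nl by (intro ends.step ends_insert_avoid) auto
      then have "ends (insert y A) F t s" using t ends_insert_through by metis
      then show ?thesis using ends_unique[OF L] s t by metis
    qed simp
  }
  assume R: "ends A F t r \<or> (ends A F t (Some y) \<and> ends A F (F y) r)"
  then show "ends (insert y A) F t r"
  proof
    assume "ends A F t r" then show ?thesis using assms ends_insert_avoid by metis
  next
    assume *: "ends A F t (Some y) \<and> ends A F (F y) r"
    then have "ends (insert y A) F (Some y) r"
      using assms by (intro ends.step ends_insert_avoid) auto
    then show ?thesis using * ends_insert_through by metis
  qed
qed

section \<open>Weighted forest sums and harmonic functions\<close>

definition forest_sum :: "('e \<Rightarrow> real) \<Rightarrow> ('a \<Rightarrow> 'e set) \<Rightarrow> ('a \<Rightarrow> 'e \<Rightarrow> 'a option) \<Rightarrow> 'a set \<Rightarrow> real" where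
  "forest_sum wt Out tgt A =
     (\<Sum>f\<in>PiE A Out. of_bool (acyc A (\<lambda>x. tgt x (f x))) * (\<Prod>x\<in>A. wt (f x)))"

text \<open>By the matrix-tree theorem \<open>forest_sum\<close> is the determinant of the Laplacian
  on \<open>A\<close> with killing outside. The quotient of \<open>forest_sum_to\<close> by
  \<open>forest_sum\<close> is the probability that the walk from \<open>t\<close> leaves
  \<open>A\<close> at \<open>r\<close>; it is kept undivided because the sums may vanish.\<close>

definition forest_sum_to :: "('e \<Rightarrow> real) \<Rightarrow> ('a \<Rightarrow> 'e set) \<Rightarrow> ('a \<Rightarrow> 'e \<Rightarrow> 'a option) \<Rightarrow> 'a set \<Rightarrow>
    'a option \<Rightarrow> 'a option \<Rightarrow> real" where
  "forest_sum_to wt Out tgt A r t =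
     (\<Sum>f\<in>PiE A Out. of_bool (acyc A (\<lambda>x. tgt x (f x)) \<and> ends A (\<lambda>x. tgt x (f x)) t r) *
        (\<Prod>x\<in>A. wt (f x)))"

lemma sum_PiE_insert:
  fixes h :: "('a \<Rightarrow> 'e) \<Rightarrow> real"
  assumes "y \<notin> A"
  shows "(\<Sum>f\<in>PiE (insert y A) S. h f) = (\<Sum>f\<in>PiE A S. \<Sum>z\<in>S y. h (f(y := z)))"
proof -
  have "(\<Sum>f\<in>PiE (insert y A) S. h f) =
      (\<Sum>f\<in>(\<lambda>(z, g). g(y := z)) ` (S y \<times> PiE A S). h f)"
    by (simp add: PiE_insert_eq)
  also have "\<dots> = (\<Sum>(z, g)\<in>S y \<times> PiE A S. h (g(y := z)))"
    using inj_combinator[OF assms, of S] by (subst sum.reindex) (auto simp: case_prod_unfold)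
  also have "\<dots> = (\<Sum>z\<in>S y. \<Sum>g\<in>PiE A S. h (g(y := z)))"
    by (simp add: sum.cartesian_product)
  also have "\<dots> = (\<Sum>f\<in>PiE A S. \<Sum>z\<in>S y. h (f(y := z)))"
    by (rule sum.swap)
  finally show ?thesis .
qed

context
  fixes wt :: "'e \<Rightarrow> real" and Out :: "'a \<Rightarrow> 'e set" and tgt :: "'a \<Rightarrow> 'e \<Rightarrow> 'a option"
begin

private abbreviation (input) "FS \<equiv> forest_sum wt Out tgt"
private abbreviation (input) "FT \<equiv> forest_sum_to wt Out tgt"

lemma prod_fun_upd_insert:
  assumes "finite A" "y \<notin> A"
  shows "(\<Prod>x\<in>insert y A. wt ((f(y := z)) x)) = wt z * (\<Prod>x\<in>A. wt (f x))"
proof -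
  have "(\<Prod>x\<in>A. wt ((f(y := z)) x)) = (\<Prod>x\<in>A. wt (f x))"
    using assms by (intro prod.cong) auto
  then show ?thesis using assms by simp
qed

lemma ends_acyc_fun_upd:
  assumes "y \<notin> A"
  shows "ends A (\<lambda>x. tgt x ((f(y := z)) x)) t r \<longleftrightarrow> ends A (\<lambda>x. tgt x (f x)) t r"
    "acyc A (\<lambda>x. tgt x ((f(y := z)) x)) \<longleftrightarrow> acyc A (\<lambda>x. tgt x (f x))"
  using assms by (intro ends_cong acyc_cong; auto)+

text \<open>A forest on \<open>A\<close> accepts the edge \<open>z\<close> unless the target of
  \<open>z\<close> already hangs below \<open>y\<close>. For determinants this is a Schur
  complement.\<close>

lemma forest_sum_insert:
  assumes "finite A" "y \<notin> A"
  shows "FS (insert y A) = (\<Sum>z\<in>Out y. wt z * (FS A - FT A (Some y) (tgt y z)))"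
proof -
  have "FS (insert y A) = (\<Sum>f\<in>PiE A Out. \<Sum>z\<in>Out y.
      of_bool (acyc A (\<lambda>x. tgt x (f x)) \<and> \<not> ends A (\<lambda>x. tgt x (f x)) (tgt y z) (Some y)) *
      (wt z * (\<Prod>x\<in>A. wt (f x))))"
    unfolding forest_sum_def sum_PiE_insert[OF assms(2)] prod_fun_upd_insert[OF assms]
      acyc_insert[OF assms(2)] ends_acyc_fun_upd[OF assms(2)] by simp
  also have "\<dots> = (\<Sum>z\<in>Out y. \<Sum>f\<in>PiE A Out.
      of_bool (acyc A (\<lambda>x. tgt x (f x)) \<and> \<not> ends A (\<lambda>x. tgt x (f x)) (tgt y z) (Some y)) *
      (wt z * (\<Prod>x\<in>A. wt (f x))))"
    by (rule sum.swap)
  also have "\<dots> = (\<Sum>z\<in>Out y. wt z * (FS A - FT A (Some y) (tgt y z)))"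
    unfolding forest_sum_def forest_sum_to_def sum_subtractf[symmetric] sum_distrib_left
    by (intro sum.cong refl) auto
  finally show ?thesis .
qed

lemma forest_sum_to_insert:
  assumes "finite A" "y \<notin> A" "r \<noteq> Some y"
  shows "FT (insert y A) r t = (\<Sum>f\<in>PiE A Out. of_bool (acyc A (\<lambda>x. tgt x (f x))) *
      (\<Prod>x\<in>A. wt (f x)) * (\<Sum>z\<in>Out y. wt z * of_bool (\<not> ends A (\<lambda>x. tgt x (f x)) (tgt y z) (Some y)) *
        (of_bool (ends A (\<lambda>x. tgt x (f x)) t r) +
         of_bool (ends A (\<lambda>x. tgt x (f x)) t (Some y)) * of_bool (ends A (\<lambda>x. tgt x (f x)) (tgt y z) r))))"
proof -
  have *: "of_bool (acyc (insert y A) (\<lambda>x. tgt x ((f(y := z)) x)) \<and>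
        ends (insert y A) (\<lambda>x. tgt x ((f(y := z)) x)) t r) =
      (of_bool (acyc A (\<lambda>x. tgt x (f x)) \<and> \<not> ends A (\<lambda>x. tgt x (f x)) (tgt y z) (Some y)) *
        (of_bool (ends A (\<lambda>x. tgt x (f x)) t r) +
         of_bool (ends A (\<lambda>x. tgt x (f x)) t (Some y)) * of_bool (ends A (\<lambda>x. tgt x (f x)) (tgt y z) r)) :: real)"
    (is "?l = ?r") for f z
  proof (cases "acyc (insert y A) (\<lambda>x. tgt x ((f(y := z)) x))")
    case True
    have "\<not> (ends A (\<lambda>x. tgt x (f x)) t r \<and> ends A (\<lambda>x. tgt x (f x)) t (Some y))"
      using ends_unique assms(3) by metis
    moreover have "acyc A (\<lambda>x. tgt x (f x)) \<and> \<not> ends A (\<lambda>x. tgt x (f x)) (tgt y z) (Some y)"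
      using True unfolding acyc_insert[OF assms(2)] ends_acyc_fun_upd[OF assms(2)] by simp
    ultimately show ?thesis
      using True unfolding ends_insert[OF assms(2) True assms(3)] ends_acyc_fun_upd[OF assms(2)] by auto
  next
    case False
    then show ?thesis unfolding acyc_insert[OF assms(2)] ends_acyc_fun_upd[OF assms(2)] by auto
  qed
  show ?thesis
    unfolding forest_sum_to_def sum_PiE_insert[OF assms(2)] prod_fun_upd_insert[OF assms(1,2)] *
      sum_distrib_left
    by (intro sum.cong refl) (auto simp: algebra_simps)
qed

text \<open>
  Remove \<open>y\<close> from \<open>A\<close>: both sides are sums over a forest and two out-edges of \<open>y\<close>, one used by the
  forest and one by the averaging, and exchanging the two edges turns one into the other.
\<close>

lemma forest_sum_to_harmonic:
  assumes "finite A" "y \<in> A" "finite (Out y)"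
  shows "FT A r (Some y) * (\<Sum>z\<in>Out y. wt z) = (\<Sum>z\<in>Out y. wt z * FT A r (tgt y z))"
proof (cases "r = Some y")
  \<comment> \<open>A vertex of \<open>A\<close> is never a root, so both sides vanish.\<close>
  case True
  have "FT A r t = 0" for t
    unfolding forest_sum_to_def using True assms(2) ends_target[of A _ t r]
    by (intro sum.neutral) auto
  then show ?thesis by simp
next
  case False
  define B where "B = A - {y}"
  have B: "finite B" "y \<notin> B" "A = insert y B" using assms by (auto simp: B_def)
  let ?E = "\<lambda>f t r. of_bool (ends B (\<lambda>x. tgt x (f x)) t r) :: real"
  let ?p = "\<lambda>f. of_bool (acyc B (\<lambda>x. tgt x (f x))) * (\<Prod>x\<in>B. wt (f x))"
  define a where "a = (\<lambda>f s. \<Sum>z\<in>Out y. wt z * ?E f (tgt y z) s)"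
  have nE: "of_bool (\<not> ends B (\<lambda>x. tgt x (f x)) t (Some y)) = 1 - ?E f t (Some y)" for f t
    by simp
  \<comment> \<open>A path ends at one root only. This removes the product of the two indicators at
    \<open>tgt y z\<close> from the expansion below.\<close>
  have excl: "?E f t r * ?E f t (Some y) = 0" for f t
    using False ends_unique[of B "\<lambda>x. tgt x (f x)" t r "Some y"] by auto
  have CI: "FT A r t = (\<Sum>f\<in>PiE B Out. ?p f * (?E f t r * ((\<Sum>z\<in>Out y. wt z) - a f (Some y)) +
      ?E f t (Some y) * a f r))" for t
  proof -
    have "(\<Sum>z\<in>Out y. wt z * of_bool (\<not> ends B (\<lambda>x. tgt x (f x)) (tgt y z) (Some y)) *
        (?E f t r + ?E f t (Some y) * ?E f (tgt y z) r)) =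
        ?E f t r * ((\<Sum>z\<in>Out y. wt z) - a f (Some y)) + ?E f t (Some y) * a f r" for f
    proof -
      have "(\<Sum>z\<in>Out y. wt z * of_bool (\<not> ends B (\<lambda>x. tgt x (f x)) (tgt y z) (Some y)) *
          (?E f t r + ?E f t (Some y) * ?E f (tgt y z) r)) =
          (\<Sum>z\<in>Out y. ?E f t r * wt z - ?E f t r * (wt z * ?E f (tgt y z) (Some y)) +
            ?E f t (Some y) * (wt z * ?E f (tgt y z) r))"
        unfolding nE
      proof (intro sum.cong refl)
        fix z
        have "wt z * (1 - ?E f (tgt y z) (Some y)) * (?E f t r + ?E f t (Some y) * ?E f (tgt y z) r) =
            ?E f t r * wt z - ?E f t r * (wt z * ?E f (tgt y z) (Some y)) +
            ?E f t (Some y) * (wt z * ?E f (tgt y z) r) - 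
            wt z * ?E f t (Some y) * (?E f (tgt y z) r * ?E f (tgt y z) (Some y))"
          by (simp only: algebra_simps)
        then show "wt z * (1 - ?E f (tgt y z) (Some y)) * (?E f t r + ?E f t (Some y) * ?E f (tgt y z) r) =
            ?E f t r * wt z - ?E f t r * (wt z * ?E f (tgt y z) (Some y)) +
            ?E f t (Some y) * (wt z * ?E f (tgt y z) r)"
          unfolding excl by simp
      qed
      also have "\<dots> = ?E f t r * ((\<Sum>z\<in>Out y. wt z) - a f (Some y)) + ?E f t (Some y) * a f r"
        unfolding a_def by (simp only: sum.distrib sum_subtractf sum_distrib_left[symmetric] right_diff_distrib)
      finally show ?thesis .
    qed
    then show ?thesis unfolding B(3) forest_sum_to_insert[OF B(1,2) False] by simp
  qed
  have "(\<Sum>z\<in>Out y. wt z * FT A r (tgt y z)) =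
     (\<Sum>f\<in>PiE B Out. \<Sum>z\<in>Out y. wt z * (?p f * (?E f (tgt y z) r * ((\<Sum>z\<in>Out y. wt z) - a f (Some y)) +
      ?E f (tgt y z) (Some y) * a f r)))"
    unfolding CI sum_distrib_left by (rule sum.swap)
  also have "\<dots> = (\<Sum>f\<in>PiE B Out. ?p f * (a f r * ((\<Sum>z\<in>Out y. wt z) - a f (Some y)) +
      a f (Some y) * a f r))"
  proof (intro sum.cong refl)
    fix f
    have "(\<Sum>z\<in>Out y. wt z * (?p f * (?E f (tgt y z) r * ((\<Sum>z\<in>Out y. wt z) - a f (Some y)) +
      ?E f (tgt y z) (Some y) * a f r))) = (\<Sum>z\<in>Out y. ?p f * ((\<Sum>z\<in>Out y. wt z) - a f (Some y)) * (wt z * ?E f (tgt y z) r) + 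
       ?p f * a f r * (wt z * ?E f (tgt y z) (Some y)))"
      by (intro sum.cong refl) (simp only: algebra_simps)
    also have "\<dots> = ?p f * ((\<Sum>z\<in>Out y. wt z) - a f (Some y)) * a f r + ?p f * a f r * a f (Some y)"
      by (subst (2 3) a_def) (simp only: sum.distrib sum_distrib_left)
    finally show "(\<Sum>z\<in>Out y. wt z * (?p f * (?E f (tgt y z) r * ((\<Sum>z\<in>Out y. wt z) - a f (Some y)) +
      ?E f (tgt y z) (Some y) * a f r))) = ?p f * (a f r * ((\<Sum>z\<in>Out y. wt z) - a f (Some y)) +
      a f (Some y) * a f r)"
      by (simp only: algebra_simps)
  qed
  \<comment> \<open>The two terms with \<open>a f (Some y)\<close> cancel. The rest is the sum for
    \<open>t = Some y\<close>, because \<open>y\<close> is a root of the forests on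
    \<open>B\<close>.\<close>
  also have "\<dots> = FT A r (Some y) * (\<Sum>z\<in>Out y. wt z)"
  proof -
    have 1: "?E f (Some y) r = 0" "?E f (Some y) (Some y) = 1" for f
      using B(2) False by (auto simp: ends_outside image_iff)
    show ?thesis
      unfolding CI 1 sum_distrib_right by (intro sum.cong refl) (simp add: algebra_simps)
  qed
  finally show ?thesis by simp
qed

end

lemma forest_sum_to_outside:
  assumes "t \<notin> Some ` A"
  shows "forest_sum_to wt Out tgt A r t = (if r = t then forest_sum wt Out tgt A else 0)"
  using assms by (simp add: forest_sum_to_def forest_sum_def ends_outside)

lemma forest_sum_cong:
  assumes "\<And>x. x \<in> A \<Longrightarrow> Out x = Out' x" "\<And>x e. x \<in> A \<Longrightarrow> e \<in> Out x \<Longrightarrow> tgt x e = tgt' x e"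
  shows "forest_sum wt Out tgt A = forest_sum wt Out' tgt' A"
    "forest_sum_to wt Out tgt A r t = forest_sum_to wt Out' tgt' A r t"
proof -
  have P: "PiE A Out = PiE A Out'" by (intro PiE_cong assms(1))
  have e: "ends A (\<lambda>x. tgt x (f x)) t r = ends A (\<lambda>x. tgt' x (f x)) t r"
    and a: "acyc A (\<lambda>x. tgt x (f x)) = acyc A (\<lambda>x. tgt' x (f x))" if "f \<in> PiE A Out'" for f t r
    using PiE_mem[OF that] assms by (intro ends_cong acyc_cong; metis)+
  show "forest_sum wt Out tgt A = forest_sum wt Out' tgt' A"
    "forest_sum_to wt Out tgt A r t = forest_sum_to wt Out' tgt' A r t"
    unfolding forest_sum_def forest_sum_to_def P by (intro sum.cong refl; simp add: a e)+
qed

context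
  fixes wt :: "'e \<Rightarrow> real" and Out :: "'a \<Rightarrow> 'e set" and A :: "'a set"
  assumes nonneg: "\<And>x e. x \<in> A \<Longrightarrow> e \<in> Out x \<Longrightarrow> wt e \<ge> 0"
begin

lemma prod_wt_nonneg: "f \<in> PiE A Out \<Longrightarrow> (\<Prod>x\<in>A. wt (f x)) \<ge> 0"
  using nonneg by (intro prod_nonneg) auto

lemma forest_sum_nonneg: "forest_sum wt Out tgt A \<ge> 0"
  unfolding forest_sum_def using prod_wt_nonneg by (intro sum_nonneg) auto

lemma forest_sum_to_nonneg: "forest_sum_to wt Out tgt A r t \<ge> 0"
  unfolding forest_sum_to_def using prod_wt_nonneg by (intro sum_nonneg) auto

lemma forest_sum_to_le: "forest_sum_to wt Out tgt A r t \<le> forest_sum wt Out tgt A"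
  unfolding forest_sum_to_def forest_sum_def using prod_wt_nonneg by (intro sum_mono) auto

lemma acyc_kill:
  assumes "acyc A F" "\<And>x. x \<in> A \<Longrightarrow> F' x = F x \<or> F' x = None"
  shows "acyc A F'"
proof -
  have "\<exists>r'. ends A F' t r'" if "ends A F t r" for t r
    using that
  proof (induction rule: ends.induct)
    case (stop t)
    then show ?case by (auto intro: ends.stop)
  next
    case (step x r)
    then show ?case using assms(2)[of x] by (metis ends.step ends.stop imageE option.distinct(1))
  qed
  then show ?thesis using assms(1) unfolding acyc_def by blast
qed

text \<open>Redirecting edges to the root \<open>None\<close> only cuts paths short, so it destroys
  no forest.\<close>

lemma forest_sum_kill_mono:
  assumes "\<And>x e. x \<in> A \<Longrightarrow> e \<in> Out x \<Longrightarrow> tgt' x e = tgt x e \<or> tgt' x e = None"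
  shows "forest_sum wt Out tgt A \<le> forest_sum wt Out tgt' A"
  unfolding forest_sum_def
proof (intro sum_mono mult_right_mono prod_wt_nonneg)
  fix f assume f: "f \<in> PiE A Out"
  have "acyc A (\<lambda>x. tgt' x (f x))" if "acyc A (\<lambda>x. tgt x (f x))"
    using PiE_mem[OF f] assms by (intro acyc_kill[OF that]) metis
  then show "of_bool (acyc A (\<lambda>x. tgt x (f x))) \<le> (of_bool (acyc A (\<lambda>x. tgt' x (f x))) :: real)"
    by simp
qed

text \<open>Positivity of the forest sum plays the role of connectedness: a forest of positive
  weight leads from a point of maximum to a root along edges that preserve the maximum, and at the
  root \<open>\<phi>\<close> is at most 0.\<close>

lemma forest_sum_max_principle:
  assumes A: "finite A" "\<And>x. x \<in> A \<Longrightarrow> finite (Out x)"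
    and pos: "forest_sum wt Out tgt A > 0"
    and sub: "\<And>x. x \<in> A \<Longrightarrow> \<phi> (Some x) * (\<Sum>e\<in>Out x. wt e) \<le> (\<Sum>e\<in>Out x. wt e * \<phi> (tgt x e))"
    and bd: "\<And>x e. x \<in> A \<Longrightarrow> e \<in> Out x \<Longrightarrow> tgt x e \<notin> Some ` A \<Longrightarrow> \<phi> (tgt x e) \<le> 0"
    and x: "x \<in> A"
  shows "\<phi> (Some x) \<le> (0::real)"
proof (rule ccontr)
  assume neg: "\<not> ?thesis"
  define m where "m = Max ((\<lambda>x. \<phi> (Some x)) ` A)"
  have le: "\<phi> (Some y) \<le> m" if "y \<in> A" for y using that A by (auto simp: m_def)
  have mpos: "m > 0" using le[OF x] neg by simp
  have "m \<in> (\<lambda>x. \<phi> (Some x)) ` A" using A x unfolding m_def by (intro Max_in) auto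
  then obtain x0 where x0: "x0 \<in> A" "\<phi> (Some x0) = m" by auto
  obtain f where f: "f \<in> PiE A Out" "of_bool (acyc A (\<lambda>x. tgt x (f x))) * (\<Prod>x\<in>A. wt (f x)) \<noteq> 0"
    using pos unfolding forest_sum_def by (metis (no_types, lifting) less_irrefl sum.neutral)
  then have ac: "acyc A (\<lambda>x. tgt x (f x))" and "(\<Prod>x\<in>A. wt (f x)) \<noteq> 0" by (auto split: if_splits)
  then have nz: "wt (f y) > 0" if "y \<in> A" for y
    using that A(1) nonneg[of y "f y"] f(1) by (auto simp: less_le)
  \<comment> \<open>At a maximum the average is attained only if each edge of positive weight leads
    to a maximum again, and by \<open>bd\<close> a positive value cannot occur outside
    \<open>A\<close>.\<close>
  have flow: "tgt y (f y) \<in> Some ` A \<and> \<phi> (tgt y (f y)) = m" if y: "y \<in> A" "\<phi> (Some y) = m" for y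
  proof -
    have tl: "\<phi> (tgt y e) \<le> m" if "e \<in> Out y" for e
      using le bd[OF y(1) that] mpos by (cases "tgt y e \<in> Some ` A") auto
    have t0: "0 \<le> wt e * (m - \<phi> (tgt y e))" if "e \<in> Out y" for e
      using tl[OF that] nonneg[OF y(1) that] by simp
    have "(\<Sum>e\<in>Out y. wt e * (m - \<phi> (tgt y e))) \<le> 0"
      using sub[OF y(1)] y(2) by (simp add: right_diff_distrib sum_subtractf sum_distrib_left mult.commute)
    then have "(\<Sum>e\<in>Out y. wt e * (m - \<phi> (tgt y e))) = 0"
      using t0 by (meson order_antisym sum_nonneg)
    then have "wt (f y) * (m - \<phi> (tgt y (f y))) = 0"
      using sum_nonneg_eq_0_iff[OF A(2)[OF y(1)], of "\<lambda>e. wt e * (m - \<phi> (tgt y e))"] t0 f(1) y(1) by auto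
    then have "\<phi> (tgt y (f y)) = m" using nz[OF y(1)] by simp
    moreover have "tgt y (f y) \<in> Some ` A"
      using bd[OF y(1), of "f y"] f(1) y(1) mpos calculation by fastforce
    ultimately show ?thesis by simp
  qed
  have "\<not> (\<exists>y\<in>A. t = Some y \<and> \<phi> t = m)" if "ends A (\<lambda>x. tgt x (f x)) t r" for t r
    using that
  proof (induction rule: ends.induct)
    case (stop t)
    then show ?case by auto
  next
    case (step x r)
    then show ?case using flow[of x] by auto
  qed
  then show False using ac x0 unfolding acyc_def by blast
qed

end

section \<open>Positivity of forest sums and lifting to a larger chain\<close>

inductive exits :: "('a \<Rightarrow> 'e set) \<Rightarrow> ('a \<Rightarrow> 'e \<Rightarrow> 'a option) \<Rightarrow> 'a set \<Rightarrow> 'a \<Rightarrow> bool" for Out tgt A where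
  out: "e \<in> Out x \<Longrightarrow> tgt x e \<notin> Some ` A \<Longrightarrow> exits Out tgt A x"
| go: "e \<in> Out x \<Longrightarrow> tgt x e = Some y \<Longrightarrow> y \<in> A \<Longrightarrow> exits Out tgt A y \<Longrightarrow> exits Out tgt A x"

lemma exits_mono: "exits Out tgt A x \<Longrightarrow> B \<subseteq> A \<Longrightarrow> exits Out tgt B x"
proof (induction rule: exits.induct)
  case (out e x)
  then show ?case by (intro exits.out[of e]) auto
next
  case (go e x y)
  then show ?case by (cases "y \<in> B") (auto intro: exits.intros)
qed

lemma exits_last: "exits Out tgt A x \<Longrightarrow> x \<in> A \<Longrightarrow> \<exists>y\<in>A. \<exists>e\<in>Out y. tgt y e \<notin> Some ` A"
  by (induction rule: exits.induct) auto

text \<open>Some vertex has an edge that leaves \<open>A\<close> at once. Such an edge never closes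
  a cycle, so the vertex can be split off; the remaining vertices still exit, since their paths may
  now stop earlier.\<close>

lemma forest_sum_pos:
  fixes wt :: "'e \<Rightarrow> real"
  assumes "finite A" "\<And>x. x \<in> A \<Longrightarrow> finite (Out x)"
    "\<And>x e. x \<in> A \<Longrightarrow> e \<in> Out x \<Longrightarrow> wt e > 0" "\<And>x. x \<in> A \<Longrightarrow> exits Out tgt A x"
  shows "forest_sum wt Out tgt A > 0"
  using assms
proof (induction "card A" arbitrary: A)
  case 0
  then show ?case by (simp add: forest_sum_def acyc_def)
next
  case (Suc n)
  then have "A \<noteq> {}" by auto
  then obtain x e where x: "x \<in> A" "e \<in> Out x" "tgt x e \<notin> Some ` A"
    using exits_last Suc.prems(4) by (metis all_not_in_conv)
  define B where "B = A - {x}"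
  have B: "finite B" "x \<notin> B" "A = insert x B" "B \<subseteq> A" using Suc.prems(1) x(1) by (auto simp: B_def)
  have nn: "\<And>x e. x \<in> B \<Longrightarrow> e \<in> Out x \<Longrightarrow> wt e \<ge> 0" using B(4) Suc.prems(3) by (meson less_imp_le subsetD)
  have "n = card B" using Suc.hyps(2) B by (metis card_insert_disjoint diff_Suc_1)
  then have WB: "forest_sum wt Out tgt B > 0"
    using Suc.prems B(1,4) exits_mono[of Out tgt A _ B] by (intro Suc.hyps(1)) blast+
  have "0 < wt e * (forest_sum wt Out tgt B - forest_sum_to wt Out tgt B (Some x) (tgt x e))"
    using x B WB Suc.prems(3)[OF x(1,2)] by (subst forest_sum_to_outside) (auto simp: image_iff)
  also have "\<dots> \<le> forest_sum wt Out tgt A"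
    unfolding B(3) forest_sum_insert[OF B(1,2)]
  proof (rule member_le_sum)
    fix z assume "z \<in> Out x - {e}"
    then have "0 \<le> wt z" using Suc.prems(3)[OF x(1)] by (auto intro: less_imp_le)
    then show "0 \<le> wt z * (forest_sum wt Out tgt B - forest_sum_to wt Out tgt B (Some x) (tgt x z))"
      using forest_sum_to_le[of B Out wt tgt, OF nn] by simp
  qed (use x Suc.prems in auto)
  finally show ?case .
qed

text \<open>
  Adding the out-edges of one vertex \<open>u\<close> of \<open>U\<close> multiplies both sums by the same factor: it is given by
  the harmonic function with boundary value 1 at \<open>u\<close>, and this function is lifted by \<open>\<pi>\<close> because
  the maximum principle makes it unique.
\<close>

lemma forest_sum_lift:
  fixes wt :: "'e \<Rightarrow> real" and Out :: "'a \<Rightarrow> 'e set" and Out' :: "'b \<Rightarrow> 'e set"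
  assumes fin: "finite X" "finite Y" "\<And>x. x \<in> X \<Longrightarrow> finite (Out x)" "\<And>y. y \<in> Y \<Longrightarrow> finite (Out' y)"
    and nn: "\<And>x e. x \<in> X \<Longrightarrow> e \<in> Out x \<Longrightarrow> wt e \<ge> 0" "\<And>y e. y \<in> Y \<Longrightarrow> e \<in> Out' y \<Longrightarrow> wt e \<ge> 0"
    and pr: "\<And>y x. y \<in> Y \<Longrightarrow> \<pi> y = Some x \<Longrightarrow> x \<in> X \<and> Out' y = Out x"
      "\<And>y x e. y \<in> Y \<Longrightarrow> \<pi> y = Some x \<Longrightarrow> e \<in> Out x \<Longrightarrow> Option.bind (tgt' y e) \<pi> = tgt x e"
      "\<And>y e. y \<in> Y \<Longrightarrow> \<pi> y = None \<Longrightarrow> e \<in> Out' y \<Longrightarrow> Option.bind (tgt' y e) \<pi> = None"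
    and cl: "\<And>y e. y \<in> Y \<Longrightarrow> e \<in> Out' y \<Longrightarrow> tgt' y e \<in> insert None (Some ` Y)"
    and U: "U \<subseteq> X" "\<And>u. u \<in> U \<Longrightarrow> s u \<in> Y \<and> \<pi> (s u) = Some u" "\<And>u y. u \<in> U \<Longrightarrow> y \<in> Y \<Longrightarrow> \<pi> y = Some u \<Longrightarrow> y = s u"
    and pos: "forest_sum wt Out tgt (X - U) > 0"
  shows "forest_sum wt Out' tgt' Y * forest_sum wt Out tgt (X - U) =
    forest_sum wt Out tgt X * forest_sum wt Out' tgt' (Y - s ` U)"
proof -
  let ?W = "forest_sum wt Out tgt" and ?V = "forest_sum wt Out' tgt'"
  \<comment> \<open>The vertices of \<open>U\<close> are added one at a time on both sides;
    \<open>B\<close> is the set already added.\<close>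
  have "?V (Y - s ` (U - B)) * ?W (X - U) = ?W (X - (U - B)) * ?V (Y - s ` U)" if "finite B" "B \<subseteq> U" for B
    using that
  proof (induction rule: finite_induct)
    case (insert i B)
    define A A' where "A = X - (U - B)" and "A' = Y - s ` (U - B)"
    have i: "i \<in> U" "i \<in> X" "i \<notin> B" "i \<notin> A" using insert U(1) by (auto simp: A_def)
    have IH: "?V A' * ?W (X - U) = ?W A * ?V (Y - s ` U)" using insert by (simp add: A_def A'_def)
    have sinj: "s u = s v \<longleftrightarrow> u = v" if "u \<in> U" "v \<in> U" for u v using that U(2) by (metis option.inject)
    have si: "s i \<notin> A'" "s i \<in> Y" using i U(2)[of i] by (auto simp: A'_def)
    have AI: "X - (U - insert i B) = insert i A" using i by (auto simp: A_def)
    have AI': "Y - s ` (U - insert i B) = insert (s i) A'" using i si sinj by (auto simp: A'_def)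
    have fA: "finite A" "finite A'" using fin by (auto simp: A_def A'_def)
    have nA: "\<And>x e. x \<in> A \<Longrightarrow> e \<in> Out x \<Longrightarrow> wt e \<ge> 0" "\<And>x e. x \<in> A' \<Longrightarrow> e \<in> Out' x \<Longrightarrow> wt e \<ge> 0"
      using nn by (auto simp: A_def A'_def)
    define d where "d = forest_sum_to wt Out tgt A (Some i)"
    define d' where "d' = forest_sum_to wt Out' tgt' A' (Some (s i))"
    have dN: "d None = 0" "d' None = 0" by (auto simp: d_def d'_def forest_sum_to_outside)
    have d0: "0 \<le> d t" "d t \<le> ?W A" "0 \<le> d' t'" "d' t' \<le> ?V A'" for t t'
      using nA by (auto simp: d_def d'_def intro!: forest_sum_to_nonneg forest_sum_to_le)
    \<comment> \<open>Difference of the two normalised harmonic functions, multiplied by both forest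
      sums so that it makes sense even if one of them is 0.\<close>
    define \<phi> where "\<phi> t = d' t * ?W A - d (Option.bind t \<pi>) * ?V A'" for t
    have root: "\<phi> t = 0" if t: "t \<notin> Some ` A'" "t \<in> insert None (Some ` Y)" for t
    proof (cases t)
      case None
      then show ?thesis using dN by (simp add: \<phi>_def)
    next
      case (Some y)
      then obtain u where u: "u \<in> U" "u \<notin> B" "y = s u" using t by (auto simp: A'_def)
      then have "d' t = (if u = i then ?V A' else 0)" "d (Some u) = (if u = i then ?W A else 0)"
        using t Some sinj i u by (auto simp: d_def d'_def forest_sum_to_outside A_def image_iff)
      then show ?thesis using U(2)[OF u(1)] u Some by (simp add: \<phi>_def)
    qed
    have harm: "\<phi> (Some y) * (\<Sum>e\<in>Out' y. wt e) = (\<Sum>e\<in>Out' y. wt e * \<phi> (tgt' y e))" if y: "y \<in> A'" for y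
    proof -
      have yY: "y \<in> Y" using y by (auto simp: A'_def)
      have h': "d' (Some y) * (\<Sum>e\<in>Out' y. wt e) = (\<Sum>e\<in>Out' y. wt e * d' (tgt' y e))"
        unfolding d'_def using fA y fin(4)[OF yY] by (intro forest_sum_to_harmonic) auto
      have h: "d (Option.bind (Some y) \<pi>) * (\<Sum>e\<in>Out' y. wt e) = (\<Sum>e\<in>Out' y. wt e * d (Option.bind (tgt' y e) \<pi>))"
      proof (cases "\<pi> y")
        case None
        then show ?thesis using pr(3)[OF yY None] dN by simp
      next
        case (Some x)
        then have x: "x \<in> X" "Out' y = Out x" using pr(1)[OF yY] by auto
        have "x \<in> A" using U(3)[of x y] yY Some y x by (auto simp: A_def A'_def)
        then have "d (Some x) * (\<Sum>e\<in>Out x. wt e) = (\<Sum>e\<in>Out x. wt e * d (tgt x e))"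
          unfolding d_def using fA fin(3)[OF x(1)] by (intro forest_sum_to_harmonic) auto
        then show ?thesis using pr(2)[OF yY Some] x Some by simp
      qed
      have "\<phi> (Some y) * (\<Sum>e\<in>Out' y. wt e) = (d' (Some y) * (\<Sum>e\<in>Out' y. wt e)) * ?W A -
          (d (Option.bind (Some y) \<pi>) * (\<Sum>e\<in>Out' y. wt e)) * ?V A'"
        by (simp add: \<phi>_def algebra_simps)
      then show ?thesis unfolding h h'
        by (simp only: \<phi>_def sum_distrib_right right_diff_distrib sum_subtractf mult.assoc)
    qed
    have \<phi>0: "\<phi> t = 0" if "t \<in> insert None (Some ` Y)" for t
    \<comment> \<open>The maximum principle needs a positive forest sum. If the sum vanishes, so
      does \<open>d'\<close>, which it dominates.\<close>
    proof (cases "?V A' = 0")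
      case True
      then show ?thesis using d0(3,4)[of t] by (simp add: \<phi>_def)
    next
      case False
      then have vpos: "?V A' > 0" using d0(3,4)[of None] by linarith
      show ?thesis
      proof (cases "t \<in> Some ` A'")
        case True
        then obtain y where y: "y \<in> A'" "t = Some y" by auto
        have sub: "A' \<subseteq> Y" by (auto simp: A'_def)
        have "\<phi> (Some y) \<le> 0"
          using fA fin(4) vpos harm root cl sub y(1)
          by (intro forest_sum_max_principle[of A' Out' wt tgt' \<phi>, OF nA(2)]) (auto simp: subset_iff)
        moreover have "- \<phi> (Some y) \<le> 0"
        proof (rule forest_sum_max_principle[of A' Out' wt tgt' "\<lambda>t. - \<phi> t", OF nA(2)])
          show "- \<phi> (Some x) * (\<Sum>e\<in>Out' x. wt e) \<le> (\<Sum>e\<in>Out' x. wt e * - \<phi> (tgt' x e))" if "x \<in> A'" for x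
            using harm[OF that] by (simp add: sum_negf)
        qed (use fA fin(4) vpos root cl sub y(1) in \<open>auto simp: subset_iff\<close>)
        ultimately show ?thesis using y by simp
      next
        case False
        then show ?thesis using root that by simp
      qed
    qed
    have key: "?V (insert (s i) A') * ?W A = ?V A' * ?W (insert i A)"
    proof -
      have O: "Out' (s i) = Out i" using pr(1)[OF si(2)] U(2)[OF i(1)] by auto
      have "?V (insert (s i) A') * ?W A = (\<Sum>e\<in>Out i. wt e * ((?V A' - d' (tgt' (s i) e)) * ?W A))"
        unfolding forest_sum_insert[OF fA(2) si(1)] d'_def[symmetric] O sum_distrib_right
        by (simp only: mult.assoc)
      also have "\<dots> = (\<Sum>e\<in>Out i. wt e * ((?W A - d (tgt i e)) * ?V A'))"
      proof (rule sum.cong[OF refl], rule arg_cong[of _ _ "\<lambda>z. _ * z"])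
        fix e assume e: "e \<in> Out i"
        then have "\<phi> (tgt' (s i) e) = 0" using cl[OF si(2), of e] O by (intro \<phi>0) auto
        moreover have "Option.bind (tgt' (s i) e) \<pi> = tgt i e" using pr(2)[OF si(2) _ e] U(2)[OF i(1)] by simp
        ultimately show "(?V A' - d' (tgt' (s i) e)) * ?W A = (?W A - d (tgt i e)) * ?V A'"
          by (simp add: \<phi>_def algebra_simps)
      qed
      also have "\<dots> = ?V A' * ?W (insert i A)"
        unfolding forest_sum_insert[OF fA(1) i(4)] d_def[symmetric] sum_distrib_left
        by (simp only: mult.assoc mult.commute mult.left_commute)
      finally show ?thesis .
    qed
    have "?V (insert (s i) A') * ?W (X - U) = ?W (insert i A) * ?V (Y - s ` U)"
    \<comment> \<open>If \<open>?W A\<close> is not 0, it cancels from the product of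
      \<open>key\<close> with the induction hypothesis. If it is 0, the hypothesis forces
      \<open>?V A' = 0\<close>, and both new sums vanish by their expansions.\<close>
    proof (cases "?W A = 0")
      case False
      have "?W A * (?V (insert (s i) A') * ?W (X - U)) = ?W A * (?W (insert i A) * ?V (Y - s ` U))"
        using arg_cong[OF key, of "\<lambda>z. z * ?W (X - U)"] arg_cong[OF IH, of "\<lambda>z. ?W (insert i A) * z"]
        by (simp only: mult_ac)
      then show ?thesis using False by simp
    next
      case True
      then have "?V A' = 0" using IH pos by simp
      then have "d' t = 0" "d t' = 0" for t t' using d0(3,4)[of t] d0(1,2)[of t'] True by auto
      then have "?V (insert (s i) A') = 0" "?W (insert i A) = 0"
        unfolding forest_sum_insert[OF fA(2) si(1)] forest_sum_insert[OF fA(1) i(4)] d'_def[symmetric] d_def[symmetric]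
        using True \<open>?V A' = 0\<close> by auto
      then show ?thesis by simp
    qed
    then show ?case unfolding AI AI' .
  qed simp
  from this[of U] show ?thesis using fin(1) U(1) finite_subset by auto
qed

section \<open>Killing on two nested sets\<close>

definition arc_target :: "('e \<Rightarrow> 'v) \<Rightarrow> 'e set \<Rightarrow> 'e \<Rightarrow> 'v option" where
  "arc_target dst E e = (if e \<in> E then Some (dst e) else None)"

text \<open>In the application \<open>X\<close> and \<open>Y\<close> are the vertices of a domain
  and of a smaller one, \<open>E\<close> and \<open>F\<close> the edges drawn inside them. The
  assumptions \<open>U\<close> keep the edges that leave the smaller domain away from
  \<open>U\<close> at both ends, so a walk is outside \<open>U\<close> when it changes to the second
  layer.\<close>

locale nested_killing =
  fixes wt :: "'e \<Rightarrow> real" and Out :: "'v \<Rightarrow> 'e set" and dst :: "'e \<Rightarrow> 'v"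
    and X Y U :: "'v set" and E F :: "'e set"
  assumes fin: "finite X" "\<And>x. x \<in> X \<Longrightarrow> finite (Out x)"
    and sub: "Y \<subseteq> X" "U \<subseteq> Y"
    and wt: "\<And>x e. x \<in> X \<Longrightarrow> e \<in> Out x \<Longrightarrow> wt e > 0" "\<And>x. x \<in> X \<Longrightarrow> (\<Sum>e\<in>Out x. wt e) = 1"
    and E: "\<And>x e. x \<in> X \<Longrightarrow> e \<in> Out x \<Longrightarrow> e \<in> E \<Longrightarrow> dst e \<in> X"
    and F: "\<And>x e. x \<in> Y \<Longrightarrow> e \<in> Out x \<Longrightarrow> e \<in> F \<Longrightarrow> e \<in> E \<and> dst e \<in> Y"
    and U: "\<And>x. x \<in> U \<Longrightarrow> Out x \<subseteq> F" "\<And>x e. x \<in> Y \<Longrightarrow> e \<in> Out x \<Longrightarrow> e \<in> E \<Longrightarrow> e \<notin> F \<Longrightarrow> dst e \<notin> U"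
    and exits: "\<And>x. x \<in> X \<Longrightarrow> exits Out (\<lambda>_. arc_target dst E) X x"
begin

text \<open>The two layers record whether the walk has used an edge outside \<open>F\<close> since its last visit
  to \<open>U\<close>; returns to \<open>U\<close> from the second layer are kept only at vertices in \<open>B\<close>.\<close>

definition layers :: "('v \<times> bool) set" where
  "layers = Y \<times> {False} \<union> (X - U) \<times> {True}"

definition ltgt :: "'v set \<Rightarrow> 'v \<times> bool \<Rightarrow> 'e \<Rightarrow> ('v \<times> bool) option" where
  "ltgt B p e =
     (if e \<notin> E then None
      else if snd p then (if dst e \<in> U then (if fst p \<in> B then Some (dst e, False) else None) else Some (dst e, True))
      else Some (dst e, e \<notin> F))"

lemma finite_layers: "finite layers"
  using fin(1) finite_subset[OF sub(1)] by (simp add: layers_def)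

lemma layers_fst: "p \<in> layers \<Longrightarrow> fst p \<in> X"
  using sub by (auto simp: layers_def)

lemma ltgt_closed: "p \<in> layers \<Longrightarrow> e \<in> Out (fst p) \<Longrightarrow> ltgt B p e \<in> insert None (Some ` layers)"
proof -
  assume p: "p \<in> layers" and e: "e \<in> Out (fst p)"
  obtain x b where xb: "p = (x, b)" by (cases p)
  have x: "x \<in> X" "e \<in> Out x" using layers_fst[OF p] e xb by auto
  show "ltgt B p e \<in> insert None (Some ` layers)"
  proof (cases "e \<in> E \<and> \<not> b")
    case True
    then have "x \<in> Y" using p xb by (auto simp: layers_def)
    then show ?thesis
      using True E[OF x] F[of x e] U(2)[of x e] x xb by (cases "e \<in> F") (auto simp: layers_def ltgt_def)
  next
    case False
    then show ?thesis using E[OF x] sub xb by (auto simp: layers_def ltgt_def subset_iff)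
  qed
qed

lemma ltgt_kill: "ltgt B p e = ltgt X p e \<or> ltgt B p e = None" if "p \<in> layers"
  using layers_fst[OF that] by (auto simp: ltgt_def)

text \<open>With all returns kept, the layered chain is a lift of the walk in \<open>X\<close>, so
  exit paths lift as well.\<close>

lemma exits_layers:
  assumes "p \<in> layers"
  shows "exits (Out \<circ> fst) (ltgt X) layers p"
proof -
  have "\<forall>b. (x, b) \<in> layers \<longrightarrow> exits (Out \<circ> fst) (ltgt X) layers (x, b)"
    if "exits Out (\<lambda>_. arc_target dst E) X x" "x \<in> X" for x
    using that
  proof (induction rule: exits.induct)
    case (out e x)
    then have "e \<notin> E" using E by (auto simp: arc_target_def)
    then show ?case using out by (auto intro!: exits.out[of e] simp: ltgt_def)
  next
    case (go e x y)
    then have e: "e \<in> E" "dst e = y" by (auto simp: arc_target_def split: if_splits)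
    show ?case
    proof (intro allI impI)
      fix b assume b: "(x, b) \<in> layers"
      obtain b' where t: "ltgt X (x, b) e = Some (y, b')"
        using e go.prems by (cases b; cases "dst e \<in> U") (auto simp: ltgt_def)
      then have "(y, b') \<in> layers" using ltgt_closed[OF b, of e X] go.hyps by auto
      then show "exits (Out \<circ> fst) (ltgt X) layers (x, b)"
        using t go.hyps(1,3) go.IH exits.go[of e "Out \<circ> fst" "(x, b)" "ltgt X" "(y, b')" layers]
        by (simp add: comp_def)
    qed
  qed
  from this[of "fst p"] show ?thesis using exits layers_fst[OF assms] assms by (metis prod.collapse)
qed

text \<open>An exit path in \<open>X\<close> is followed up to its first edge outside
  \<open>F\<close>, where the inner walk is killed.\<close>

lemma exits_inner: "x \<in> Y \<Longrightarrow> exits Out (\<lambda>_. arc_target dst F) Y x"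
proof -
  assume x: "x \<in> Y"
  have *: "x \<in> Y \<longrightarrow> exits Out (\<lambda>_. arc_target dst F) Y x"
    if "exits Out (\<lambda>_. arc_target dst E) X x" "x \<in> X" for x
    using that
  proof (induction rule: exits.induct)
    case (out e x)
    then have "e \<notin> E" using E by (auto simp: arc_target_def)
    then have "x \<in> Y \<Longrightarrow> e \<notin> F" using F[of x e] out by blast
    then show ?case using out by (auto intro!: exits.out[of e] simp: arc_target_def)
  next
    case (go e x y)
    then have e: "e \<in> E" "dst e = y" by (auto simp: arc_target_def split: if_splits)
    show ?case
    proof (cases "e \<in> F")
      case True
      show ?thesis
      proof
        assume "x \<in> Y"
        then have "y \<in> Y" using F[of x e] go.hyps(1) True e by auto
        moreover have "exits Out (\<lambda>_. arc_target dst F) Y y" using go.IH go.hyps(3) calculation by simp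
        ultimately show "exits Out (\<lambda>_. arc_target dst F) Y x"
          using exits.go[of e Out x "\<lambda>_. arc_target dst F" y Y] go.hyps(1) True e by (simp add: arc_target_def)
      qed
    next
      case False
      then show ?thesis using go by (auto intro!: exits.out[of e] simp: arc_target_def)
    qed
  qed
  have "x \<in> X" using x sub by auto
  from *[OF exits[OF this] this] x show "exits Out (\<lambda>_. arc_target dst F) Y x" by simp
qed

abbreviation lsum :: "('v \<Rightarrow> 'e set) \<Rightarrow> 'v set \<Rightarrow> real" where
  "lsum R B \<equiv> forest_sum wt (R \<circ> fst) (ltgt B) layers"

lemma nonneg: "x \<in> X \<Longrightarrow> e \<in> Out x \<Longrightarrow> wt e \<ge> 0"
  using wt(1) by (meson less_imp_le)

lemma nonneg_layers: "p \<in> layers \<Longrightarrow> e \<in> (Out \<circ> fst) p \<Longrightarrow> wt e \<ge> 0"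
  using nonneg[OF layers_fst] by simp

lemma lsum_pos: "lsum Out X > 0"
  using finite_layers fin(2)[OF layers_fst] wt(1)[OF layers_fst] exits_layers
  by (intro forest_sum_pos) auto

text \<open>Forgetting the layer projects the chain with all returns onto the walk in
  \<open>X\<close>, and a vertex of \<open>U\<close> has only one copy. The rows outside
  \<open>U\<close> are the same for \<open>R\<close> and \<open>Out\<close>, so the factors without
  the vertices of \<open>U\<close> do not depend on \<open>R\<close>.\<close>

lemma lift_outer:
  assumes R: "\<And>x. x \<in> X \<Longrightarrow> R x \<subseteq> Out x" "\<And>x. x \<notin> U \<Longrightarrow> R x = Out x"
  shows "lsum R X * forest_sum wt Out (\<lambda>_. arc_target dst E) (X - U) =
    forest_sum wt R (\<lambda>_. arc_target dst E) X * forest_sum wt (Out \<circ> fst) (ltgt X) (layers - U \<times> {False})"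
proof -
  have pos: "forest_sum wt Out (\<lambda>_. arc_target dst E) (X - U) > 0"
    using fin wt exits_mono[OF exits, of _ "X - U"] by (intro forest_sum_pos) auto
  have eq: "forest_sum wt R (\<lambda>_. arc_target dst E) (X - U) = forest_sum wt Out (\<lambda>_. arc_target dst E) (X - U)"
    using R by (intro forest_sum_cong) auto
  have im: "(\<lambda>u. (u, False)) ` U = U \<times> {False}" by auto
  have "lsum R X * forest_sum wt R (\<lambda>_. arc_target dst E) (X - U) =
    forest_sum wt R (\<lambda>_. arc_target dst E) X * forest_sum wt (R \<circ> fst) (ltgt X) (layers - (\<lambda>u. (u, False)) ` U)"
  proof (rule forest_sum_lift[where \<pi> = "\<lambda>p. Some (fst p)"])
    show "finite (R x)" if "x \<in> X" for x using fin(2)[OF that] R(1)[OF that] finite_subset by blast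
    then show "finite ((R \<circ> fst) p)" if "p \<in> layers" for p using layers_fst[OF that] by simp
    show nn: "0 \<le> wt e" if "x \<in> X" "e \<in> R x" for x e using that R(1) nonneg by blast
    show "0 \<le> wt e" if "p \<in> layers" "e \<in> (R \<circ> fst) p" for p e using nn[OF layers_fst[OF that(1)]] that(2) by simp
    show "Option.bind (ltgt X p e) (\<lambda>p. Some (fst p)) = arc_target dst E e"
      if "p \<in> layers" "Some (fst p) = Some x" "e \<in> R x" for p x e
      using that layers_fst[OF that(1)] by (auto simp: ltgt_def arc_target_def)
    show "ltgt X p e \<in> insert None (Some ` layers)" if "p \<in> layers" "e \<in> (R \<circ> fst) p" for p e
      using that R(1)[OF layers_fst[OF that(1)]] by (intro ltgt_closed) auto
    show "p = (u, False)" if "u \<in> U" "p \<in> layers" "Some (fst p) = Some u" for u p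
      using that by (auto simp: layers_def)
  qed (use finite_layers fin sub layers_fst pos eq in \<open>auto simp: layers_def\<close>)
  moreover have "forest_sum wt (R \<circ> fst) (ltgt X) (layers - U \<times> {False}) =
      forest_sum wt (Out \<circ> fst) (ltgt X) (layers - U \<times> {False})"
  proof (rule forest_sum_cong(1))
    fix p assume "p \<in> layers - U \<times> {False}"
    then have "fst p \<notin> U" by (auto simp: layers_def)
    then show "(R \<circ> fst) p = (Out \<circ> fst) p" using R(2) by simp
  qed simp
  ultimately show ?thesis unfolding eq im by simp
qed

text \<open>Without returns the second layer never comes back to \<open>U\<close>, so for the rows
  of \<open>U\<close> it is as good as the cemetery; hence the projection to
  \<open>None\<close>.\<close>

lemma lift_inner:
  assumes R: "\<And>x. x \<in> X \<Longrightarrow> R x \<subseteq> Out x" "\<And>x. x \<notin> U \<Longrightarrow> R x = Out x"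
  shows "lsum R {} * forest_sum wt Out (\<lambda>_. arc_target dst F) (Y - U) =
    forest_sum wt R (\<lambda>_. arc_target dst F) Y * forest_sum wt (Out \<circ> fst) (ltgt {}) (layers - U \<times> {False})"
proof -
  have pos: "forest_sum wt Out (\<lambda>_. arc_target dst F) (Y - U) > 0"
    using fin wt exits_mono[OF exits_inner, of _ "Y - U"] sub finite_subset[OF sub(1)] by (intro forest_sum_pos) auto
  have eq: "forest_sum wt R (\<lambda>_. arc_target dst F) (Y - U) = forest_sum wt Out (\<lambda>_. arc_target dst F) (Y - U)"
    using R by (intro forest_sum_cong) auto
  have im: "(\<lambda>u. (u, False)) ` U = U \<times> {False}" by auto
  have "lsum R {} * forest_sum wt R (\<lambda>_. arc_target dst F) (Y - U) =
    forest_sum wt R (\<lambda>_. arc_target dst F) Y * forest_sum wt (R \<circ> fst) (ltgt {}) (layers - (\<lambda>u. (u, False)) ` U)"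
  proof (rule forest_sum_lift[where \<pi> = "\<lambda>p. if snd p then None else Some (fst p)"])
    have fR: "finite (R x)" if "x \<in> X" for x using fin(2)[OF that] R(1)[OF that] finite_subset by blast
    then show "finite (R x)" if "x \<in> Y" for x using that sub by blast
    show "finite ((R \<circ> fst) p)" if "p \<in> layers" for p using fR layers_fst[OF that] by simp
    have nn: "0 \<le> wt e" if "x \<in> X" "e \<in> R x" for x e using that R(1) nonneg by blast
    then show "0 \<le> wt e" if "x \<in> Y" "e \<in> R x" for x e using that sub by blast
    show "0 \<le> wt e" if "p \<in> layers" "e \<in> (R \<circ> fst) p" for p e using nn[OF layers_fst[OF that(1)]] that(2) by simp
    show "Option.bind (ltgt {} p e) (\<lambda>p. if snd p then None else Some (fst p)) = arc_target dst F e"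
      if "p \<in> layers" "(if snd p then None else Some (fst p)) = Some x" "e \<in> R x" for p x e
    proof -
      have "x \<in> Y" "p = (x, False)" using that(1,2) by (auto simp: layers_def split: if_splits)
      then show ?thesis using F[of x e] R(1)[of x] that(3) sub by (auto simp: ltgt_def arc_target_def)
    qed
    show "ltgt {} p e \<in> insert None (Some ` layers)" if "p \<in> layers" "e \<in> (R \<circ> fst) p" for p e
      using that R(1)[OF layers_fst[OF that(1)]] by (intro ltgt_closed) auto
  qed (use finite_layers fin sub finite_subset[OF sub(1)] layers_fst pos eq in
      \<open>auto simp: layers_def ltgt_def split: if_splits\<close>)
  moreover have "forest_sum wt (R \<circ> fst) (ltgt {}) (layers - U \<times> {False}) =
      forest_sum wt (Out \<circ> fst) (ltgt {}) (layers - U \<times> {False})"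
  proof (rule forest_sum_cong(1))
    fix p assume "p \<in> layers - U \<times> {False}"
    then have "fst p \<notin> U" by (auto simp: layers_def)
    then show "(R \<circ> fst) p = (Out \<circ> fst) p" using R(2) by simp
  qed simp
  ultimately show ?thesis unfolding eq im by simp
qed

definition return_weight :: "'v \<Rightarrow> real" where
  "return_weight x = (\<Sum>e\<in>{e \<in> Out x. e \<in> E \<and> dst e \<in> U}. wt e)"

lemma lsum_row:
  assumes p: "p \<in> layers"
  defines "A \<equiv> layers - {p}"
  shows "lsum Out B = (\<Sum>e\<in>Out (fst p). wt e * (forest_sum wt (Out \<circ> fst) (ltgt B) A -
    forest_sum_to wt (Out \<circ> fst) (ltgt B) A (Some p) (ltgt B p e)))"
proof -
  have "layers = insert p A" "p \<notin> A" "finite A" using p finite_layers by (auto simp: A_def)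
  then show ?thesis using forest_sum_insert[of A p wt "Out \<circ> fst" "ltgt B"] by simp
qed

text \<open>
  The returns to \<open>U\<close> are restored one vertex at a time. The function \<open>g\<close> collects the costs; it is
  bounded by the expected number of returns, as it is a subsolution of the corresponding equation
  for the walk with all returns.
\<close>

lemma returns_bound:
  assumes B: "finite B" "B \<subseteq> X - U" and u: "u\<^sub>0 \<in> U" and C: "C \<ge> 0"
    and harnack: "\<And>g u. (\<And>x. x \<in> Y \<Longrightarrow> g x \<ge> 0) \<Longrightarrow>
      (\<And>x. x \<in> Y \<Longrightarrow> Out x \<subseteq> F \<Longrightarrow> g x = (\<Sum>e\<in>Out x. wt e * g (dst e))) \<Longrightarrow> u \<in> U \<Longrightarrow> g u \<le> C * g u\<^sub>0"
  shows "\<exists>g::('v \<times> bool) option \<Rightarrow> real. (\<forall>t. g t \<ge> 0) \<and> g None = 0 \<and>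
    (\<forall>p\<in>layers. g (Some p) \<le> (\<Sum>e\<in>Out (fst p). wt e * g (ltgt X p e)) +
      (if snd p \<and> fst p \<in> B then return_weight (fst p) else 0)) \<and>
    lsum Out B \<ge> lsum Out {} * (1 - C * g (Some (u\<^sub>0, False)))"
  using B
proof (induction rule: finite_induct)
  case empty
  show ?case by (rule exI[of _ "\<lambda>_. 0"]) auto
next
  case (insert z B)
  then have "B \<subseteq> X - U" by auto
  from insert.IH[OF this] obtain g where g: "\<forall>t. g t \<ge> 0" "g None = 0"
    "\<forall>p\<in>layers. g (Some p) \<le> (\<Sum>e\<in>Out (fst p). wt e * g (ltgt X p e)) +
      (if snd p \<and> fst p \<in> B then return_weight (fst p) else 0)"
    "lsum Out B \<ge> lsum Out {} * (1 - C * g (Some (u\<^sub>0, False)))" by blast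
  have z: "z \<in> X" "z \<notin> U" "z \<notin> B" "(z, True) \<in> layers" using insert by (auto simp: layers_def)
  define A where "A = layers - {(z, True)}"
  have A: "finite A" "(z, True) \<notin> A" "layers = insert (z, True) A"
    using finite_layers z by (auto simp: A_def)
  \<comment> \<open>With \<open>(z, True)\<close> turned into a root, \<open>d\<close> is, up to the
    factor \<open>w\<close>, the probability of reaching it before being killed.\<close>
  define d where "d = forest_sum_to wt (Out \<circ> fst) (ltgt B) A (Some (z, True))"
  define w where "w = forest_sum wt (Out \<circ> fst) (ltgt B) A"
  have nnA: "p \<in> A \<Longrightarrow> e \<in> (Out \<circ> fst) p \<Longrightarrow> wt e \<ge> 0" for p e
    using nonneg_layers[of p e] by (auto simp: A_def)
  have d0: "d t \<ge> 0" for t unfolding d_def using nnA by (intro forest_sum_to_nonneg) auto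
  have dN: "d None = 0" by (simp add: d_def forest_sum_to_outside)
  have dz: "d (Some (z, True)) = w"
    using A(2) by (simp add: d_def w_def forest_sum_to_outside image_iff)
  \<comment> \<open>\<open>ltgt B\<close> and \<open>ltgt (insert z B)\<close> differ only in the
    row of \<open>(z, True)\<close>, which is absent from \<open>A\<close>.\<close>
  have w_eq: "forest_sum wt (Out \<circ> fst) (ltgt (insert z B)) A = w"
    "forest_sum_to wt (Out \<circ> fst) (ltgt (insert z B)) A (Some (z, True)) t = d t" for t
    unfolding w_def d_def by (intro forest_sum_cong; auto simp: ltgt_def A_def layers_def)+
  have rowB: "lsum Out B = (\<Sum>e\<in>Out z. wt e * (w - d (ltgt B (z, True) e)))"
    using lsum_row[OF z(4), of B] by (simp add: A_def d_def w_def)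
  have rowBz: "lsum Out (insert z B) = (\<Sum>e\<in>Out z. wt e * (w - d (ltgt (insert z B) (z, True) e)))"
    using lsum_row[OF z(4), of "insert z B"] w_eq unfolding A_def by simp
  have harm: "d (Some p) = (\<Sum>e\<in>Out (fst p). wt e * d (ltgt B p e))" if "p \<in> A" for p
  proof -
    have "fst p \<in> X" using that layers_fst by (auto simp: A_def)
    then show ?thesis
      using forest_sum_to_harmonic[of A p "Out \<circ> fst" wt "ltgt B" "Some (z, True)"] that A(1) fin(2) wt(2)
      by (simp add: d_def)
  qed
  \<comment> \<open>The cost of a return depends on the vertex of \<open>U\<close> where it lands;
    Harnack's inequality replaces that vertex by \<open>u\<^sub>0\<close>. It applies because edges
    in \<open>F\<close> stay in the first layer.\<close>
  have duC: "d (Some (u, False)) \<le> C * d (Some (u\<^sub>0, False))" if "u \<in> U" for u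
  proof (rule harnack[of "\<lambda>x. d (Some (x, False))", OF _ _ that])
    fix x assume x: "x \<in> Y" "Out x \<subseteq> F"
    then have "(x, False) \<in> A" by (auto simp: A_def layers_def)
    moreover have "ltgt B (x, False) e = Some (dst e, False)" if "e \<in> Out x" for e
      using that x F[OF x(1) that] by (auto simp: ltgt_def)
    ultimately show "d (Some (x, False)) = (\<Sum>e\<in>Out x. wt e * d (Some (dst e, False)))"
      using harm[of "(x, False)"] by simp
  qed (rule d0)
  have "lsum Out B - lsum Out (insert z B) =
      (\<Sum>e\<in>Out z. wt e * (d (ltgt (insert z B) (z, True) e) - d (ltgt B (z, True) e)))"
    unfolding rowB rowBz sum_subtractf[symmetric] by (intro sum.cong refl) (simp add: algebra_simps)
  also have "\<dots> = (\<Sum>e\<in>Out z. if e \<in> E \<and> dst e \<in> U then wt e * d (Some (dst e, False)) else 0)"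
    using z(3) dN by (intro sum.cong refl) (auto simp: ltgt_def)
  also have "\<dots> = (\<Sum>e\<in>{e \<in> Out z. e \<in> E \<and> dst e \<in> U}. wt e * d (Some (dst e, False)))"
    using fin(2)[OF z(1)] by (subst sum.inter_filter) auto
  also have "\<dots> \<le> (\<Sum>e\<in>{e \<in> Out z. e \<in> E \<and> dst e \<in> U}. wt e * (C * d (Some (u\<^sub>0, False))))"
    using duC nonneg[OF z(1)] by (intro sum_mono mult_left_mono) auto
  also have "\<dots> = return_weight z * (C * d (Some (u\<^sub>0, False)))"
    by (simp add: return_weight_def sum_distrib_right)
  finally have diff: "lsum Out B - lsum Out (insert z B) \<le> return_weight z * (C * d (Some (u\<^sub>0, False)))" .
  have Z0: "lsum Out {} > 0"
  proof -
    have "lsum Out X \<le> lsum Out {}"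
      using nonneg_layers ltgt_kill by (intro forest_sum_kill_mono) auto
    then show ?thesis using lsum_pos by simp
  qed
  have ZB: "lsum Out B \<le> lsum Out {}"
    using nonneg_layers by (intro forest_sum_kill_mono) (auto simp: ltgt_def)
  have r0: "return_weight z \<ge> 0" unfolding return_weight_def using nonneg[OF z(1)] by (intro sum_nonneg) auto
  have dle: "wt e * d (ltgt B p e) \<le> wt e * d (ltgt X p e)" if "p \<in> layers" "e \<in> Out (fst p)" for p e
    using ltgt_kill[OF that(1), of B e] d0 dN nonneg[OF layers_fst[OF that(1)] that(2)]
    by (auto intro!: mult_left_mono)
  \<comment> \<open>At \<open>(z, True)\<close> the function has a source: by the row expansion,
    \<open>w\<close> exceeds the average of \<open>d\<close> by exactly
    \<open>lsum Out B\<close>.\<close>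
  have dsub: "d (Some p) \<le> (\<Sum>e\<in>Out (fst p). wt e * d (ltgt X p e)) + (if p = (z, True) then lsum Out {} else 0)"
    if p: "p \<in> layers" for p
  proof (cases "p = (z, True)")
    case False
    then have "p \<in> A" using p by (simp add: A_def)
    then show ?thesis using harm[of p] dle[OF p] False by (auto intro!: sum_mono)
  next
    case True
    have "lsum Out B = w - (\<Sum>e\<in>Out z. wt e * d (ltgt B (z, True) e))"
      unfolding rowB using wt(2)[OF z(1)]
      by (simp add: right_diff_distrib sum_subtractf sum_distrib_right[symmetric])
    then have "d (Some p) = lsum Out B + (\<Sum>e\<in>Out z. wt e * d (ltgt B (z, True) e))"
      using dz True by simp
    moreover have "(\<Sum>e\<in>Out z. wt e * d (ltgt B (z, True) e)) \<le> (\<Sum>e\<in>Out z. wt e * d (ltgt X (z, True) e))"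
      using dle[OF p] True by (intro sum_mono) auto
    ultimately show ?thesis using True ZB by simp
  qed
  \<comment> \<open>With this factor the source of \<open>k * d\<close> at \<open>(z, True)\<close>
    is at most \<open>return_weight z\<close>, the term that inserting \<open>z\<close> adds to the
    inequality.\<close>
  define k where "k = return_weight z / lsum Out {}"
  have k0: "k \<ge> 0" using r0 Z0 by (simp add: k_def)
  define g' where "g' t = g t + k * d t" for t
  have "lsum Out {} * (1 - C * g' (Some (u\<^sub>0, False))) =
      lsum Out {} * (1 - C * g (Some (u\<^sub>0, False))) - return_weight z * (C * d (Some (u\<^sub>0, False)))"
    using Z0 by (simp add: g'_def k_def field_simps)
  also have "\<dots> \<le> lsum Out (insert z B)" using g(4) diff by simp
  finally have 1: "lsum Out {} * (1 - C * g' (Some (u\<^sub>0, False))) \<le> lsum Out (insert z B)" .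
  have 2: "g' (Some p) \<le> (\<Sum>e\<in>Out (fst p). wt e * g' (ltgt X p e)) +
      (if snd p \<and> fst p \<in> insert z B then return_weight (fst p) else 0)" if p: "p \<in> layers" for p
  proof -
    have "g' (Some p) \<le> (\<Sum>e\<in>Out (fst p). wt e * g (ltgt X p e)) +
      (if snd p \<and> fst p \<in> B then return_weight (fst p) else 0) +
      k * ((\<Sum>e\<in>Out (fst p). wt e * d (ltgt X p e)) + (if p = (z, True) then lsum Out {} else 0))"
      unfolding g'_def using g(3) p dsub[OF p] k0 by (intro add_mono mult_left_mono) auto
    also have "\<dots> = (\<Sum>e\<in>Out (fst p). wt e * g' (ltgt X p e)) +
        ((if snd p \<and> fst p \<in> B then return_weight (fst p) else 0) + k * (if p = (z, True) then lsum Out {} else 0))"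
      by (simp add: g'_def algebra_simps sum.distrib sum_distrib_left)
    also have "(if snd p \<and> fst p \<in> B then return_weight (fst p) else 0) + k * (if p = (z, True) then lsum Out {} else 0) =
        (if snd p \<and> fst p \<in> insert z B then return_weight (fst p) else 0)"
      using z(3) Z0 by (cases p) (auto simp: k_def)
    finally show ?thesis .
  qed
  show ?case
  proof (intro exI[of _ g'] conjI allI ballI)
    show "g' t \<ge> 0" for t using g(1) d0 k0 by (simp add: g'_def)
    show "g' None = 0" using g(2) dN by (simp add: g'_def)
  qed (use 1 2 in blast)+
qed

text \<open>\<open>h\<close> is the probability of returning to \<open>U\<close>. As each return
  needs a new exit, after which it has probability at most \<open>\<kappa>\<close>, the expected
  number of returns is at most
  \<open>\<kappa> + \<kappa>^2 + ... = \<kappa> / (1 - \<kappa>)\<close>, and Harnack's inequality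
  contributes the factor \<open>C\<close>. \<open>R\<close> stands for the out-edges compatible with
  a restricted configuration.\<close>

theorem nested_comparison:
  assumes R: "\<And>x. x \<in> X \<Longrightarrow> R x \<subseteq> Out x" "\<And>x. x \<notin> U \<Longrightarrow> R x = Out x"
    and u: "u\<^sub>0 \<in> U" and C: "C \<ge> 0" and \<kappa>: "0 \<le> \<kappa>" "\<kappa> < 1"
    and harnack: "\<And>g u. (\<And>x. x \<in> Y \<Longrightarrow> g x \<ge> 0) \<Longrightarrow>
      (\<And>x. x \<in> Y \<Longrightarrow> Out x \<subseteq> F \<Longrightarrow> g x = (\<Sum>e\<in>Out x. wt e * g (dst e))) \<Longrightarrow> u \<in> U \<Longrightarrow> g u \<le> C * g u\<^sub>0"
    and h: "\<And>x. x \<in> X \<Longrightarrow> h x \<ge> 0" "\<And>x. x \<in> U \<Longrightarrow> h x = 1"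
      "\<And>x. x \<in> X - U \<Longrightarrow> h x = (\<Sum>e\<in>{e \<in> Out x. e \<in> E}. wt e * h (dst e))"
      "\<And>x e. x \<in> Y \<Longrightarrow> e \<in> Out x \<Longrightarrow> e \<in> E \<Longrightarrow> e \<notin> F \<Longrightarrow> h (dst e) \<le> \<kappa>"
  shows "(1 - C * \<kappa> / (1 - \<kappa>)) * (forest_sum wt R (\<lambda>_. arc_target dst E) X * forest_sum wt Out (\<lambda>_. arc_target dst F) Y) \<le>
    forest_sum wt R (\<lambda>_. arc_target dst F) Y * forest_sum wt Out (\<lambda>_. arc_target dst E) X"
proof -
  obtain g :: "('v \<times> bool) option \<Rightarrow> real" where g: "\<forall>t. g t \<ge> 0" "g None = 0"
    "\<forall>p\<in>layers. g (Some p) \<le> (\<Sum>e\<in>Out (fst p). wt e * g (ltgt X p e)) +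
      (if snd p \<and> fst p \<in> X - U then return_weight (fst p) else 0)"
    "lsum Out (X - U) \<ge> lsum Out {} * (1 - C * g (Some (u\<^sub>0, False)))"
    using returns_bound[of "X - U", OF _ _ u C harnack] fin(1) by blast
  \<comment> \<open>a supersolution of the equation for the expected number of returns\<close>
  define \<psi> where "\<psi> t = (case t of None \<Rightarrow> 0 | Some (x, b) \<Rightarrow> (if b then h x else \<kappa>) / (1 - \<kappa>))" for t :: "('v \<times> bool) option"
  have \<psi>super: "\<psi> (Some p) \<ge> (\<Sum>e\<in>Out (fst p). wt e * \<psi> (ltgt X p e)) +
      (if snd p \<and> fst p \<in> X - U then return_weight (fst p) else 0)" if p: "p \<in> layers" for p
  proof (cases p)
    case (Pair x b)
    then have x: "x \<in> X" using layers_fst[OF p] by simp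
    show ?thesis
    proof (cases b)
      case True
      then have xU: "x \<in> X - U" using p Pair by (auto simp: layers_def)
      have "(\<Sum>e\<in>Out x. wt e * \<psi> (ltgt X (x, True) e)) + return_weight x =
         (\<Sum>e\<in>Out x. wt e * \<psi> (ltgt X (x, True) e) + (if e \<in> E \<and> dst e \<in> U then wt e else 0))"
        unfolding return_weight_def sum.distrib
        using fin(2)[OF x] by (subst sum.inter_filter) auto
      also have "\<dots> = (\<Sum>e\<in>Out x. if e \<in> E then wt e * h (dst e) / (1 - \<kappa>) else 0)"
        using \<kappa> xU h(2) by (intro sum.cong refl) (auto simp: ltgt_def \<psi>_def field_simps)
      also have "\<dots> = (\<Sum>e\<in>{e \<in> Out x. e \<in> E}. wt e * h (dst e)) / (1 - \<kappa>)"
        unfolding sum_divide_distrib using fin(2)[OF x] by (subst sum.inter_filter) auto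
      also have "\<dots> = \<psi> (Some p)" using h(3)[OF xU] Pair True by (simp add: \<psi>_def)
      finally show ?thesis using Pair True xU by simp
    next
      case False
      then have xY: "x \<in> Y" using p Pair by (auto simp: layers_def)
      have "(\<Sum>e\<in>Out x. wt e * \<psi> (ltgt X (x, False) e)) \<le> (\<Sum>e\<in>Out x. wt e * (\<kappa> / (1 - \<kappa>)))"
      proof (intro sum_mono mult_left_mono)
        fix e assume e: "e \<in> Out x"
        show "\<psi> (ltgt X (x, False) e) \<le> \<kappa> / (1 - \<kappa>)"
          using h(4)[OF xY e] \<kappa> by (auto simp: ltgt_def \<psi>_def intro: divide_right_mono)
        show "0 \<le> wt e" using nonneg[OF x e] .
      qed
      also have "\<dots> = \<psi> (Some p)"
        using wt(2)[OF x] Pair False by (simp add: \<psi>_def sum_distrib_right[symmetric] sum_divide_distrib[symmetric])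
      finally show ?thesis using Pair False by simp
    qed
  qed
  have u0: "(u\<^sub>0, False) \<in> layers" using u sub by (auto simp: layers_def)
  have "g (Some (u\<^sub>0, False)) - \<psi> (Some (u\<^sub>0, False)) \<le> 0"
  proof (rule forest_sum_max_principle[of layers "Out \<circ> fst" wt "ltgt X" "\<lambda>t. g t - \<psi> t"])
    show "(g (Some p) - \<psi> (Some p)) * sum wt ((Out \<circ> fst) p) \<le> (\<Sum>e\<in>(Out \<circ> fst) p. wt e * (g (ltgt X p e) - \<psi> (ltgt X p e)))"
      if p: "p \<in> layers" for p
    proof -
      have "g (Some p) - \<psi> (Some p) \<le> (\<Sum>e\<in>Out (fst p). wt e * g (ltgt X p e)) - (\<Sum>e\<in>Out (fst p). wt e * \<psi> (ltgt X p e))"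
        using bspec[OF g(3) p] \<psi>super[OF p] by linarith
      then show ?thesis using wt(2)[OF layers_fst[OF p]]
        by (simp add: right_diff_distrib sum_subtractf)
    qed
    show "g (ltgt X p e) - \<psi> (ltgt X p e) \<le> 0" if "p \<in> layers" "e \<in> (Out \<circ> fst) p" "ltgt X p e \<notin> Some ` layers" for p e
      using ltgt_closed[OF that(1), of e X] that g(2) by (auto simp: \<psi>_def)
  qed (use nonneg_layers finite_layers fin(2) layers_fst lsum_pos u0 in auto)
  then have "g (Some (u\<^sub>0, False)) \<le> \<kappa> / (1 - \<kappa>)" by (simp add: \<psi>_def)
  then have "C * g (Some (u\<^sub>0, False)) \<le> C * \<kappa> / (1 - \<kappa>)" using C by (metis mult_left_mono times_divide_eq_right)
  \<comment> \<open>Second-layer vertices lie in \<open>X - U\<close>, so all returns have been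
    restored.\<close>
  moreover have "lsum Out (X - U) = lsum Out X"
    by (intro forest_sum_cong) (auto simp: ltgt_def layers_def)
  moreover have nn: "p \<in> layers \<Longrightarrow> e \<in> (R \<circ> fst) p \<Longrightarrow> wt e \<ge> 0" for p e
    using R(1)[OF layers_fst, of p] nonneg_layers[of p e] by auto
  have RZ: "lsum R X \<le> lsum R {}" "lsum R X \<ge> 0"
    using nn ltgt_kill by (intro forest_sum_kill_mono forest_sum_nonneg; auto)+
  have Z: "lsum Out X \<le> lsum Out {}"
    using nonneg_layers ltgt_kill by (intro forest_sum_kill_mono) auto
  define c where "c = 1 - C * \<kappa> / (1 - \<kappa>)"
  have key: "lsum Out X \<ge> c * lsum Out {}"
  proof -
    have "lsum Out {} * c \<le> lsum Out {} * (1 - C * g (Some (u\<^sub>0, False)))"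
      using Z lsum_pos calculation(1) by (intro mult_left_mono) (auto simp: c_def)
    then show ?thesis using g(4) calculation(2) by (simp add: mult.commute)
  qed
  let ?p = "forest_sum wt Out (\<lambda>_. arc_target dst F) Y" and ?pR = "forest_sum wt R (\<lambda>_. arc_target dst F) Y"
  let ?q = "forest_sum wt Out (\<lambda>_. arc_target dst E) X" and ?qR = "forest_sum wt R (\<lambda>_. arc_target dst E) X"
  let ?wp = "forest_sum wt Out (\<lambda>_. arc_target dst F) (Y - U)" and ?wq = "forest_sum wt Out (\<lambda>_. arc_target dst E) (X - U)"
  let ?v0 = "forest_sum wt (Out \<circ> fst) (ltgt {}) (layers - U \<times> {False})" and ?v1 = "forest_sum wt (Out \<circ> fst) (ltgt X) (layers - U \<times> {False})"
  \<comment> \<open>The sums \<open>?v0\<close>, \<open>?v1\<close>, \<open>?wp\<close> and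
    \<open>?wq\<close> omit the rows of \<open>U\<close>. They are the same for \<open>R\<close> and
    \<open>Out\<close> and drop out of the comparison.\<close>
  have L: "lsum R X * ?wq = ?qR * ?v1" "lsum Out X * ?wq = ?q * ?v1"
    "lsum R {} * ?wp = ?pR * ?v0" "lsum Out {} * ?wp = ?p * ?v0"
    using lift_outer[of R] lift_outer[of Out] lift_inner[of R] lift_inner[of Out] R by auto
  have v1: "?v1 > 0"
    using finite_layers fin(2)[OF layers_fst] wt(1)[OF layers_fst] exits_mono[OF exits_layers, of _ "layers - U \<times> {False}"]
    by (intro forest_sum_pos) auto
  have "?v1 \<le> ?v0" using nonneg_layers ltgt_kill by (intro forest_sum_kill_mono) auto
  then have v0: "?v0 > 0" using v1 by simp
  \<comment> \<open>For \<open>R\<close> only the free inequality between kept and killed returns is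
    used; the loss \<open>c\<close> comes from the unrestricted sum.\<close>
  have "c * (lsum R X * lsum Out {}) \<le> lsum R {} * lsum Out X"
  proof -
    have "c * (lsum R X * lsum Out {}) = lsum R X * (c * lsum Out {})" by simp
    also have "\<dots> \<le> lsum R X * lsum Out X" using key RZ by (intro mult_left_mono) auto
    also have "\<dots> \<le> lsum R {} * lsum Out X" using RZ lsum_pos by (intro mult_right_mono) auto
    finally show ?thesis .
  qed
  moreover have wn: "?wq \<ge> 0" "?wp \<ge> 0"
    using nonneg sub by (intro forest_sum_nonneg; auto)+
  ultimately have "c * (lsum R X * lsum Out {}) * (?wq * ?wp) \<le> lsum R {} * lsum Out X * (?wq * ?wp)"
    by (intro mult_right_mono) auto
  then have "c * ((lsum R X * ?wq) * (lsum Out {} * ?wp)) \<le> (lsum R {} * ?wp) * (lsum Out X * ?wq)"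
    by (simp only: mult_ac)
  then have "(?v0 * ?v1) * (c * (?qR * ?p)) \<le> (?v0 * ?v1) * (?pR * ?q)"
    unfolding L by (simp only: mult_ac)
  then show ?thesis using v0 v1 by (simp add: c_def)
qed

end

section \<open>Planar topology\<close>

text \<open>\<open>fashoda\<close> asks for paths joining opposite sides of a box. Prolonging both
  paths straight to a large square creates no new intersection, because each prolongation lies
  beyond the strip that contains the other path.\<close>

lemma crossing_paths_meet:
  fixes f g :: "real \<Rightarrow> complex"
  assumes f: "path f" and g: "path g"
    and fs: "\<And>z. z \<in> path_image f \<Longrightarrow> \<bar>Re z - a\<bar> \<le> s" and gs: "\<And>z. z \<in> path_image g \<Longrightarrow> \<bar>Im z - b\<bar> \<le> s"
    and fe: "Im (pathstart f) < b - s" "Im (pathfinish f) > b + s"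
    and ge: "Re (pathstart g) < a - s" "Re (pathfinish g) > a + s"
  shows "path_image f \<inter> path_image g \<noteq> {}"
proof -
  obtain H where H: "\<And>z. z \<in> path_image f \<union> path_image g \<Longrightarrow> norm z \<le> H"
    using compact_imp_bounded[OF compact_path_image[OF f]] compact_imp_bounded[OF compact_path_image[OF g]]
    by (metis bounded_Un bounded_iff)
  have Hc: "\<bar>Re z\<bar> \<le> H" "\<bar>Im z\<bar> \<le> H" if "z \<in> path_image f \<union> path_image g" for z
    using H[OF that] abs_Re_le_cmod[of z] abs_Im_le_cmod[of z] by linarith+
  have ends: "pathstart f \<in> path_image f" "pathfinish f \<in> path_image f"
    "pathstart g \<in> path_image g" "pathfinish g \<in> path_image g" by auto
  define f' where "f' = linepath (Complex (Re (pathstart f)) (-H)) (pathstart f) +++ (f +++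
    linepath (pathfinish f) (Complex (Re (pathfinish f)) H))"
  define g' where "g' = linepath (Complex (-H) (Im (pathstart g))) (pathstart g) +++ (g +++
    linepath (pathfinish g) (Complex H (Im (pathfinish g))))"
  have pf: "path f'" "path g'" using f g by (auto simp: f'_def g'_def)
  have imf: "path_image f' = closed_segment (Complex (Re (pathstart f)) (-H)) (pathstart f) \<union> (path_image f \<union>
     closed_segment (pathfinish f) (Complex (Re (pathfinish f)) H))"
    by (simp add: f'_def path_image_join)
  have img: "path_image g' = closed_segment (Complex (-H) (Im (pathstart g))) (pathstart g) \<union> (path_image g \<union>
     closed_segment (pathfinish g) (Complex H (Im (pathfinish g))))"
    by (simp add: g'_def path_image_join)
  have sv: "Re z = Re x \<and> min (Im x) (Im y) \<le> Im z \<and> Im z \<le> max (Im x) (Im y)"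
    if "z \<in> closed_segment x y" "Re x = Re y" for x y z
    using that closed_segment_same_Re[of x y] closed_segment_eq_real_ivl[of "Im x" "Im y"] by (auto split: if_splits)
  have sh: "Im z = Im x \<and> min (Re x) (Re y) \<le> Re z \<and> Re z \<le> max (Re x) (Re y)"
    if "z \<in> closed_segment x y" "Im x = Im y" for x y z
    using that closed_segment_same_Im[of x y] closed_segment_eq_real_ivl[of "Re x" "Re y"] by (auto split: if_splits)
  have sf: "Re z = Re (pathstart f) \<and> -H \<le> Im z \<and> Im z \<le> Im (pathstart f)"
    if "z \<in> closed_segment (Complex (Re (pathstart f)) (-H)) (pathstart f)" for z
    using sv[OF that] Hc(2)[of "pathstart f"] ends by auto
  have ff: "Re z = Re (pathfinish f) \<and> Im z \<le> H \<and> Im z \<ge> Im (pathfinish f)"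
    if "z \<in> closed_segment (pathfinish f) (Complex (Re (pathfinish f)) H)" for z
    using sv[OF that] Hc(2)[of "pathfinish f"] ends by auto
  have sg: "Im z = Im (pathstart g) \<and> -H \<le> Re z \<and> Re z \<le> Re (pathstart g)"
    if "z \<in> closed_segment (Complex (-H) (Im (pathstart g))) (pathstart g)" for z
    using sh[OF that] Hc(1)[of "pathstart g"] ends by auto
  have fg: "Im z = Im (pathfinish g) \<and> Re z \<le> H \<and> Re z \<ge> Re (pathfinish g)"
    if "z \<in> closed_segment (pathfinish g) (Complex H (Im (pathfinish g)))" for z
    using sh[OF that] Hc(1)[of "pathfinish g"] ends by auto
  have memf: "z \<in> path_image f \<or> (Re z = Re (pathstart f) \<and> -H \<le> Im z \<and> Im z \<le> Im (pathstart f)) \<or>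
    (Re z = Re (pathfinish f) \<and> Im z \<le> H \<and> Im z \<ge> Im (pathfinish f))" if "z \<in> path_image f'" for z
    using that sf[of z] ff[of z] unfolding imf by blast
  have memg: "z \<in> path_image g \<or> (Im z = Im (pathstart g) \<and> -H \<le> Re z \<and> Re z \<le> Re (pathstart g)) \<or>
    (Im z = Im (pathfinish g) \<and> Re z \<le> H \<and> Re z \<ge> Re (pathfinish g))" if "z \<in> path_image g'" for z
    using that sg[of z] fg[of z] unfolding img by blast
  have Hs: "\<bar>Re z\<bar> \<le> H \<and> \<bar>Im z\<bar> \<le> H" if "z \<in> {pathstart f, pathfinish f, pathstart g, pathfinish g}" for z
    using that ends Hc[of z] by auto
  define \<phi> :: "complex \<Rightarrow> real^2" where "\<phi> = (\<lambda>z. \<chi> i. if i = 1 then Re z else Im z)"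
  have \<phi>n: "\<phi> z $ 1 = Re z" "\<phi> z $ 2 = Im z" for z by (auto simp: \<phi>_def)
  have "linear \<phi>" by (rule linearI) (auto simp: \<phi>_def vec_eq_iff)
  then have cont: "continuous_on S \<phi>" for S by (simp add: linear_continuous_on linear_conv_bounded_linear)
  have inj: "\<phi> x = \<phi> y \<Longrightarrow> x = y" for x y by (metis \<phi>n complex_eqI)
  have box: "\<phi> ` path_image h \<subseteq> cbox (\<chi> i. -H) (\<chi> i. H)"
    if "\<And>z. z \<in> path_image h \<Longrightarrow> \<bar>Re z\<bar> \<le> H \<and> \<bar>Im z\<bar> \<le> H" for h :: "real \<Rightarrow> complex"
  proof (rule image_subsetI)
    fix z assume "z \<in> path_image h"
    then show "\<phi> z \<in> cbox (\<chi> i. -H) (\<chi> i. H)"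
      using that[of z] by (auto simp: mem_box_cart \<phi>_def)
  qed
  have bf: "\<bar>Re z\<bar> \<le> H \<and> \<bar>Im z\<bar> \<le> H" if "z \<in> path_image f'" for z
    using memf[OF that] Hc[of z] Hs[of "pathstart f"] Hs[of "pathfinish f"] by (elim disjE) (simp_all add: abs_le_iff)
  have bg: "\<bar>Re z\<bar> \<le> H \<and> \<bar>Im z\<bar> \<le> H" if "z \<in> path_image g'" for z
    using memg[OF that] Hc[of z] Hs[of "pathstart g"] Hs[of "pathfinish g"] by (elim disjE) (simp_all add: abs_le_iff)
  obtain w where w: "w \<in> path_image (\<phi> \<circ> g')" "w \<in> path_image (\<phi> \<circ> f')"
  proof (rule fashoda[of "\<phi> \<circ> g'" "\<phi> \<circ> f'" "\<chi> i. -H" "\<chi> i. H"])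
    show "path (\<phi> \<circ> g')" "path (\<phi> \<circ> f')" using pf cont by (auto intro!: path_continuous_image)
    show "path_image (\<phi> \<circ> g') \<subseteq> cbox (\<chi> i. -H) (\<chi> i. H)" "path_image (\<phi> \<circ> f') \<subseteq> cbox (\<chi> i. -H) (\<chi> i. H)"
      using box[of f'] box[of g'] bf bg by (auto simp: path_image_compose)
  qed (auto simp: pathstart_def pathfinish_def f'_def g'_def joinpaths_def linepath_def \<phi>_def)
  then obtain z where z: "z \<in> path_image f'" "z \<in> path_image g'"
    using inj by (auto simp: path_image_compose)
  have "z \<in> path_image f \<and> z \<in> path_image g"
    using memf[OF z(1)] memg[OF z(2)] fs[of z] gs[of z] fs[OF ends(1)] fs[OF ends(2)] gs[OF ends(3)] gs[OF ends(4)] fe ge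
    unfolding abs_le_iff by argo
  then show ?thesis by blast
qed

section \<open>Winding around a point and separation\<close>

lemma logarithms_differ_by_const:
  fixes g L :: "complex \<Rightarrow> complex"
  assumes "Topological_Spaces.connected A" "continuous_on A g" "continuous_on A L"
    "\<And>z. z \<in> A \<Longrightarrow> exp (g z) = exp (L z)"
  obtains k where "\<And>z. z \<in> A \<Longrightarrow> g z = L z + k"
proof -
  have "(\<lambda>z. g z - L z) constant_on A"
  proof (rule continuous_discrete_range_constant[OF assms(1)])
    show "continuous_on A (\<lambda>z. g z - L z)" using assms by (intro continuous_intros)
    fix x assume x: "x \<in> A"
    have "2 * pi \<le> norm ((g y - L y) - (g x - L x))" if y: "y \<in> A" "g y - L y \<noteq> g x - L x" for y
    proof -
      have "exp (g y - L y) = exp (g x - L x)" using assms(4)[OF x] assms(4)[OF y(1)] by (simp add: exp_diff)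
      then obtain n :: int where n: "g y - L y = g x - L x + (of_int (2 * n) * pi) * \<i>"
        unfolding exp_eq by blast
      then have "n \<noteq> 0" using y(2) by auto
      then have "(1::real) \<le> \<bar>of_int n\<bar>" by linarith
      moreover have "norm ((g y - L y) - (g x - L x)) = 2 * \<bar>of_int n\<bar> * pi"
        unfolding n by (simp add: norm_mult)
      ultimately show ?thesis using pi_gt_zero by (simp add: mult_right_le_one_le)
    qed
    then show "\<exists>e>0. \<forall>y. y \<in> A \<and> g y - L y \<noteq> g x - L x \<longrightarrow> e \<le> norm ((g y - L y) - (g x - L x))"
      by (intro exI[of _ "2 * pi"]) auto
  qed
  then obtain k where "\<And>z. z \<in> A \<Longrightarrow> g z - L z = k" unfolding constant_on_def by blast
  then show thesis using that[of k] by (metis add.commute diff_add_cancel)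
qed

text \<open>Along the four sides, a continuous logarithm of \<open>z - \<zeta>\<close> on \<open>D\<close> would increase by \<open>2\<pi>\<i>\<close>.\<close>

lemma circuit_winds:
  fixes D :: "complex set"
  assumes D: "open D" "simply_connected D" "\<zeta> \<notin> D"
    and A: "\<And>i. i \<in> {0, 1, 2, 3} \<Longrightarrow> Topological_Spaces.connected (A i)" "\<And>i. i \<in> {0, 1, 2, 3} \<Longrightarrow> A i \<subseteq> D"
    and half: "\<And>z. z \<in> A 0 \<Longrightarrow> Re z > Re \<zeta>" "\<And>z. z \<in> A 1 \<Longrightarrow> Im z > Im \<zeta>"
      "\<And>z. z \<in> A 2 \<Longrightarrow> Re z < Re \<zeta>" "\<And>z. z \<in> A (3::nat) \<Longrightarrow> Im z < Im \<zeta>"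
    and meet: "A 0 \<inter> A 1 \<noteq> {}" "A 1 \<inter> A 2 \<noteq> {}" "A 2 \<inter> A 3 \<noteq> {}" "A 3 \<inter> A 0 \<noteq> {}"
  shows False
proof -
  have "continuous_on D (\<lambda>z. z - \<zeta>)" "\<forall>z\<in>D. z - \<zeta> \<noteq> 0" using D(3) by (auto intro: continuous_intros)
  then obtain g where g: "continuous_on D g" "\<And>z. z \<in> D \<Longrightarrow> z - \<zeta> = exp (g z)"
    using D(2) unfolding simply_connected_eq_continuous_log[OF D(1)] by blast
  \<comment> \<open>Branch of the logarithm centred at the direction \<open>\<i> ^ i\<close>: on
    \<open>A i\<close> its imaginary part stays within \<open>pi / 2\<close> of
    \<open>i * (pi / 2)\<close>.\<close>
  define L where "L i z = Ln ((z - \<zeta>) / \<i> ^ i) + of_nat i * (\<i> * (pi / 2))" for i :: nat and z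
  have RP: "Re ((z - \<zeta>) / \<i> ^ i) > 0" if "i \<in> {0, 1, 2, 3}" "z \<in> A i" for i z
    using that half[of z] by (auto simp: power3_eq_cube Re_divide_Reals numeral_3_eq_3)
  have ex: "exp (L i z) = z - \<zeta>" if "i \<in> {0, 1, 2, 3}" "z \<in> A i" for i z
  proof -
    have nz: "(z - \<zeta>) / \<i> ^ i \<noteq> 0" using RP[OF that] by auto
    have "exp (\<i> * (pi / 2)) = \<i>"
      by (simp add: complex_eq_iff Re_exp Im_exp)
    then have "exp (of_nat i * (\<i> * (pi / 2))) = \<i> ^ i" by (simp only: exp_of_nat_mult)
    then show ?thesis using nz by (simp add: L_def exp_add)
  qed
  have cL: "continuous_on (A i) (L i)" if "i \<in> {0, 1, 2, 3}" for i
  proof -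
    have "(z - \<zeta>) / \<i> ^ i \<notin> \<real>\<^sub>\<le>\<^sub>0" if "z \<in> A i" for z
      using RP[OF \<open>i \<in> _\<close> that] unfolding complex_nonpos_Reals_iff by linarith
    then show ?thesis unfolding L_def by (intro continuous_intros) auto
  qed
  have "\<exists>k. \<forall>z\<in>A i. g z = L i z + k" if i: "i \<in> {0, 1, 2, 3}" for i
  proof -
    have "continuous_on (A i) g" using g(1) A(2)[OF i] continuous_on_subset by blast
    moreover have "exp (g z) = exp (L i z)" if "z \<in> A i" for z using g(2)[of z] ex[OF i that] A(2)[OF i] that by auto
    ultimately show ?thesis using logarithms_differ_by_const[OF A(1)[OF i] _ cL[OF i], of g] by metis
  qed
  then obtain k where k: "\<And>i z. i \<in> {0, 1, 2, 3} \<Longrightarrow> z \<in> A i \<Longrightarrow> g z = L i z + k i" by metis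
  have imL: "\<bar>Im (L i z) - i * (pi / 2)\<bar> < pi / 2" if "i \<in> {0, 1, 2, 3}" "z \<in> A i" for i z
  proof -
    have "\<bar>Im (Ln ((z - \<zeta>) / \<i> ^ i))\<bar> < pi / 2"
      using RP[OF that] Re_Ln_pos_lt[of "(z - \<zeta>) / \<i> ^ i"] by (metis less_irrefl zero_complex.simps(1))
    then show ?thesis by (simp add: L_def)
  qed
  \<comment> \<open>At a common point of consecutive sides the two branches differ by a multiple of
    \<open>2 * pi * \<i>\<close> whose modulus is less than \<open>2 * pi\<close>, so they agree
    there.\<close>
  have step: "k i = k j" if ij: "i \<in> {0, 1, 2, 3}" "j \<in> {0, 1, 2, 3}" "j = Suc i" and m: "A i \<inter> A j \<noteq> {}" for i j
  proof -
    obtain z where z: "z \<in> A i" "z \<in> A j" using m by blast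
    have "exp (L i z) = exp (L j z)" using ex z ij by simp
    then obtain n :: int where n: "L i z = L j z + (of_int (2 * n) * pi) * \<i>"
      unfolding exp_eq by blast
    then have im: "Im (L i z) - Im (L j z) = 2 * of_int n * pi" by simp
    have "real j * (pi / 2) = real i * (pi / 2) + pi / 2" by (simp add: ij(3) algebra_simps)
    then have "\<bar>Im (L i z) - Im (L j z)\<bar> < 2 * pi"
      using imL[OF ij(1) z(1)] imL[OF ij(2) z(2)] pi_gt_zero by linarith
    then have "\<bar>real_of_int n\<bar> * (2 * pi) < 1 * (2 * pi)"
      unfolding im abs_mult using pi_gt_zero by (simp only: abs_of_pos abs_numeral mult_ac mult_1)
    then have "\<bar>real_of_int n\<bar> < 1" by (rule mult_right_less_imp_less) simp
    then have "n = 0" by linarith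
    then have "L i z = L j z" using n by simp
    then show ?thesis using k[OF ij(1) z(1)] k[OF ij(2) z(2)] by simp
  qed
  have "k 0 = k 1" by (rule step) (use meet(1) in simp_all)
  also have "k 1 = k 2" by (rule step) (use meet(2) in simp_all)
  also have "k 2 = k 3" by (rule step) (use meet(3) in simp_all)
  finally have "k 0 = k 3" .
  moreover obtain z where z: "z \<in> A 3" "z \<in> A 0" using meet by blast
  ultimately have "L 3 z = L 0 z" using k[of 0 z] k[of 3 z] by simp
  \<comment> \<open>At the closing point the last branch has imaginary part above \<open>pi\<close>,
    the first one below \<open>pi / 2\<close>.\<close>
  then show False using imL[of 3 z] imL[of 0 z] z pi_gt_zero by simp
qed

text \<open>The component of the complement of \<open>K\<close> around \<open>T\<close> works: its
  complement is connected and unbounded, so it has no holes.\<close>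

lemma unbounded_connected_avoided:
  fixes K :: "complex set"
  assumes "closed K" "Topological_Spaces.connected K" "\<not> bounded K" "Topological_Spaces.connected T" "T \<noteq> {}" "T \<inter> K = {}"
  obtains D where "open D" "simply_connected D" "T \<subseteq> D" "D \<inter> K = {}"
proof -
  obtain x where x: "x \<in> T" using assms by blast
  define D where "D = connected_component_set (- K) x"
  have xK: "x \<in> - K" using x assms by auto
  have o: "open D" unfolding D_def using assms(1) by (intro open_connected_component) auto
  have comp: "D \<in> components (- K)" using xK by (auto simp: D_def components_def)
  have TD: "T \<subseteq> D" unfolding D_def using assms x by (intro connected_component_maximal) auto
  have DK: "D \<inter> K = {}" using comp in_components_subset by blast
  have "Topological_Spaces.connected (- D)" using component_complement_connected[OF assms(2) comp] .
  moreover have "\<not> bounded (- D)" using DK assms(3) bounded_subset[of "- D" K] by blast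
  ultimately have "simply_connected D"
    unfolding simply_connected_eq_unbounded_complement_components[OF o]
    using in_components_connected[OF comp] by (metis bounded_empty components_eq_sing_iff singletonD)
  then show thesis using that o TD DK by blast
qed

section \<open>Finite walks and the driving noise\<close>

primrec walk :: "(complex, 'e) pre_digraph \<Rightarrow> complex \<Rightarrow> 'e list \<Rightarrow> bool" where
  "walk G v [] \<longleftrightarrow> v \<in> verts G"
| "walk G v (e # l) \<longleftrightarrow> e \<in> out_arcs G v \<and> walk G (head G e) l"

primrec walk_end :: "(complex, 'e) pre_digraph \<Rightarrow> complex \<Rightarrow> 'e list \<Rightarrow> complex" where
  "walk_end G v [] = v"
| "walk_end G v (e # l) = walk_end G (head G e) l"

text \<open>Events are predicates on edge lists that have to hold for some prefix of length at most
  \<open>N\<close>. Conditioning on the first edge is then a substitution in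
  \<open>\<Phi>\<close>.\<close>

primrec hit_prob :: "(complex, 'e) pre_digraph \<Rightarrow> ('e \<Rightarrow> real) \<Rightarrow> nat \<Rightarrow> complex \<Rightarrow> ('e list \<Rightarrow> bool) \<Rightarrow> real" where
  "hit_prob G w 0 v \<Phi> = (if \<Phi> [] then 1 else 0)"
| "hit_prob G w (Suc N) v \<Phi> = (if \<Phi> [] then 1 else
     \<Sum>e\<in>out_arcs G v. trans_prob G w e * hit_prob G w N (head G e) (\<lambda>l. \<Phi> (e # l)))"

text \<open>The number of steps is left open but finite, so estimates can be composed without
  passing to limits.\<close>

definition reaches :: "(complex, 'e) pre_digraph \<Rightarrow> ('e \<Rightarrow> real) \<Rightarrow> real \<Rightarrow> complex \<Rightarrow> ('e list \<Rightarrow> bool) \<Rightarrow> bool" where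
  "reaches G w p v \<Phi> \<longleftrightarrow> (\<exists>N. hit_prob G w N v \<Phi> \<ge> p)"

text \<open>Enumerates the minimal walks with property \<open>\<Phi>\<close>; their weights add up
  to \<open>hit_prob\<close>, which links it to cylinders of the noise.\<close>

primrec first_hits :: "(complex, 'e) pre_digraph \<Rightarrow> nat \<Rightarrow> complex \<Rightarrow> ('e list \<Rightarrow> bool) \<Rightarrow> 'e list set" where
  "first_hits G 0 v \<Phi> = (if \<Phi> [] then {[]} else {})"
| "first_hits G (Suc N) v \<Phi> = (if \<Phi> [] then {[]} else
     \<Union>e\<in>out_arcs G v. (#) e ` first_hits G N (head G e) (\<lambda>l. \<Phi> (e # l)))"

lemma walk_end_append: "walk_end G v (l @ l') = walk_end G (walk_end G v l) l'"
  by (induction l arbitrary: v) auto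

locale walk_graph =
  fixes G :: "(complex, 'e) pre_digraph" and w :: "'e \<Rightarrow> real"
  assumes wg: "weighted_graph G w"
begin

lemma finite_out: "v \<in> verts G \<Longrightarrow> finite (out_arcs G v)"
  and out_nonempty: "v \<in> verts G \<Longrightarrow> out_arcs G v \<noteq> {}"
  and w_pos: "e \<in> arcs G \<Longrightarrow> w e > 0"
  using wg by (auto simp: weighted_graph_def)

lemma out_arcsD: "e \<in> out_arcs G v \<Longrightarrow> e \<in> arcs G" "e \<in> out_arcs G v \<Longrightarrow> tail G e = v"
  by (auto simp: out_arcs_def)

lemma head_verts: "e \<in> arcs G \<Longrightarrow> head G e \<in> verts G" and tail_verts: "e \<in> arcs G \<Longrightarrow> tail G e \<in> verts G"
proof -
  have "wf_digraph G" using wg by (simp add: weighted_graph_def)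
  then show "e \<in> arcs G \<Longrightarrow> head G e \<in> verts G" "e \<in> arcs G \<Longrightarrow> tail G e \<in> verts G"
    by (simp_all add: wf_digraph.head_in_verts wf_digraph.tail_in_verts)
qed

lemma total_rate_pos: "v \<in> verts G \<Longrightarrow> total_rate G w v > 0"
  unfolding total_rate_def using finite_out out_nonempty w_pos by (intro sum_pos) (auto simp: out_arcs_def)

lemma trans_prob_pos: "e \<in> arcs G \<Longrightarrow> trans_prob G w e > 0"
  unfolding trans_prob_def using total_rate_pos tail_verts w_pos by simp

lemma sum_trans_prob: "v \<in> verts G \<Longrightarrow> (\<Sum>e\<in>out_arcs G v. trans_prob G w e) = 1"
proof -
  assume v: "v \<in> verts G"
  have "(\<Sum>e\<in>out_arcs G v. trans_prob G w e) = (\<Sum>e\<in>out_arcs G v. w e / total_rate G w v)"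
    by (intro sum.cong refl) (simp add: trans_prob_def)
  also have "\<dots> = 1" using total_rate_pos[OF v] by (simp add: total_rate_def flip: sum_divide_distrib)
  finally show ?thesis .
qed

lemma walk_verts: "walk G v l \<Longrightarrow> v \<in> verts G"
  by (cases l) (auto dest: out_arcsD intro: tail_verts)

lemma walk_append: "walk G v (l @ l') \<longleftrightarrow> walk G v l \<and> walk G (walk_end G v l) l'"
  by (induction l arbitrary: v) (auto dest: walk_verts)

lemma walk_end_verts: "walk G v l \<Longrightarrow> walk_end G v l \<in> verts G"
  by (induction l arbitrary: v) auto

section \<open>Calculus of hitting probabilities\<close>

lemma hit_prob_bounds: "v \<in> verts G \<Longrightarrow> 0 \<le> hit_prob G w N v \<Phi> \<and> hit_prob G w N v \<Phi> \<le> 1"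
proof (induction N arbitrary: v \<Phi>)
  case (Suc N)
  have IH: "0 \<le> hit_prob G w N (head G e) \<Psi>" "hit_prob G w N (head G e) \<Psi> \<le> 1" if "e \<in> out_arcs G v" for e \<Psi>
    using Suc.IH[OF head_verts[OF out_arcsD(1)[OF that]]] by auto
  have tp: "0 \<le> trans_prob G w e" if "e \<in> out_arcs G v" for e
    using trans_prob_pos[OF out_arcsD(1)[OF that]] by simp
  have "(\<Sum>e\<in>out_arcs G v. trans_prob G w e * hit_prob G w N (head G e) (\<lambda>l. \<Phi> (e # l))) \<le>
      (\<Sum>e\<in>out_arcs G v. trans_prob G w e)"
    using IH tp by (intro sum_mono mult_left_le) auto
  moreover have "0 \<le> (\<Sum>e\<in>out_arcs G v. trans_prob G w e * hit_prob G w N (head G e) (\<lambda>l. \<Phi> (e # l)))"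
    using IH tp by (intro sum_nonneg mult_nonneg_nonneg) auto
  ultimately show ?case using sum_trans_prob[OF Suc.prems] by simp
qed simp

lemma hit_prob_mono:
  assumes "v \<in> verts G" "\<And>l. walk G v l \<Longrightarrow> \<Phi> l \<Longrightarrow> \<Psi> l"
  shows "hit_prob G w N v \<Phi> \<le> hit_prob G w N v \<Psi>"
  using assms
proof (induction N arbitrary: v \<Phi> \<Psi>)
  case 0
  then show ?case by auto
next
  case (Suc N)
  show ?case
  proof (cases "\<Psi> []")
    case True
    then show ?thesis using hit_prob_bounds[OF Suc.prems(1), of "Suc N" \<Phi>] by simp
  next
    case False
    then have "\<not> \<Phi> []" using Suc.prems by auto
    moreover have "trans_prob G w e * hit_prob G w N (head G e) (\<lambda>l. \<Phi> (e # l)) \<le>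
        trans_prob G w e * hit_prob G w N (head G e) (\<lambda>l. \<Psi> (e # l))" if e: "e \<in> out_arcs G v" for e
      using e Suc.prems trans_prob_pos[OF out_arcsD(1)[OF e]] head_verts[OF out_arcsD(1)[OF e]]
      by (intro mult_left_mono Suc.IH) auto
    ultimately show ?thesis using False by (auto intro!: sum_mono)
  qed
qed

lemma hit_prob_Suc: "v \<in> verts G \<Longrightarrow> hit_prob G w N v \<Phi> \<le> hit_prob G w (Suc N) v \<Phi>"
proof (induction N arbitrary: v \<Phi>)
  case 0
  then show ?case using hit_prob_bounds[of v "Suc 0" \<Phi>] by auto
next
  case (Suc N)
  have "trans_prob G w e * hit_prob G w N (head G e) (\<lambda>l. \<Phi> (e # l)) \<le>
        trans_prob G w e * hit_prob G w (Suc N) (head G e) (\<lambda>l. \<Phi> (e # l))" if e: "e \<in> out_arcs G v" for e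
    using e Suc.prems trans_prob_pos[OF out_arcsD(1)[OF e]] head_verts[OF out_arcsD(1)[OF e]]
    by (intro mult_left_mono Suc.IH) auto
  then show ?case by (auto intro!: sum_mono simp del: hit_prob.simps(2) simp: hit_prob.simps(2)[of G w N v] hit_prob.simps(2)[of G w "Suc N" v])
qed

lemma hit_prob_mono_time:
  assumes "v \<in> verts G" "N \<le> N'"
  shows "hit_prob G w N v \<Phi> \<le> hit_prob G w N' v \<Phi>"
  using assms(2)
proof (induction rule: dec_induct)
  case (step n)
  then show ?case using hit_prob_Suc[OF assms(1), of n \<Phi>] by linarith
qed simp

lemma reaches_mono:
  assumes "reaches G w p v \<Phi>" "v \<in> verts G" "q \<le> p" "\<And>l. walk G v l \<Longrightarrow> \<Phi> l \<Longrightarrow> \<Psi> l"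
  shows "reaches G w q v \<Psi>"
  using assms hit_prob_mono[of v \<Phi> \<Psi>] unfolding reaches_def by (meson order_trans)

lemma reaches_now: "\<Phi> [] \<Longrightarrow> p \<le> 1 \<Longrightarrow> reaches G w p v \<Phi>"
  unfolding reaches_def by (intro exI[of _ 0]) simp

text \<open>Strong Markov property at the first time when \<open>\<Phi>\<close> holds;
  \<open>\<Psi>\<close> may depend on the history. The number of further steps depends on the
  history too, but at each stage there are only finitely many out-edges, so a maximum
  exists.\<close>

lemma hit_prob_compose:
  assumes "v \<in> verts G" "p \<ge> 0"
    "\<And>l. walk G v l \<Longrightarrow> \<Phi> l \<Longrightarrow> reaches G w p (walk_end G v l) (\<Psi> l)"
  shows "\<exists>N'. hit_prob G w N' v (\<lambda>l. \<exists>l1 l2. l = l1 @ l2 \<and> \<Phi> l1 \<and> \<Psi> l1 l2) \<ge> hit_prob G w N v \<Phi> * p"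
  using assms
proof (induction N arbitrary: v \<Phi> \<Psi>)
  case (0 v \<Phi> \<Psi>)
  show ?case
  proof (cases "\<Phi> []")
    case True
    then have "reaches G w p v (\<Psi> [])" using 0(3)[of "[]"] 0(1) by simp
    then have "reaches G w p v (\<lambda>l. \<exists>l1 l2. l = l1 @ l2 \<and> \<Phi> l1 \<and> \<Psi> l1 l2)"
      by (rule reaches_mono[OF _ 0(1) order_refl]) (metis True append_Nil)
    then show ?thesis using True by (simp add: reaches_def)
  next
    case False
    then show ?thesis using hit_prob_bounds[OF 0(1)] by (auto intro: exI[of _ 0])
  qed
next
  case (Suc N v \<Phi> \<Psi>)
  let ?X = "\<lambda>l. \<exists>l1 l2. l = l1 @ l2 \<and> \<Phi> l1 \<and> \<Psi> l1 l2"
  show ?case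
  proof (cases "\<Phi> []")
    case True
    then have "reaches G w p v (\<Psi> [])" using Suc.prems(3)[of "[]"] Suc.prems(1) by simp
    then have "reaches G w p v ?X"
      by (rule reaches_mono[OF _ Suc.prems(1) order_refl]) (metis True append_Nil)
    then show ?thesis using True by (simp add: reaches_def)
  next
    case False
    let ?Y = "\<lambda>e l. \<exists>l1 l2. l = l1 @ l2 \<and> \<Phi> (e # l1) \<and> \<Psi> (e # l1) l2"
    have "\<exists>N'. hit_prob G w N' (head G e) (?Y e) \<ge> hit_prob G w N (head G e) (\<lambda>l. \<Phi> (e # l)) * p"
      if e: "e \<in> out_arcs G v" for e
    proof (rule Suc.IH)
      show "head G e \<in> verts G" using head_verts[OF out_arcsD(1)[OF e]] .
      show "reaches G w p (walk_end G (head G e) l) (\<Psi> (e # l))" if "walk G (head G e) l" "\<Phi> (e # l)" for l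
        using Suc.prems(3)[of "e # l"] e that by simp
    qed (rule Suc.prems)
    then have "\<exists>n. \<forall>e\<in>out_arcs G v.
        hit_prob G w (n e) (head G e) (?Y e) \<ge> hit_prob G w N (head G e) (\<lambda>l. \<Phi> (e # l)) * p"
      by (intro bchoice ballI)
    then obtain n where n: "\<And>e. e \<in> out_arcs G v \<Longrightarrow>
        hit_prob G w (n e) (head G e) (?Y e) \<ge> hit_prob G w N (head G e) (\<lambda>l. \<Phi> (e # l)) * p" by blast
    define N' where "N' = Max (n ` out_arcs G v)"
    have N': "n e \<le> N'" if "e \<in> out_arcs G v" for e
      using that finite_out[OF Suc.prems(1)] by (simp add: N'_def)
    have le: "hit_prob G w N (head G e) (\<lambda>l. \<Phi> (e # l)) * p \<le> hit_prob G w N' (head G e) (\<lambda>l. ?X (e # l))"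
      if e: "e \<in> out_arcs G v" for e
    proof -
      have h: "head G e \<in> verts G" using head_verts[OF out_arcsD(1)[OF e]] .
      have "hit_prob G w N' (head G e) (?Y e) \<le> hit_prob G w N' (head G e) (\<lambda>l. ?X (e # l))"
        using h by (rule hit_prob_mono) (metis append_Cons)
      then show ?thesis using n[OF e] hit_prob_mono_time[OF h N'[OF e], of "?Y e"] by linarith
    qed
    have "hit_prob G w (Suc N) v \<Phi> * p =
        (\<Sum>e\<in>out_arcs G v. trans_prob G w e * (hit_prob G w N (head G e) (\<lambda>l. \<Phi> (e # l)) * p))"
      using False by (simp add: sum_distrib_right mult.assoc)
    also have "\<dots> \<le> (\<Sum>e\<in>out_arcs G v. trans_prob G w e * hit_prob G w N' (head G e) (\<lambda>l. ?X (e # l)))"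
      using le trans_prob_pos[OF out_arcsD(1)] by (intro sum_mono mult_left_mono) (auto intro: less_imp_le)
    also have "\<dots> \<le> hit_prob G w (Suc N') v ?X"
    proof (cases "?X []")
      case True
      have "(\<Sum>e\<in>out_arcs G v. trans_prob G w e * hit_prob G w N' (head G e) (\<lambda>l. ?X (e # l))) \<le>
          (\<Sum>e\<in>out_arcs G v. trans_prob G w e)"
        using trans_prob_pos[OF out_arcsD(1)] hit_prob_bounds[OF head_verts[OF out_arcsD(1)]]
        by (intro sum_mono mult_left_le) (auto intro: less_imp_le)
      also have "\<dots> = 1" using sum_trans_prob[OF Suc.prems(1)] .
      finally show ?thesis using True by simp
    next
      case False
      then show ?thesis by (simp only: hit_prob.simps if_False order_refl)
    qed
    finally show ?thesis by blast
  qed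
qed

lemma reaches_compose:
  assumes "reaches G w q v \<Phi>" "v \<in> verts G" "p \<ge> 0"
    "\<And>l. walk G v l \<Longrightarrow> \<Phi> l \<Longrightarrow> reaches G w p (walk_end G v l) (\<Psi> l)"
  shows "reaches G w (q * p) v (\<lambda>l. \<exists>l1 l2. l = l1 @ l2 \<and> \<Phi> l1 \<and> \<Psi> l1 l2)"
proof -
  obtain N where N: "q \<le> hit_prob G w N v \<Phi>" using assms(1) by (auto simp: reaches_def)
  have "q * p \<le> hit_prob G w N v \<Phi> * p" using N assms(3) by (rule mult_right_mono)
  moreover obtain N' where "hit_prob G w N v \<Phi> * p \<le>
      hit_prob G w N' v (\<lambda>l. \<exists>l1 l2. l = l1 @ l2 \<and> \<Phi> l1 \<and> \<Psi> l1 l2)"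
    using hit_prob_compose[OF assms(2-4), where N = N] by blast
  ultimately show ?thesis unfolding reaches_def by (intro exI[of _ N']) linarith
qed

text \<open>Turns a probability estimate into a deterministic walk. This is how edges are shown to
  be short and distant places to be reachable.\<close>

lemma reaches_witness:
  assumes "reaches G w p v \<Phi>" "p > 0" "v \<in> verts G"
  obtains l where "walk G v l" "\<Phi> l"
proof -
  have "\<exists>l. walk G v l \<and> \<Phi> l" if "hit_prob G w N v \<Phi> > 0" "v \<in> verts G" for N
    using that
  proof (induction N arbitrary: v \<Phi>)
    case 0
    then show ?case by (auto split: if_splits intro: exI[of _ "[]"])
  next
    case (Suc N)
    show ?case
    proof (cases "\<Phi> []")
      case True
      then show ?thesis using Suc.prems by (auto intro: exI[of _ "[]"])
    next
      case False
      have "\<exists>e\<in>out_arcs G v. trans_prob G w e * hit_prob G w N (head G e) (\<lambda>l. \<Phi> (e # l)) > 0"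
      proof (rule ccontr)
        assume "\<not> ?thesis"
        then have "hit_prob G w (Suc N) v \<Phi> \<le> 0" using False by (auto intro!: sum_nonpos simp: not_less)
        then show False using Suc.prems(1) by linarith
      qed
      then obtain e where e: "e \<in> out_arcs G v" "trans_prob G w e * hit_prob G w N (head G e) (\<lambda>l. \<Phi> (e # l)) > 0"
        by blast
      then have "hit_prob G w N (head G e) (\<lambda>l. \<Phi> (e # l)) > 0"
        using trans_prob_pos[OF out_arcsD(1)[OF e(1)]] zero_less_mult_pos by blast
      then obtain l where "walk G (head G e) l" "\<Phi> (e # l)"
        using Suc.IH head_verts[OF out_arcsD(1)[OF e(1)]] by blast
      then show ?thesis using e(1) by (intro exI[of _ "e # l"]) auto
    qed
  qed
  then show thesis using assms that unfolding reaches_def by (meson less_le_trans)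
qed

definition walk_weight :: "'e list \<Rightarrow> real" where
  "walk_weight l = prod_list (map (trans_prob G w) l)"

lemma first_hits_props:
  assumes "v \<in> verts G"
  shows finite_first_hits: "finite (first_hits G N v \<Phi>)"
    and sum_first_hits: "(\<Sum>l\<in>first_hits G N v \<Phi>. walk_weight l) = hit_prob G w N v \<Phi>"
    and walk_first_hits: "l \<in> first_hits G N v \<Phi> \<Longrightarrow> walk G v l"
  using assms
proof (induction N arbitrary: v \<Phi> l)
  case 0
  {
    case 1 then show ?case by simp
  next
    case 2 then show ?case by (simp add: walk_weight_def)
  next
    case 3 then show ?case by (auto split: if_splits)
  }
next
  case (Suc N)
  {
    case 1
    then show ?case using finite_out Suc.IH(1) head_verts out_arcsD(1) by auto
  next
    case 2
    show ?case
    proof (cases "\<Phi> []")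
      case True
      then show ?thesis by (simp add: walk_weight_def)
    next
      case False
      have "(\<Sum>l\<in>(#) e ` first_hits G N (head G e) (\<lambda>l. \<Phi> (e # l)). walk_weight l) =
          trans_prob G w e * hit_prob G w N (head G e) (\<lambda>l. \<Phi> (e # l))" if e: "e \<in> out_arcs G v" for e
        using Suc.IH(2)[OF head_verts[OF out_arcsD(1)[OF e]], of "\<lambda>l. \<Phi> (e # l)"]
        by (subst sum.reindex) (auto simp: walk_weight_def sum_distrib_left[symmetric])
      then show ?thesis
        using False finite_out[OF 2] Suc.IH(1) head_verts out_arcsD(1)
        by (simp add: sum.UNION_disjoint) (subst sum.UNION_disjoint; auto)
    qed
  next
    case 3
    then show ?case using Suc.IH(3) head_verts out_arcsD(1) by (auto split: if_splits)
  }
qed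

lemma first_hits_Suc: "first_hits G N v \<Phi> \<subseteq> first_hits G (Suc N) v \<Phi>"
proof (induction N arbitrary: v \<Phi>)
  case (Suc N)
  show ?case
  proof (cases "\<Phi> []")
    case False
    then show ?thesis using Suc[of _ "\<lambda>l. \<Phi> (_ # l)"]
      by (simp only: first_hits.simps(2)[of G N v] first_hits.simps(2)[of G "Suc N" v] if_False) blast
  qed simp
qed simp

lemma first_hits_cover:
  "walk G v l \<Longrightarrow> \<Phi> l \<Longrightarrow> length l \<le> N \<Longrightarrow> \<exists>l'\<in>first_hits G N v \<Phi>. \<exists>l''. l = l' @ l''"
proof (induction N arbitrary: v \<Phi> l)
  case 0
  then show ?case by auto
next
  case (Suc N)
  show ?case
  proof (cases l)
    case Nil
    then show ?thesis using Suc.prems by auto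
  next
    case (Cons e m)
    then have "\<exists>l'\<in>first_hits G N (head G e) (\<lambda>l. \<Phi> (e # l)). \<exists>l''. m = l' @ l''"
      using Suc.prems by (intro Suc.IH) auto
    then show ?thesis using Suc.prems Cons by (cases "\<Phi> []") force+
  qed
qed

lemma finite_walks: "v \<in> verts G \<Longrightarrow> finite {l. walk G v l \<and> length l = n}"
proof (induction n arbitrary: v)
  case 0
  have "{l. walk G v l \<and> length l = 0} \<subseteq> {[]}" by auto
  then show ?case using finite_subset by blast
next
  case (Suc n)
  have "{l. walk G v l \<and> length l = Suc n} \<subseteq> (\<Union>e\<in>out_arcs G v. (#) e ` {l. walk G (head G e) l \<and> length l = n})"
  proof
    fix l assume "l \<in> {l. walk G v l \<and> length l = Suc n}"
    then show "l \<in> (\<Union>e\<in>out_arcs G v. (#) e ` {l. walk G (head G e) l \<and> length l = n})"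
      by (cases l) auto
  qed
  moreover have "finite (\<Union>e\<in>out_arcs G v. (#) e ` {l. walk G (head G e) l \<and> length l = n})"
    using Suc.IH[OF head_verts[OF out_arcsD(1)]] finite_out[OF Suc.prems] by blast
  ultimately show ?case using finite_subset by blast
qed

lemma countable_walks: "v \<in> verts G \<Longrightarrow> countable {l. walk G v l}"
proof -
  assume v: "v \<in> verts G"
  have "{l. walk G v l} = (\<Union>n. {l. walk G v l \<and> length l = n})" by auto
  then show ?thesis using finite_walks[OF v] by (simp add: countable_finite)
qed

section \<open>Transfer from the driving noise to finite walks\<close>

abbreviation "noise \<equiv> noise_space G w"

text \<open>The set \<open>S\<close> for the next jump has two uses: \<open>UNIV\<close> gives the
  probability of following \<open>l\<close>, the complement of the out-edges gives a null
  event.\<close>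

definition cylinder :: "complex \<Rightarrow> 'e list \<Rightarrow> 'e set \<Rightarrow> 'e noise set" where
  "cylinder v l S = {\<omega> \<in> space noise. (\<forall>i<length l. snd (\<omega> (i, walk_end G v (take i l))) = l ! i) \<and>
     snd (\<omega> (length l, walk_end G v l)) \<in> S}"

lemma pmf_step: "v \<in> verts G \<Longrightarrow> pmf (weighted_pmf w (out_arcs G v)) e =
    (if e \<in> out_arcs G v then trans_prob G w e else 0)"
  using finite_out[of v] w_pos total_rate_pos[of v]
  by (subst pmf_weighted_pmf) (auto simp: trans_prob_def total_rate_def out_arcs_def intro: less_imp_le)

lemma walk_take_end: "walk G v l \<Longrightarrow> i < length l \<Longrightarrow> l ! i \<in> out_arcs G (walk_end G v (take i l))"
proof (induction l arbitrary: v i)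
  case (Cons e l)
  then show ?case by (cases i) auto
qed simp

text \<open>Each jump reads its own variable: the indices differ in the time component even if a
  vertex is visited twice, so independence makes the measure of a cylinder a product.\<close>

lemma prob_space_noise: "prob_space noise"
  and emeasure_cylinder: "walk G v l \<Longrightarrow> emeasure noise (cylinder v l S) =
    ennreal (walk_weight l * measure (measure_pmf (weighted_pmf w (out_arcs G (walk_end G v l)))) S)"
  and sets_cylinder: "walk G v l \<Longrightarrow> cylinder v l S \<in> sets noise"
proof -
  \<comment> \<open>\<open>product_prob_space\<close> needs a probability measure at every index, also outside the vertex set\<close>
  define M where "M = (\<lambda>(n::nat, v). if v \<in> verts G then
     density lborel (\<lambda>t. ennreal (exponential_density (total_rate G w v) t))
       \<Otimes>\<^sub>M measure_pmf (weighted_pmf w (out_arcs G v))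
     else return (borel \<Otimes>\<^sub>M count_space UNIV) undefined)"
  have P: "prob_space (M i)" for i
    using prob_space_exponential_density total_rate_pos
    by (auto simp: M_def split: prod.split intro!: prob_space_pair prob_space_return prob_space_measure_pmf)
      (auto simp: space_pair_measure)
  interpret product_prob_space M "UNIV \<times> verts G"
    by (intro product_prob_space.intro product_sigma_finite.intro product_prob_space_axioms.intro P
      prob_space_imp_sigma_finite)
  have eq: "noise = PiM (UNIV \<times> verts G) M"
    unfolding noise_space_def by (intro PiM_cong) (auto simp: M_def)
  show "prob_space noise" unfolding eq by (rule P.prob_space_axioms)
  assume l: "walk G v l"
  define u where "u i = walk_end G v (take i l)" for i
  define J where "J = (\<lambda>i. (i, u i)) ` {..length l}"
  define X where "X = (\<lambda>p::nat \<times> complex. UNIV \<times> (if fst p < length l then {l ! fst p} else S) :: (real \<times> 'e) set)"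
  have uv: "u i \<in> verts G" for i
  proof -
    have "walk G v (take i l)" using l walk_append[of v "take i l" "drop i l"] by simp
    then show ?thesis unfolding u_def by (rule walk_end_verts)
  qed
  have uL: "u (length l) = walk_end G v l" by (simp add: u_def)
  have J: "J \<subseteq> UNIV \<times> verts G" "finite J" using uv by (auto simp: J_def)
  have X: "X i \<in> sets (M i)" if "i \<in> J" for i
    using that uv by (auto simp: J_def X_def M_def)
  have cyl: "cylinder v l S = {x \<in> space (PiM (UNIV \<times> verts G) M). \<forall>i\<in>J. x i \<in> X i}"
    unfolding cylinder_def eq J_def lessThan_Suc_atMost[symmetric] lessThan_Suc
    by (auto simp: X_def u_def mem_Times_iff)
  show "cylinder v l S \<in> sets noise"
    unfolding cyl eq
  proof (intro sets.sets_Collect_finite_All J(2))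
    fix i assume i: "i \<in> J"
    have "(\<lambda>x. x i) -` X i \<inter> space (PiM (UNIV \<times> verts G) M) \<in> sets (PiM (UNIV \<times> verts G) M)"
      using i J(1) X[OF i] by (intro measurable_sets[OF measurable_component_singleton]) auto
    then show "{x \<in> space (PiM (UNIV \<times> verts G) M). x i \<in> X i} \<in> sets (PiM (UNIV \<times> verts G) M)"
      by (simp add: vimage_def Int_def conj_commute)
  qed
  have em: "emeasure (M (i, x)) (UNIV \<times> T) = ennreal (measure (measure_pmf (weighted_pmf w (out_arcs G x))) T)"
    if x: "x \<in> verts G" for i x T
  proof -
    interpret D: prob_space "density lborel (\<lambda>t. ennreal (exponential_density (total_rate G w x) t))"
      using prob_space_exponential_density total_rate_pos[OF x] .
    have "emeasure (M (i, x)) (UNIV \<times> T) = emeasure (density lborel (\<lambda>t. ennreal (exponential_density (total_rate G w x) t))) UNIV *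
        emeasure (measure_pmf (weighted_pmf w (out_arcs G x))) T"
      using x unfolding M_def by (subst measure_pmf.emeasure_pair_measure_Times[symmetric]) auto
    also have "emeasure (density lborel (\<lambda>t. ennreal (exponential_density (total_rate G w x) t))) UNIV = 1"
      using D.emeasure_space_1 by simp
    finally show ?thesis by (simp add: measure_pmf.emeasure_eq_measure)
  qed
  have "emeasure noise (cylinder v l S) = (\<Prod>i\<in>J. emeasure (M i) (X i))"
    unfolding cyl eq using J X by (intro emeasure_PiM_Collect) auto
  also have "\<dots> = (\<Prod>i\<le>length l. emeasure (M (i, u i)) (X (i, u i)))"
    unfolding J_def by (subst prod.reindex) (auto simp: inj_on_def)
  also have "\<dots> = (\<Prod>i\<le>length l. ennreal (if i < length l then trans_prob G w (l ! i)
      else measure (measure_pmf (weighted_pmf w (out_arcs G (walk_end G v l)))) S))"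
  proof (intro prod.cong refl)
    fix i assume "i \<in> {..length l}"
    then show "emeasure (M (i, u i)) (X (i, u i)) = ennreal (if i < length l then trans_prob G w (l ! i)
      else measure (measure_pmf (weighted_pmf w (out_arcs G (walk_end G v l)))) S)"
      using walk_take_end[OF l, of i, folded u_def] pmf_step[OF uv[of i], of "l ! i"] uL
      by (auto simp: X_def em[OF uv] measure_pmf_single)
  qed
  also have "\<dots> = ennreal (\<Prod>i\<le>length l. if i < length l then trans_prob G w (l ! i)
      else measure (measure_pmf (weighted_pmf w (out_arcs G (walk_end G v l)))) S)"
    using trans_prob_pos out_arcsD(1)[OF walk_take_end[OF l]] by (intro prod_ennreal) (auto intro: less_imp_le)
  also have "(\<Prod>i\<le>length l. if i < length l then trans_prob G w (l ! i)
      else measure (measure_pmf (weighted_pmf w (out_arcs G (walk_end G v l)))) S) =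
      (\<Prod>i<length l. trans_prob G w (l ! i)) * measure (measure_pmf (weighted_pmf w (out_arcs G (walk_end G v l)))) S"
    by (simp add: lessThan_Suc_atMost[symmetric])
  also have "(\<Prod>i<length l. trans_prob G w (l ! i)) = walk_weight l"
    unfolding walk_weight_def prod.list_conv_set_nth by (simp add: atLeast0LessThan)
  finally show "emeasure noise (cylinder v l S) =
    ennreal (walk_weight l * measure (measure_pmf (weighted_pmf w (out_arcs G (walk_end G v l)))) S)" .
qed

lemma measure_cylinder_UNIV: "walk G v l \<Longrightarrow> measure noise (cylinder v l UNIV) = walk_weight l"
proof -
  assume l: "walk G v l"
  have "walk_weight l \<ge> 0"
    using l unfolding walk_weight_def
    by (induction l arbitrary: v) (auto intro!: mult_nonneg_nonneg less_imp_le[OF trans_prob_pos])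
  then show ?thesis using emeasure_cylinder[OF l, of UNIV] by (simp add: measure_def)
qed

definition edges :: "complex \<Rightarrow> 'e noise \<Rightarrow> nat \<Rightarrow> 'e list" where
  "edges v \<omega> n = map (jump_edge G v \<omega>) [0..<n]"

lemma walk_end_edges: "walk_end G v (edges v \<omega> n) = jump_chain G v \<omega> n"
proof (induction n)
  case (Suc n)
  have "edges v \<omega> (Suc n) = edges v \<omega> n @ [jump_edge G v \<omega> n]" by (simp add: edges_def)
  then show ?case using Suc by (simp add: walk_end_append jump_edge_def)
qed (simp add: edges_def)

lemma take_edges: "i \<le> n \<Longrightarrow> take i (edges v \<omega> n) = edges v \<omega> i"
  by (simp add: edges_def take_map)

lemma edges_cylinder:
  assumes "\<omega> \<in> space noise"
  shows "\<omega> \<in> cylinder v (edges v \<omega> n) S \<longleftrightarrow> jump_edge G v \<omega> n \<in> S"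
proof -
  have "snd (\<omega> (i, walk_end G v (take i (edges v \<omega> n)))) = edges v \<omega> n ! i" if "i < length (edges v \<omega> n)" for i
  proof -
    have "i < n" using that by (simp add: edges_def)
    then have "edges v \<omega> n ! i = jump_edge G v \<omega> i" by (simp add: edges_def)
    then show ?thesis using \<open>i < n\<close> by (simp add: take_edges walk_end_edges jump_edge_def)
  qed
  then show ?thesis using assms by (simp add: cylinder_def walk_end_edges jump_edge_def) (simp add: edges_def)
qed

text \<open>Up to a null set, \<open>H\<close> is covered by the increasing events that a first hit
  has occurred within \<open>N\<close> steps. The strict inequality is what passes from their union
  to a single \<open>N\<close>.\<close>

lemma hit_prob_exceeds:
  assumes v: "v \<in> verts G" and p: "p \<ge> 0" and H: "measure noise H > p"
    and \<Phi>: "\<And>\<omega>. \<omega> \<in> H \<Longrightarrow> \<exists>n. \<Phi> (edges v \<omega> n)"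
  shows "\<exists>N. hit_prob G w N v \<Phi> > p"
proof (rule ccontr)
  assume "\<not> ?thesis"
  then have le: "hit_prob G w N v \<Phi> \<le> p" for N by (simp add: not_less)
  interpret N: prob_space noise by (rule prob_space_noise)
  \<comment> \<open>\<open>measure\<close> is 0 on sets that are not measurable, so the bound itself
    yields measurability.\<close>
  have Hs: "H \<in> sets noise" using H p measure_notin_sets by fastforce
  \<comment> \<open>Null event that after some walk the next chosen edge does not start at the
    current vertex.\<close>
  define Bad where "Bad = (\<Union>l\<in>{l. walk G v l}. cylinder v l (- out_arcs G (walk_end G v l)))"
  have bad0: "cylinder v l (- out_arcs G (walk_end G v l)) \<in> null_sets noise" if l: "walk G v l" for l
  proof -
    have "set_pmf (weighted_pmf w (out_arcs G (walk_end G v l))) \<subseteq> out_arcs G (walk_end G v l)"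
      using pmf_step[OF walk_end_verts[OF l]] by (auto simp: set_pmf_eq split: if_splits)
    then have "measure (measure_pmf (weighted_pmf w (out_arcs G (walk_end G v l)))) (- out_arcs G (walk_end G v l)) = 0"
      by (auto simp: measure_pmf_zero_iff)
    then show ?thesis using emeasure_cylinder[OF l] sets_cylinder[OF l] by (auto simp: null_sets_def)
  qed
  have Bad: "Bad \<in> null_sets noise"
    unfolding Bad_def using countable_walks[OF v] bad0 by (intro null_sets_UN') auto
  define C where "C N = (\<Union>l\<in>first_hits G N v \<Phi>. cylinder v l UNIV)" for N
  have Cs: "C N \<in> sets noise" for N
    unfolding C_def using finite_first_hits[OF v] walk_first_hits[OF v] sets_cylinder
    by (intro sets.finite_UN) auto
  have Cle: "measure noise (C N) \<le> p" for N
  proof -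
    have "measure noise (C N) \<le> (\<Sum>l\<in>first_hits G N v \<Phi>. measure noise (cylinder v l UNIV))"
      unfolding C_def using finite_first_hits[OF v] walk_first_hits[OF v] sets_cylinder
      by (intro N.finite_measure_subadditive_finite) auto
    also have "\<dots> = hit_prob G w N v \<Phi>"
      unfolding sum_first_hits[OF v, symmetric] using walk_first_hits[OF v]
      by (intro sum.cong refl measure_cylinder_UNIV) auto
    finally show ?thesis using le[of N] by linarith
  qed
  have "incseq C" unfolding C_def using first_hits_Suc by (intro incseq_SucI) blast
  then have "(\<lambda>N. measure noise (C N)) \<longlonglongrightarrow> measure noise (\<Union>N. C N)"
    using Cs by (intro N.finite_Lim_measure_incseq) auto
  then have CU: "measure noise (\<Union>N. C N) \<le> p"
    using Cle by (intro LIMSEQ_le_const2) auto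
  have "H \<subseteq> Bad \<union> (\<Union>N. C N)"
  proof
    fix \<omega> assume w: "\<omega> \<in> H"
    then have sp: "\<omega> \<in> space noise" using Hs sets.sets_into_space by blast
    obtain n where n: "\<Phi> (edges v \<omega> n)" using \<Phi>[OF w] by blast
    show "\<omega> \<in> Bad \<union> (\<Union>N. C N)"
    proof (cases "walk G v (edges v \<omega> n)")
      case True
      obtain l' l'' where l: "l' \<in> first_hits G n v \<Phi>" "edges v \<omega> n = l' @ l''"
        using first_hits_cover[where \<Phi> = \<Phi>, OF True n, of n] by (auto simp: edges_def)
      have "length l' \<le> n" using l(2) by (metis edges_def diff_zero length_append length_map length_upt le_add1)
      then have "l' = edges v \<omega> (length l')" using l(2) take_edges[of "length l'" n v \<omega>] by simp
      then have "\<omega> \<in> cylinder v l' UNIV" using edges_cylinder[OF sp, of v "length l'" UNIV] by simp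
      then show ?thesis using l(1) by (auto simp: C_def)
    next
      case False
      \<comment> \<open>The first step at which the recorded edges cease to form a walk puts
        \<open>\<omega>\<close> into \<open>Bad\<close>.\<close>
      define k where "k = (LEAST k. \<not> walk G v (edges v \<omega> k))"
      have k: "\<not> walk G v (edges v \<omega> k)" unfolding k_def using False by (rule LeastI)
      then have "k \<noteq> 0" using v by (intro notI) (simp add: edges_def)
      then obtain m where m: "k = Suc m" by (cases k) auto
      have wm: "walk G v (edges v \<omega> m)" using not_less_Least[of m "\<lambda>k. \<not> walk G v (edges v \<omega> k)"] m k_def by auto
      have "edges v \<omega> k = edges v \<omega> m @ [jump_edge G v \<omega> m]" by (simp add: edges_def m)
      then have "jump_edge G v \<omega> m \<notin> out_arcs G (walk_end G v (edges v \<omega> m))"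
        using k wm head_verts out_arcsD(1) by (auto simp: walk_append)
      then have "\<omega> \<in> cylinder v (edges v \<omega> m) (- out_arcs G (walk_end G v (edges v \<omega> m)))"
        using edges_cylinder[OF sp] by simp
      then show ?thesis using wm by (auto simp: Bad_def)
    qed
  qed
  then have "measure noise H \<le> measure noise (Bad \<union> (\<Union>N. C N))"
    using Bad Cs by (intro N.finite_measure_mono) auto
  also have "\<dots> = measure noise (\<Union>N. C N)"
    using Cs by (subst Un_commute, intro measure_Un_null_set Bad) auto
  finally show False using CU H by linarith
qed

end

section \<open>Circuits of the walk\<close>

definition wtrace :: "('e \<Rightarrow> real \<Rightarrow> complex) \<Rightarrow> complex \<Rightarrow> 'e list \<Rightarrow> complex set" where
  "wtrace c v l = insert v (\<Union>e\<in>set l. path_image (c e))"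

text \<open>Neighbourhood, in the maximum norm, of the box spanned by \<open>a\<close> and
  \<open>b\<close>. For \<open>a\<close> and \<open>b\<close> on a line parallel to an axis it is
  the rectangle of a crossing.\<close>

definition tube :: "complex \<Rightarrow> complex \<Rightarrow> real \<Rightarrow> complex set" where
  "tube a b s = {x. min (Re a) (Re b) - s \<le> Re x \<and> Re x \<le> max (Re a) (Re b) + s \<and>
     min (Im a) (Im b) - s \<le> Im x \<and> Im x \<le> max (Im a) (Im b) + s}"

lemma tube_close:
  assumes "x \<in> tube a b s"
  shows "\<bar>Re a - X\<bar> \<le> r \<Longrightarrow> \<bar>Re b - X\<bar> \<le> r \<Longrightarrow> \<bar>Re x - X\<bar> \<le> r + s"
    "\<bar>Im a - X\<bar> \<le> r \<Longrightarrow> \<bar>Im b - X\<bar> \<le> r \<Longrightarrow> \<bar>Im x - X\<bar> \<le> r + s"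
  using assms by (auto simp: tube_def abs_le_iff)

text \<open>One graph of the family; crossings are available from the scale \<open>m\<close>
  upwards. The rectangle with sides 3 and 1, scaled by \<open>\<eta>\<close>, is the tube of margin
  \<open>\<eta> / 2\<close> around the segment of length \<open>2 * \<eta>\<close> between the
  centres of its two balls.\<close>

locale crossing_graph = walk_graph G w for G :: "(complex, 'e) pre_digraph" and w :: "'e \<Rightarrow> real" +
  fixes c :: "'e \<Rightarrow> real \<Rightarrow> complex" and p0 m :: real
  assumes embedding: "good_embedding G c" and locally_finite: "bounded S \<Longrightarrow> finite (verts G \<inter> S)" and p0: "0 < p0" "p0 \<le> 1" and m: "m > 0"
    and step: "\<And>d a \<eta> v. d \<in> {1, -1, \<i>, -\<i>} \<Longrightarrow> \<eta> \<ge> m \<Longrightarrow> v \<in> verts G \<Longrightarrow> v \<in> ball a (\<eta> / 4) \<Longrightarrow>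
      reaches G w p0 v (\<lambda>l. walk_end G v l \<in> ball (a + of_real (2 * \<eta>) * d) (\<eta> / 4) \<and> wtrace c v l \<subseteq> tube a (a + of_real (2 * \<eta>) * d) (\<eta> / 2))"
begin

lemma curve:
  assumes "e \<in> arcs G"
  shows "path (c e)" "pathstart (c e) = tail G e" "pathfinish (c e) = head G e" "c e ` {0<..<1} \<inter> verts G = {}"
  using assms embedding by (auto simp: good_embedding_def intro: valid_path_imp_path)

lemma curve_ends: "e \<in> arcs G \<Longrightarrow> tail G e \<in> path_image (c e)" "e \<in> arcs G \<Longrightarrow> head G e \<in> path_image (c e)"
  using curve(2,3) pathstart_in_path_image pathfinish_in_path_image by metis+

lemma walk_end_trace: "walk G v l \<Longrightarrow> walk_end G v l \<in> wtrace c v l"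
proof (induction l arbitrary: v)
  case (Cons e l)
  then have "walk_end G (head G e) l \<in> wtrace c (head G e) l" "head G e \<in> path_image (c e)"
    using curve_ends by auto
  then show ?case by (auto simp: wtrace_def)
qed (simp add: wtrace_def)

lemma trace_append: "walk G v l \<Longrightarrow> wtrace c v (l @ l') = wtrace c v l \<union> wtrace c (walk_end G v l) l'"
  using walk_end_trace[of v l] by (auto simp: wtrace_def)

lemma trace_path:
  "walk G v l \<Longrightarrow> \<exists>g. path g \<and> pathstart g = v \<and> pathfinish g = walk_end G v l \<and> path_image g = wtrace c v l"
proof (induction l arbitrary: v)
  case Nil
  then show ?case by (intro exI[of _ "\<lambda>_. v"]) (auto simp: path_def pathstart_def pathfinish_def path_image_def wtrace_def)
next
  case (Cons e l)
  then obtain g where g: "path g" "pathstart g = head G e" "pathfinish g = walk_end G (head G e) l" "path_image g = wtrace c (head G e) l"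
    by auto
  have e: "e \<in> arcs G" "tail G e = v" using Cons.prems by auto
  have "path_image (c e +++ g) = wtrace c v (e # l)"
    using g curve[OF e(1)] curve_ends[OF e(1)] e(2) by (auto simp: path_image_join wtrace_def)
  then show ?case using g curve[OF e(1)] e(2) by (intro exI[of _ "c e +++ g"]) auto
qed

lemma connected_trace: "walk G v l \<Longrightarrow> Topological_Spaces.connected (wtrace c v l)"
  using trace_path connected_path_image by metis

definition moves :: "real \<Rightarrow> complex \<Rightarrow> complex \<Rightarrow> complex \<Rightarrow> 'e list \<Rightarrow> bool" where
  "moves \<eta> a b v l \<longleftrightarrow> walk_end G v l \<in> ball b (\<eta> / 4) \<and> wtrace c v l \<subseteq> tube a b (\<eta> / 2)"

text \<open>The target ball of a crossing is the starting ball of the next one, so crossings in one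
  direction can be chained.\<close>

lemma straight_moves:
  assumes d: "d \<in> {1, -1, \<i>, -\<i>}" and \<eta>: "\<eta> \<ge> m" and v: "v \<in> verts G" "v \<in> ball a (\<eta> / 4)"
  shows "reaches G w (p0 ^ n) v (moves \<eta> a (a + of_real (2 * \<eta> * real n) * d) v)"
proof (induction n)
  case 0
  have "\<bar>Re v - Re a\<bar> \<le> \<eta> / 4" "\<bar>Im v - Im a\<bar> \<le> \<eta> / 4"
    using v(2) abs_Re_le_cmod[of "v - a"] abs_Im_le_cmod[of "v - a"] by (auto simp: dist_norm norm_minus_commute)
  then have "Re a - \<eta> / 2 \<le> Re v" "Re v \<le> Re a + \<eta> / 2" "Im a - \<eta> / 2 \<le> Im v" "Im v \<le> Im a + \<eta> / 2"
    using \<eta> m by linarith+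
  then have "moves \<eta> a a v []" using v(2) by (simp add: moves_def wtrace_def tube_def)
  then show ?case by (intro reaches_now) auto
next
  case (Suc n)
  let ?b = "a + of_real (2 * \<eta> * real n) * d" and ?b' = "a + of_real (2 * \<eta> * real (Suc n)) * d"
  have eq: "?b + of_real (2 * \<eta>) * d = ?b'" by (simp add: algebra_simps)
  have "reaches G w (p0 ^ n * p0) v (\<lambda>l. \<exists>l1 l2. l = l1 @ l2 \<and> moves \<eta> a ?b v l1 \<and> moves \<eta> ?b ?b' (walk_end G v l1) l2)"
  proof (rule reaches_compose[OF Suc.IH v(1)])
    fix l assume l: "walk G v l" "moves \<eta> a ?b v l"
    show "reaches G w p0 (walk_end G v l) (moves \<eta> ?b ?b' (walk_end G v l))"
      using step[OF d \<eta> walk_end_verts[OF l(1)], of ?b] l(2) unfolding moves_def eq by simp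
  qed (use p0 in auto)
  then show ?case
  proof (rule reaches_mono[OF _ v(1)])
    fix l assume l: "walk G v l" "\<exists>l1 l2. l = l1 @ l2 \<and> moves \<eta> a ?b v l1 \<and> moves \<eta> ?b ?b' (walk_end G v l1) l2"
    then obtain l1 l2 where l12: "l = l1 @ l2" "moves \<eta> a ?b v l1" "moves \<eta> ?b ?b' (walk_end G v l1) l2" by blast
    define q where "q = 2 * \<eta> * real n"
    have q: "2 * \<eta> * real n = q" "2 * \<eta> * real (Suc n) = q + 2 * \<eta>" "q \<ge> 0"
      using \<eta> m by (auto simp: q_def algebra_simps)
    have "tube a ?b (\<eta> / 2) \<subseteq> tube a ?b' (\<eta> / 2)" "tube ?b ?b' (\<eta> / 2) \<subseteq> tube a ?b' (\<eta> / 2)"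
      using d \<eta> m q(3) unfolding q(1,2) by (auto simp: tube_def)
    then show "moves \<eta> a ?b' v l"
      using l12 l(1) unfolding moves_def l12(1) walk_end_append
      by (subst trace_append) (auto simp: walk_append)
  qed simp
qed

text \<open>Only multiples of \<open>2 * \<eta>\<close> can be travelled, so \<open>t\<close> is
  rounded. The exponent is the bound \<open>K\<close>, not the actual number of crossings, which
  makes the estimate uniform in \<open>t\<close>.\<close>

lemma move_to:
  assumes d: "d \<in> {1, \<i>}" and \<eta>: "\<eta> \<ge> m" and t: "\<bar>t\<bar> \<le> 2 * \<eta> * real K"
  obtains s where "\<bar>s - t\<bar> \<le> \<eta>" "\<And>v. v \<in> verts G \<Longrightarrow> v \<in> ball a (\<eta> / 4) \<Longrightarrow>
    reaches G w (p0 ^ K) v (moves \<eta> a (a + of_real s * d) v)"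
proof -
  define k where "k = round (t / (2 * \<eta>))"
  have \<eta>0: "\<eta> > 0" using \<eta> m by simp
  have 1: "\<bar>2 * \<eta> * of_int k - t\<bar> \<le> \<eta>"
  proof -
    have "\<bar>of_int k - t / (2 * \<eta>)\<bar> \<le> 1 / 2" unfolding k_def by (rule of_int_round_abs_le)
    then have "2 * \<eta> * \<bar>of_int k - t / (2 * \<eta>)\<bar> \<le> 2 * \<eta> * (1 / 2)" using \<eta>0 by (intro mult_left_mono) auto
    moreover have "2 * \<eta> * \<bar>of_int k - t / (2 * \<eta>)\<bar> = \<bar>2 * \<eta> * (of_int k - t / (2 * \<eta>))\<bar>"
      using \<eta>0 by (simp add: abs_mult)
    moreover have "2 * \<eta> * (of_int k - t / (2 * \<eta>)) = 2 * \<eta> * of_int k - t" using \<eta>0 by (simp add: field_simps)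
    ultimately show ?thesis by simp
  qed
  have "nat \<bar>k\<bar> \<le> K"
  proof -
    have "- real K \<le> t / (2 * \<eta>)" "t / (2 * \<eta>) \<le> real K"
      using t \<eta>0 by (auto simp: abs_le_iff pos_le_divide_eq pos_divide_le_eq mult_ac)
    then show ?thesis
      using round_mono[of "of_int (- int K)" "t / (2 * \<eta>)"] round_mono[of "t / (2 * \<eta>)" "of_int (int K)"]
      unfolding k_def round_of_int by simp
  qed
  define d' where "d' = (if k \<ge> 0 then d else - d)"
  have d': "d' \<in> {1, -1, \<i>, -\<i>}" using d by (auto simp: d'_def)
  have eqd: "of_real (2 * \<eta> * real (nat \<bar>k\<bar>)) * d' = of_real (2 * \<eta> * of_int k) * d"
    by (auto simp: d'_def)
  then have "reaches G w (p0 ^ nat \<bar>k\<bar>) v (moves \<eta> a (a + of_real (2 * \<eta> * of_int k) * d) v)"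
    if "v \<in> verts G" "v \<in> ball a (\<eta> / 4)" for v
    using straight_moves[OF d' \<eta> that, of "nat \<bar>k\<bar>", unfolded eqd] by blast
  then have "reaches G w (p0 ^ K) v (moves \<eta> a (a + of_real (2 * \<eta> * of_int k) * d) v)"
    if "v \<in> verts G" "v \<in> ball a (\<eta> / 4)" for v
    using p0 \<open>nat \<bar>k\<bar> \<le> K\<close> that
    by (intro reaches_mono[of "p0 ^ nat \<bar>k\<bar>" v _ "p0 ^ K"]) (auto intro: power_decreasing)
  then show thesis using 1 that by blast
qed

lemma move_on:
  assumes d: "d \<in> {1, \<i>}" and \<eta>: "\<eta> \<ge> m" and v: "v \<in> verts G"
    and r: "reaches G w (p0 ^ n) v \<Phi>" and \<Phi>: "\<And>l. walk G v l \<Longrightarrow> \<Phi> l \<Longrightarrow> walk_end G v l \<in> ball a (\<eta> / 4)"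
    and t: "\<bar>t\<bar> \<le> 2 * \<eta> * real K"
  obtains s where "\<bar>s - t\<bar> \<le> \<eta>" "reaches G w (p0 ^ (n + K)) v (\<lambda>l. \<exists>l1 l2. l = l1 @ l2 \<and> \<Phi> l1 \<and>
      moves \<eta> a (a + of_real s * d) (walk_end G v l1) l2)"
proof -
  obtain s where s: "\<bar>s - t\<bar> \<le> \<eta>" "\<And>u. u \<in> verts G \<Longrightarrow> u \<in> ball a (\<eta> / 4) \<Longrightarrow>
      reaches G w (p0 ^ K) u (moves \<eta> a (a + of_real s * d) u)"
    using move_to[OF d \<eta> t] by blast
  have "reaches G w (p0 ^ n * p0 ^ K) v (\<lambda>l. \<exists>l1 l2. l = l1 @ l2 \<and> \<Phi> l1 \<and>
      moves \<eta> a (a + of_real s * d) (walk_end G v l1) l2)"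
    using p0 walk_end_verts \<Phi> s(2) by (intro reaches_compose[OF r v]) auto
  then show thesis using that[OF s(1)] by (simp add: power_add)
qed

lemma movesD:
  assumes "moves \<eta> a b v l" "walk G v l"
  shows "\<bar>Re (walk_end G v l) - Re b\<bar> \<le> \<eta> / 4" "\<bar>Im (walk_end G v l) - Im b\<bar> \<le> \<eta> / 4"
    "x \<in> wtrace c v l \<Longrightarrow> x \<in> tube a b (\<eta> / 2)"
  using assms abs_Re_le_cmod[of "walk_end G v l - b"] abs_Im_le_cmod[of "walk_end G v l - b"]
  by (auto simp: moves_def dist_norm norm_minus_commute)

text \<open>
  The walk follows the right, top, left and bottom side of a square around \<open>\<zeta>\<close>. The first and the last
  side are prolonged beyond their common corner, so that they cross and close the circuit.
\<close>

lemma circuit: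
  assumes \<eta>: "\<eta> \<ge> m" and v: "v \<in> verts G" "v \<in> ball \<zeta> (10 * \<eta>)"
  shows "reaches G w (p0 ^ 33) v (\<lambda>l. wtrace c v l \<subseteq> ball \<zeta> (22 * \<eta>) \<and>
    (\<forall>D. open D \<longrightarrow> simply_connected D \<longrightarrow> wtrace c v l \<subseteq> D \<longrightarrow> \<zeta> \<in> D))"
proof -
  have \<eta>0: "\<eta> > 0" using \<eta> m by simp
  have vb: "\<bar>Re v - Re \<zeta>\<bar> \<le> 10 * \<eta>" "\<bar>Im v - Im \<zeta>\<bar> \<le> 10 * \<eta>"
    using v(2) abs_Re_le_cmod[of "v - \<zeta>"] abs_Im_le_cmod[of "v - \<zeta>"] by (auto simp: dist_norm norm_minus_commute)
  let ?P = "\<lambda>n \<Phi>. reaches G w (p0 ^ n) v \<Phi>"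
  let ?J = "\<lambda>\<Phi> a b l. \<exists>l1 l2. l = l1 @ l2 \<and> \<Phi> l1 \<and> moves \<eta> a b (walk_end G v l1) l2"
  have J: "walk_end G v l \<in> ball b (\<eta> / 4)" if "walk G v l" "?J \<Phi> a b l" for \<Phi> a b l
    using that by (auto simp: moves_def walk_end_append)
  \<comment> \<open>Every move aims anew at a line fixed relative to \<open>\<zeta>\<close>, so
    errors do not accumulate and stay below \<open>\<eta>\<close>. The largest displacements of the
    six moves are 13, 16, 10, 7, 7 and 10 times \<open>\<eta>\<close>, hence 7, 8, 5, 4, 4 and 5
    crossings, 33 in all.\<close>
  obtain s1 where s1: "\<bar>s1 - (Re \<zeta> + 3 * \<eta> - Re v)\<bar> \<le> \<eta>"
    "\<And>u. u \<in> verts G \<Longrightarrow> u \<in> ball v (\<eta> / 4) \<Longrightarrow> reaches G w (p0 ^ 7) u (moves \<eta> v (v + of_real s1 * 1) u)"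
    by (rule move_to[of 1 \<eta> "Re \<zeta> + 3 * \<eta> - Re v" 7]) (use \<eta> \<eta>0 vb in auto)
  define a1 where "a1 = v + of_real s1"
  define \<Phi>1 where "\<Phi>1 = moves \<eta> v a1 v"
  have a1: "\<bar>Re a1 - (Re \<zeta> + 3 * \<eta>)\<bar> \<le> \<eta>" "Im a1 = Im v" using s1(1) by (auto simp: a1_def)
  have r1: "?P 7 \<Phi>1" using s1(2)[OF v(1)] \<eta>0 by (simp add: \<Phi>1_def a1_def)
  have e1: "walk_end G v l \<in> ball a1 (\<eta> / 4)" if "\<Phi>1 l" for l using that by (simp add: \<Phi>1_def moves_def)
  \<comment> \<open>Down to level -6 instead of -3, and in the last move to +6 instead of +3: the
    excess covers the errors when the right and the bottom side have to cross.\<close>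
  obtain s2 where s2: "\<bar>s2 - (Im \<zeta> - 6 * \<eta> - Im a1)\<bar> \<le> \<eta>" "?P (7 + 8) (?J \<Phi>1 a1 (a1 + of_real s2 * \<i>))"
    by (rule move_on[OF _ \<eta> v(1) r1 e1, of \<i> "Im \<zeta> - 6 * \<eta> - Im a1" 8]) (use a1 vb \<eta>0 in auto)
  define a2 where "a2 = a1 + of_real s2 * \<i>"
  define \<Phi>2 where "\<Phi>2 = ?J \<Phi>1 a1 a2"
  have a2: "\<bar>Im a2 - (Im \<zeta> - 6 * \<eta>)\<bar> \<le> \<eta>" "Re a2 = Re a1" using s2(1) by (auto simp: a2_def)
  have r2: "?P 15 \<Phi>2" using s2(2) by (simp add: \<Phi>2_def a2_def)
  have e2: "walk_end G v l \<in> ball a2 (\<eta> / 4)" if "walk G v l" "\<Phi>2 l" for l using J that by (auto simp: \<Phi>2_def)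
  obtain s3 where s3: "\<bar>s3 - (Im \<zeta> + 3 * \<eta> - Im a2)\<bar> \<le> \<eta>" "?P (15 + 5) (?J \<Phi>2 a2 (a2 + of_real s3 * \<i>))"
    by (rule move_on[OF _ \<eta> v(1) r2 e2, of \<i> "Im \<zeta> + 3 * \<eta> - Im a2" 5]) (use a2 \<eta>0 in auto)
  define a3 where "a3 = a2 + of_real s3 * \<i>"
  define \<Phi>3 where "\<Phi>3 = ?J \<Phi>2 a2 a3"
  have a3: "\<bar>Im a3 - (Im \<zeta> + 3 * \<eta>)\<bar> \<le> \<eta>" "Re a3 = Re a1" using s3(1) a2 by (auto simp: a3_def)
  have r3: "?P 20 \<Phi>3" using s3(2) by (simp add: \<Phi>3_def a3_def)
  have e3: "walk_end G v l \<in> ball a3 (\<eta> / 4)" if "walk G v l" "\<Phi>3 l" for l using J that by (auto simp: \<Phi>3_def)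
  obtain s4 where s4: "\<bar>s4 - (Re \<zeta> - 3 * \<eta> - Re a3)\<bar> \<le> \<eta>" "?P (20 + 4) (?J \<Phi>3 a3 (a3 + of_real s4 * 1))"
    by (rule move_on[OF _ \<eta> v(1) r3 e3, of 1 "Re \<zeta> - 3 * \<eta> - Re a3" 4]) (use a1 a3 \<eta>0 in auto)
  define a4 where "a4 = a3 + of_real s4"
  define \<Phi>4 where "\<Phi>4 = ?J \<Phi>3 a3 a4"
  have a4: "\<bar>Re a4 - (Re \<zeta> - 3 * \<eta>)\<bar> \<le> \<eta>" "Im a4 = Im a3" using s4(1) by (auto simp: a4_def)
  have r4: "?P 24 \<Phi>4" using s4(2) by (simp add: \<Phi>4_def a4_def)
  have e4: "walk_end G v l \<in> ball a4 (\<eta> / 4)" if "walk G v l" "\<Phi>4 l" for l using J that by (auto simp: \<Phi>4_def)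
  obtain s5 where s5: "\<bar>s5 - (Im \<zeta> - 3 * \<eta> - Im a4)\<bar> \<le> \<eta>" "?P (24 + 4) (?J \<Phi>4 a4 (a4 + of_real s5 * \<i>))"
    by (rule move_on[OF _ \<eta> v(1) r4 e4, of \<i> "Im \<zeta> - 3 * \<eta> - Im a4" 4]) (use a3 a4 \<eta>0 in auto)
  define a5 where "a5 = a4 + of_real s5 * \<i>"
  define \<Phi>5 where "\<Phi>5 = ?J \<Phi>4 a4 a5"
  have a5: "\<bar>Im a5 - (Im \<zeta> - 3 * \<eta>)\<bar> \<le> \<eta>" "Re a5 = Re a4" using s5(1) by (auto simp: a5_def)
  have r5: "?P 28 \<Phi>5" using s5(2) by (simp add: \<Phi>5_def a5_def)
  have e5: "walk_end G v l \<in> ball a5 (\<eta> / 4)" if "walk G v l" "\<Phi>5 l" for l using J that by (auto simp: \<Phi>5_def)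
  obtain s6 where s6: "\<bar>s6 - (Re \<zeta> + 6 * \<eta> - Re a5)\<bar> \<le> \<eta>" "?P (28 + 5) (?J \<Phi>5 a5 (a5 + of_real s6 * 1))"
    by (rule move_on[OF _ \<eta> v(1) r5 e5, of 1 "Re \<zeta> + 6 * \<eta> - Re a5" 5]) (use a4 a5 \<eta>0 in auto)
  define a6 where "a6 = a5 + of_real s6"
  have a6: "\<bar>Re a6 - (Re \<zeta> + 6 * \<eta>)\<bar> \<le> \<eta>" "Im a6 = Im a5" using s6(1) by (auto simp: a6_def)
  have r6: "?P 33 (?J \<Phi>5 a5 a6)" using s6(2) by (simp add: a6_def)
  show ?thesis
  proof (rule reaches_mono[OF r6 v(1) order_refl])
    fix l assume l: "walk G v l" "?J \<Phi>5 a5 a6 l"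
    then obtain l1 l2 l3 l4 l5 l6 where ls: "l = ((((l1 @ l2) @ l3) @ l4) @ l5) @ l6"
      and mv: "moves \<eta> v a1 v l1" "moves \<eta> a1 a2 (walk_end G v l1) l2"
        "moves \<eta> a2 a3 (walk_end G v (l1 @ l2)) l3" "moves \<eta> a3 a4 (walk_end G v ((l1 @ l2) @ l3)) l4"
        "moves \<eta> a4 a5 (walk_end G v (((l1 @ l2) @ l3) @ l4)) l5"
        "moves \<eta> a5 a6 (walk_end G v ((((l1 @ l2) @ l3) @ l4) @ l5)) l6"
      unfolding \<Phi>1_def \<Phi>2_def \<Phi>3_def \<Phi>4_def \<Phi>5_def by blast
    define v1 v2 v3 v4 v5 where vs: "v1 = walk_end G v l1" "v2 = walk_end G v1 l2" "v3 = walk_end G v2 l3"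
      "v4 = walk_end G v3 l4" "v5 = walk_end G v4 l5"
    have wk: "walk G v l1" "walk G v1 l2" "walk G v2 l3" "walk G v3 l4" "walk G v4 l5" "walk G v5 l6"
      using l(1) unfolding ls vs by (simp_all add: walk_append walk_end_append)
    note mv' = mv[unfolded walk_end_append, folded vs]
    have tr: "wtrace c v l = wtrace c v l1 \<union> wtrace c v1 l2 \<union> wtrace c v2 l3 \<union> wtrace c v3 l4 \<union> wtrace c v4 l5 \<union> wtrace c v5 l6"
      using l(1) unfolding ls walk_append walk_end_append vs by (simp add: trace_append walk_append walk_end_append Un_assoc)
    note T = movesD(3)[OF mv'(1) wk(1)] movesD(3)[OF mv'(2) wk(2)] movesD(3)[OF mv'(3) wk(3)]
      movesD(3)[OF mv'(4) wk(4)] movesD(3)[OF mv'(5) wk(5)] movesD(3)[OF mv'(6) wk(6)]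
    have re: "\<bar>Re v - Re \<zeta>\<bar> \<le> 10 * \<eta>" "\<bar>Re a1 - Re \<zeta>\<bar> \<le> 10 * \<eta>" "\<bar>Re a2 - Re \<zeta>\<bar> \<le> 10 * \<eta>"
      "\<bar>Re a3 - Re \<zeta>\<bar> \<le> 10 * \<eta>" "\<bar>Re a4 - Re \<zeta>\<bar> \<le> 10 * \<eta>" "\<bar>Re a5 - Re \<zeta>\<bar> \<le> 10 * \<eta>" "\<bar>Re a6 - Re \<zeta>\<bar> \<le> 10 * \<eta>"
      using vb(1) a1(1) a2(2) a3(2) a4(1) a5(2) a6(1) \<eta>0 by linarith+
    have im: "\<bar>Im v - Im \<zeta>\<bar> \<le> 10 * \<eta>" "\<bar>Im a1 - Im \<zeta>\<bar> \<le> 10 * \<eta>" "\<bar>Im a2 - Im \<zeta>\<bar> \<le> 10 * \<eta>"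
      "\<bar>Im a3 - Im \<zeta>\<bar> \<le> 10 * \<eta>" "\<bar>Im a4 - Im \<zeta>\<bar> \<le> 10 * \<eta>" "\<bar>Im a5 - Im \<zeta>\<bar> \<le> 10 * \<eta>" "\<bar>Im a6 - Im \<zeta>\<bar> \<le> 10 * \<eta>"
      using vb(2) a1(2) a2(1) a3(1) a4(2) a5(1) a6(2) \<eta>0 by linarith+
    have a_close: "\<bar>Re a - Re \<zeta>\<bar> \<le> 10 * \<eta>" "\<bar>Im a - Im \<zeta>\<bar> \<le> 10 * \<eta>" if "a \<in> {v, a1, a2, a3, a4, a5, a6}" for a
      using that by (elim insertE emptyE; simp only: re im)+
    have big: "\<bar>Re x - Re \<zeta>\<bar> \<le> 10 * \<eta> + \<eta> / 2 \<and> \<bar>Im x - Im \<zeta>\<bar> \<le> 10 * \<eta> + \<eta> / 2" if xl: "x \<in> wtrace c v l" for x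
    proof -
      have close: "\<bar>Re x - Re \<zeta>\<bar> \<le> 10 * \<eta> + \<eta> / 2 \<and> \<bar>Im x - Im \<zeta>\<bar> \<le> 10 * \<eta> + \<eta> / 2"
        if "x \<in> tube a b (\<eta> / 2)" "a \<in> {v, a1, a2, a3, a4, a5, a6}" "b \<in> {v, a1, a2, a3, a4, a5, a6}" for a b
        using tube_close(1)[OF that(1) a_close(1)[OF that(2)] a_close(1)[OF that(3)]]
          tube_close(2)[OF that(1) a_close(2)[OF that(2)] a_close(2)[OF that(3)]] by blast
      consider "x \<in> wtrace c v l1" | "x \<in> wtrace c v1 l2" | "x \<in> wtrace c v2 l3" | "x \<in> wtrace c v3 l4"
        | "x \<in> wtrace c v4 l5" | "x \<in> wtrace c v5 l6"
        using xl unfolding tr by blast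
      then show ?thesis
        by cases ((drule T, erule close, simp, simp)+)
    qed
    \<comment> \<open>Each coordinate is off by at most \<open>10.5 * \<eta>\<close>, so the
      distance is at most \<open>21 * \<eta>\<close>.\<close>
    have "wtrace c v l \<subseteq> ball \<zeta> (22 * \<eta>)"
    proof
      fix x assume "x \<in> wtrace c v l"
      then have "norm (x - \<zeta>) \<le> 21 * \<eta>" using big[of x] cmod_le[of "x - \<zeta>"] by auto
      then show "x \<in> ball \<zeta> (22 * \<eta>)" using \<eta>0 by (simp add: dist_norm norm_minus_commute)
    qed
    \<comment> \<open>Surrounding \<open>\<zeta>\<close> is expressed through simply connected sets,
      so that the trace need not be a Jordan curve and may contain the initial approach to the
      square.\<close>
    moreover have "\<zeta> \<in> D" if D: "open D" "simply_connected D" "wtrace c v l \<subseteq> D" for D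
    proof (rule ccontr)
      assume nD: "\<zeta> \<notin> D"
      define A where "A i = (if i = 0 then wtrace c v2 l3 else if i = 1 then wtrace c v3 l4 else
        if i = 2 then wtrace c v4 l5 else wtrace c v5 l6)" for i :: nat
      obtain \<sigma> where \<sigma>: "path \<sigma>" "pathstart \<sigma> = v2" "pathfinish \<sigma> = v3" "path_image \<sigma> = wtrace c v2 l3"
        using trace_path[OF wk(3)] vs by metis
      obtain \<tau> where \<tau>: "path \<tau>" "pathstart \<tau> = v5" "pathfinish \<tau> = walk_end G v5 l6" "path_image \<tau> = wtrace c v5 l6"
        using trace_path[OF wk(6)] by metis
      have "path_image \<sigma> \<inter> path_image \<tau> \<noteq> {}"
      proof (rule crossing_paths_meet[OF \<sigma>(1) \<tau>(1), where s = "\<eta> / 2" and a = "Re a1" and b = "Im a5"])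
        show "\<bar>Re z - Re a1\<bar> \<le> \<eta> / 2" if "z \<in> path_image \<sigma>" for z
          using tube_close(1)[OF T(3), of z "Re a1" 0] that a2 a3 unfolding \<sigma>(4) by simp
        show "\<bar>Im z - Im a5\<bar> \<le> \<eta> / 2" if "z \<in> path_image \<tau>" for z
          using tube_close(2)[OF T(6), of z "Im a5" 0] that a6 unfolding \<tau>(4) by simp
        show "Im (pathstart \<sigma>) < Im a5 - \<eta> / 2" "Im a5 + \<eta> / 2 < Im (pathfinish \<sigma>)"
          using movesD(2)[OF mv'(2) wk(2)] movesD(2)[OF mv'(3) wk(3)] a2(1) a3(1) a5(1) \<eta>0
          unfolding \<sigma> vs[symmetric] by linarith+
        show "Re (pathstart \<tau>) < Re a1 - \<eta> / 2" "Re a1 + \<eta> / 2 < Re (pathfinish \<tau>)"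
          using movesD(1)[OF mv'(5) wk(5)] movesD(1)[OF mv'(6) wk(6)] a1(1) a4(1) a5(2) a6(1) \<eta>0
          unfolding \<tau> vs[symmetric] by linarith+
      qed
      then have meet: "wtrace c v5 l6 \<inter> wtrace c v2 l3 \<noteq> {}" unfolding \<sigma>(4) \<tau>(4) by blast
      have st: "v3 \<in> wtrace c v3 l4" "v4 \<in> wtrace c v4 l5" "v5 \<in> wtrace c v5 l6" by (auto simp: wtrace_def)
      have en: "v3 \<in> wtrace c v2 l3" "v4 \<in> wtrace c v3 l4" "v5 \<in> wtrace c v4 l5"
        using walk_end_trace[OF wk(3)] walk_end_trace[OF wk(4)] walk_end_trace[OF wk(5)] vs by simp_all
      show False
      proof (rule circuit_winds[OF D(1,2) nD, of A])
        show "Topological_Spaces.connected (A i)" if "i \<in> {0, 1, 2, 3}" for i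
          using connected_trace[OF wk(3)] connected_trace[OF wk(4)] connected_trace[OF wk(5)] connected_trace[OF wk(6)]
          by (simp add: A_def)
        show "A i \<subseteq> D" if "i \<in> {0, 1, 2, 3}" for i using D(3) unfolding tr by (auto simp: A_def)
        show "Re z > Re \<zeta>" if "z \<in> A 0" for z
        proof -
          have "z \<in> wtrace c v2 l3" using that by (simp add: A_def)
          then have "\<bar>Re z - (Re \<zeta> + 3 * \<eta>)\<bar> \<le> \<eta> + \<eta> / 2"
            by (rule tube_close(1)[OF T(3)]) (use a1(1) a2(2) a3(2) in simp_all)
          then show ?thesis using \<eta>0 by linarith
        qed
        show "Im z > Im \<zeta>" if "z \<in> A 1" for z
        proof -
          have "z \<in> wtrace c v3 l4" using that by (simp add: A_def)
          then have "\<bar>Im z - (Im \<zeta> + 3 * \<eta>)\<bar> \<le> \<eta> + \<eta> / 2"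
            by (rule tube_close(2)[OF T(4)]) (use a3(1) a4(2) in simp_all)
          then show ?thesis using \<eta>0 by linarith
        qed
        show "Re z < Re \<zeta>" if "z \<in> A 2" for z
        proof -
          have "z \<in> wtrace c v4 l5" using that by (simp add: A_def)
          then have "\<bar>Re z - (Re \<zeta> - 3 * \<eta>)\<bar> \<le> \<eta> + \<eta> / 2"
            by (rule tube_close(1)[OF T(5)]) (use a4(1) a5(2) in simp_all)
          then show ?thesis using \<eta>0 by linarith
        qed
        show "Im z < Im \<zeta>" if "z \<in> A 3" for z
        proof -
          have "z \<in> wtrace c v5 l6" using that by (simp add: A_def)
          then have "\<bar>Im z - (Im \<zeta> - 3 * \<eta>)\<bar> \<le> \<eta> + \<eta> / 2"
            by (rule tube_close(2)[OF T(6)]) (use a5(1) a6(2) in simp_all)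
          then show ?thesis using \<eta>0 by linarith
        qed
        show "A 0 \<inter> A 1 \<noteq> {}" "A 1 \<inter> A 2 \<noteq> {}" "A 2 \<inter> A 3 \<noteq> {}" "A 3 \<inter> A 0 \<noteq> {}"
          using st en meet by (simp_all add: A_def disjoint_iff) blast+
      qed
    qed
    ultimately show "wtrace c v l \<subseteq> ball \<zeta> (22 * \<eta>) \<and>
      (\<forall>D. open D \<longrightarrow> simply_connected D \<longrightarrow> wtrace c v l \<subseteq> D \<longrightarrow> \<zeta> \<in> D)" by blast
  qed
qed

end

section \<open>Planarity: meeting traces and the length of edges\<close>

definition visited :: "(complex, 'e) pre_digraph \<Rightarrow> complex \<Rightarrow> 'e list \<Rightarrow> complex set" where
  "visited G v l = insert v (head G ` set l)"

context crossing_graph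
begin

lemma vertex_on_curve:
  assumes "e \<in> arcs G" "x \<in> path_image (c e)" "x \<in> verts G"
  shows "x = tail G e \<or> x = head G e"
proof -
  obtain t where t: "t \<in> {0..1}" "x = c e t" using assms(2) by (auto simp: path_image_def)
  have "t \<notin> {0<..<1}" using curve(4)[OF assms(1)] t(2) assms(3) by blast
  then have "t = 0 \<or> t = 1" using t(1) by auto
  then show ?thesis using curve(2,3)[OF assms(1)] t(2) by (auto simp: pathstart_def pathfinish_def)
qed

lemma curves_meet:
  assumes "e \<in> arcs G" "f \<in> arcs G" "x \<in> path_image (c e)" "x \<in> path_image (c f)"
  shows "path_image (c e) = path_image (c f) \<or> x \<in> verts G"
proof -
  have int: "x \<in> c e ` {0<..<1} \<or> x \<in> verts G" if e: "e \<in> arcs G" "x \<in> path_image (c e)" for e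
  proof -
    obtain t where t: "t \<in> {0..1}" "x = c e t" using e(2) by (auto simp: path_image_def)
    show ?thesis
    proof (cases "t \<in> {0<..<1}")
      case False
      then have "t = 0 \<or> t = 1" using t(1) by auto
      then show ?thesis using curve(2,3)[OF e(1)] t(2) head_verts[OF e(1)] tail_verts[OF e(1)]
        by (auto simp: pathstart_def pathfinish_def)
    qed (use t in auto)
  qed
  show ?thesis
  proof (cases "e = f")
    case False
    then have "c e ` {0<..<1} \<inter> c f ` {0<..<1} = {} \<or> path_image (c e) = path_image (c f)"
      using embedding assms(1,2) unfolding good_embedding_def by blast
    then show ?thesis using int[OF assms(1,3)] int[OF assms(2,4)] by blast
  qed simp
qed

lemma walk_arcs: "walk G v l \<Longrightarrow> set l \<subseteq> arcs G"
  by (induction l arbitrary: v) auto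

lemma walk_tails: "walk G v l \<Longrightarrow> e \<in> set l \<Longrightarrow> tail G e \<in> visited G v l"
  by (induction l arbitrary: v) (auto simp: visited_def)

lemma vertex_on_trace:
  assumes "walk G v l" "x \<in> wtrace c v l" "x \<in> verts G"
  shows "x \<in> visited G v l"
proof (cases "x = v")
  case False
  then obtain e where e: "e \<in> set l" "x \<in> path_image (c e)" using assms(2) by (auto simp: wtrace_def)
  then have "x = tail G e \<or> x = head G e" using vertex_on_curve walk_arcs[OF assms(1)] assms(3) by blast
  then show ?thesis using e(1) walk_tails[OF assms(1) e(1)] by (auto simp: visited_def)
qed (simp add: visited_def)

text \<open>Away from vertices two edges meet only if they are drawn on top of each other, and then
  they have the same endpoints. So a common point of the traces gives a common vertex.\<close>

lemma traces_meet:
  assumes "walk G v l" "walk G u k" "wtrace c v l \<inter> wtrace c u k \<noteq> {}"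
  shows "visited G v l \<inter> visited G u k \<noteq> {}"
proof -
  obtain x where x: "x \<in> wtrace c v l" "x \<in> wtrace c u k" using assms(3) by blast
  show ?thesis
  proof (cases "x \<in> verts G")
    case True
    then show ?thesis using vertex_on_trace assms x by blast
  next
    case False
    then have "x \<noteq> v" "x \<noteq> u" using walk_verts assms(1,2) by auto
    then obtain e f where ef: "e \<in> set l" "x \<in> path_image (c e)" "f \<in> set k" "x \<in> path_image (c f)"
      using x by (auto simp: wtrace_def)
    have arcs: "e \<in> arcs G" "f \<in> arcs G" using ef walk_arcs assms(1,2) by blast+
    have "path_image (c e) = path_image (c f)" using curves_meet[OF arcs ef(2,4)] False by blast
    then have "head G e \<in> wtrace c u k" using curve_ends[OF arcs(1)] ef(3) by (auto simp: wtrace_def)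
    then have "head G e \<in> visited G u k" using vertex_on_trace[OF assms(2)] head_verts[OF arcs(1)] by blast
    then show ?thesis using ef(1) by (auto simp: visited_def)
  qed
qed

text \<open>Otherwise \<open>K\<close> together with the outside of the disc would be closed,
  connected, unbounded and disjoint from the circuit. The circuit would then lie in a simply
  connected open set that misses \<open>\<zeta>\<close>.\<close>

lemma circuit_separates:
  assumes K: "closed K" "Topological_Spaces.connected K" "\<zeta> \<in> K"
    and l: "walk G v l" "wtrace c v l \<subseteq> ball \<zeta> r"
      "\<forall>D. open D \<longrightarrow> simply_connected D \<longrightarrow> wtrace c v l \<subseteq> D \<longrightarrow> \<zeta> \<in> D"
    and out: "\<not> K \<subseteq> ball \<zeta> r"
  shows "K \<inter> wtrace c v l \<noteq> {}"
proof
  assume disj: "K \<inter> wtrace c v l = {}"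
  let ?K = "K \<union> - ball \<zeta> r"
  have "closed ?K" using K(1) by auto
  moreover have "Topological_Spaces.connected (- ball \<zeta> r)"
    by (rule connected_complement_bounded_convex) auto
  then have "Topological_Spaces.connected ?K" using K(2) out by (intro connected_Un) auto
  moreover have "\<not> bounded ?K"
    by (meson bounded_Un bounded_ball bounded_subset cobounded_imp_unbounded)
  moreover have "wtrace c v l \<inter> ?K = {}" using disj l(2) by auto
  moreover have "wtrace c v l \<noteq> {}" by (simp add: wtrace_def)
  ultimately obtain D where "open D" "simply_connected D" "wtrace c v l \<subseteq> D" "D \<inter> ?K = {}"
    using unbounded_connected_avoided[of ?K "wtrace c v l"] connected_trace[OF l(1)] by metis
  then show False using l(3) K(3) by blast
qed

text \<open>
  A circuit around an interior point of an edge has to meet the edge if the edge is long. Since edges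
  do not cross, the edge is then drawn on top of an edge of the circuit.
\<close>

lemma edge_in_cball:
  assumes e: "e \<in> arcs G" and \<eta>: "\<eta> \<ge> m"
  shows "\<exists>\<zeta>. path_image (c e) \<subseteq> cball \<zeta> (22 * \<eta>)"
proof -
  have \<eta>0: "\<eta> > 0" using \<eta> m by simp
  have cont: "continuous_on {0..1} (c e)" using curve(1)[OF e] by (simp add: path_def)
  \<comment> \<open>The centre has to be an interior point of the edge, so that the arc from it to a
    far interior point contains no vertex.\<close>
  have "\<exists>s\<in>{0<..<1}. dist (c e s) (c e 0) < 10 * \<eta>"
  proof -
    obtain d where d: "d > 0" "\<And>x'. x' \<in> {0..1} \<Longrightarrow> dist x' 0 < d \<Longrightarrow> dist (c e x') (c e 0) < 10 * \<eta>"
      using cont \<eta>0 unfolding continuous_on_iff by (metis atLeastAtMost_iff mult_pos_pos order_refl zero_le_one zero_less_numeral)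
    then show ?thesis by (intro bexI[of _ "min (1/2) (d/2)"]) auto
  qed
  then obtain s where s: "0 < s" "s < 1" "dist (c e s) (c e 0) < 10 * \<eta>" by auto
  define \<zeta> where "\<zeta> = c e s"
  have v: "tail G e \<in> verts G" "tail G e \<in> ball \<zeta> (10 * \<eta>)"
    using tail_verts[OF e] s(3) curve(2)[OF e] by (auto simp: \<zeta>_def pathstart_def)
  obtain l where l: "walk G (tail G e) l" "wtrace c (tail G e) l \<subseteq> ball \<zeta> (22 * \<eta>)"
    "\<forall>D. open D \<longrightarrow> simply_connected D \<longrightarrow> wtrace c (tail G e) l \<subseteq> D \<longrightarrow> \<zeta> \<in> D"
    using reaches_witness[OF circuit[OF \<eta> v] _ v(1)] p0 by (metis (no_types, lifting) zero_less_power)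
  show ?thesis
  proof (rule exI[of _ \<zeta>], rule ccontr)
    assume neg: "\<not> path_image (c e) \<subseteq> cball \<zeta> (22 * \<eta>)"
    then obtain t0 where t0: "t0 \<in> {0..1}" "c e t0 \<notin> cball \<zeta> (22 * \<eta>)"
      unfolding path_image_def by blast
    \<comment> \<open>The far point may be an endpoint; by continuity some interior point lies
      outside the open disc as well.\<close>
    have "\<exists>t\<in>{0<..<1}. c e t \<notin> ball \<zeta> (22 * \<eta>)"
    proof (rule ccontr)
      assume "\<not> ?thesis"
      then have "c e ` {0<..<1} \<subseteq> cball \<zeta> (22 * \<eta>)" by (auto intro: less_imp_le)
      moreover have "c e ` closure {0<..<1} \<subseteq> closure (c e ` {0<..<1})"
        using cont by (intro image_closure_subset) (auto intro: closure_subset[THEN subsetD])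
      ultimately have "c e ` {0..1} \<subseteq> cball \<zeta> (22 * \<eta>)"
        by (metis (no_types, lifting) closed_cball closure_greaterThanLessThan closure_minimal order_trans zero_less_one)
      then have "c e t0 \<in> cball \<zeta> (22 * \<eta>)" using t0(1) by blast
      then show False using t0(2) by blast
    qed
    then obtain t where t: "0 < t" "t < 1" "c e t \<notin> ball \<zeta> (22 * \<eta>)" by auto
    define I where "I = {min s t..max s t}"
    have I: "I \<subseteq> {0<..<1}" "s \<in> I" "t \<in> I" using s t by (auto simp: I_def)
    have cI: "continuous_on I (c e)" 
    proof (rule continuous_on_subset[OF cont])
      show "I \<subseteq> {0..1}" using I(1) by auto
    qed
    have "c e ` I \<inter> wtrace c (tail G e) l \<noteq> {}"
    proof (rule circuit_separates[OF _ _ _ l])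
      show "closed (c e ` I)" unfolding I_def
        using cI by (intro compact_imp_closed compact_continuous_image) (auto simp: I_def)
      show "Topological_Spaces.connected (c e ` I)"
        using cI by (intro connected_continuous_image) (auto simp: I_def)
      show "\<not> c e ` I \<subseteq> ball \<zeta> (22 * \<eta>)" using t(3) I(3) by blast
      show "\<zeta> \<in> c e ` I" using I(2) by (simp add: \<zeta>_def)
    qed
    then obtain x where x: "x \<in> c e ` I" "x \<in> wtrace c (tail G e) l" by blast
    have xv: "x \<notin> verts G" using x(1) I(1) curve(4)[OF e] by blast
    then have "x \<noteq> tail G e" using v(1) by auto
    then obtain f where f: "f \<in> set l" "x \<in> path_image (c f)" using x(2) by (auto simp: wtrace_def)
    have fa: "f \<in> arcs G" using f(1) walk_arcs[OF l(1)] by blast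
    have "x \<in> path_image (c e)" using x(1) I(1) by (auto simp: path_image_def)
    then have "path_image (c e) = path_image (c f)" using curves_meet[OF e fa _ f(2)] xv by blast
    also have "\<dots> \<subseteq> ball \<zeta> (22 * \<eta>)" using f(1) l(2) by (auto simp: wtrace_def)
    finally show False using neg ball_subset_cball by blast
  qed
qed

text \<open>A bound on edges is a consequence of crossings at the smallest scale. It keeps a single
  jump from skipping the annulus between two scales.\<close>

lemma edge_length:
  assumes "e \<in> arcs G" "x \<in> path_image (c e)" "y \<in> path_image (c e)"
  shows "dist x y \<le> 44 * m"
proof -
  obtain \<zeta> where "path_image (c e) \<subseteq> cball \<zeta> (22 * m)" using edge_in_cball[OF assms(1) order_refl] by blast
  then have "dist \<zeta> x \<le> 22 * m" "dist \<zeta> y \<le> 22 * m" using assms by auto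
  then show ?thesis using dist_triangle2[of x y \<zeta>] by (simp add: dist_commute)
qed

text \<open>One move in each direction leaves an error of at most \<open>\<eta>\<close> per
  coordinate, and the final ball adds \<open>\<eta> / 4\<close>; together this is less than
  \<open>3 * \<eta>\<close>.\<close>

lemma walk_near:
  assumes v: "v \<in> verts G" and \<eta>: "\<eta> \<ge> m"
  obtains l where "walk G v l" "walk_end G v l \<in> ball y (3 * \<eta>)"
proof -
  have \<eta>0: "\<eta> > 0" using \<eta> m by simp
  obtain K1 :: nat where K1: "\<bar>Re y - Re v\<bar> / (2 * \<eta>) \<le> real K1" using real_arch_simple by blast
  obtain K2 :: nat where K2: "\<bar>Im y - Im v\<bar> / (2 * \<eta>) \<le> real K2" using real_arch_simple by blast
  obtain s1 where s1: "\<bar>s1 - (Re y - Re v)\<bar> \<le> \<eta>"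
    "\<And>u. u \<in> verts G \<Longrightarrow> u \<in> ball v (\<eta> / 4) \<Longrightarrow> reaches G w (p0 ^ K1) u (moves \<eta> v (v + of_real s1 * 1) u)"
    by (rule move_to[of 1 \<eta> "Re y - Re v" K1]) (use \<eta> \<eta>0 K1 in \<open>auto simp: pos_divide_le_eq mult_ac\<close>)
  have r1: "reaches G w (p0 ^ K1) v (moves \<eta> v (v + of_real s1 * 1) v)" using s1(2)[OF v] \<eta>0 by simp
  obtain s2 where s2: "\<bar>s2 - (Im y - Im v)\<bar> \<le> \<eta>" "reaches G w (p0 ^ (K1 + K2)) v (\<lambda>l. \<exists>l1 l2. l = l1 @ l2 \<and> 
      moves \<eta> v (v + of_real s1 * 1) v l1 \<and> moves \<eta> (v + of_real s1 * 1) (v + of_real s1 * 1 + of_real s2 * \<i>) (walk_end G v l1) l2)"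
    by (rule move_on[OF _ \<eta> v r1, of \<i> "v + of_real s1 * 1" "Im y - Im v" K2])
      (use \<eta>0 K2 in \<open>auto simp: pos_divide_le_eq mult_ac moves_def\<close>)
  obtain l where l: "walk G v l" "\<exists>l1 l2. l = l1 @ l2 \<and> 
      moves \<eta> v (v + of_real s1 * 1) v l1 \<and> moves \<eta> (v + of_real s1 * 1) (v + of_real s1 * 1 + of_real s2 * \<i>) (walk_end G v l1) l2"
    using reaches_witness[OF s2(2) _ v] p0 by (metis (no_types, lifting) zero_less_power)
  then have "walk_end G v l \<in> ball (v + of_real s1 * 1 + of_real s2 * \<i>) (\<eta> / 4)"
    by (auto simp: moves_def walk_end_append)
  moreover have "dist y (v + of_real s1 * 1 + of_real s2 * \<i>) \<le> \<eta> + \<eta>"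
    using s1(1) s2(1) cmod_le[of "y - (v + of_real s1 * 1 + of_real s2 * \<i>)"] by (auto simp: dist_norm abs_minus_commute algebra_simps)
  ultimately have "dist y (walk_end G v l) < 3 * \<eta>"
    using dist_triangle[of y "walk_end G v l" "v + of_real s1 * 1 + of_real s2 * \<i>"] \<eta>0 by simp
  then show thesis using that l(1) by simp
qed

section \<open>Optional stopping for finite walks\<close>

lemma hit_prob_False: "(\<And>l. \<not> \<Phi> l) \<Longrightarrow> hit_prob G w N v \<Phi> = 0"
proof (induction N arbitrary: v \<Phi>)
  case (Suc N)
  have "hit_prob G w N (head G e) (\<lambda>l. \<Phi> (e # l)) = 0" for e
    by (rule Suc.IH) (rule Suc.prems)
  then show ?case using Suc.prems[of "[]"] by simp
qed simp

text \<open>Optional stopping at the first vertex where \<open>g\<close> is at least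
  \<open>a\<close>: on the event the walk stays in \<open>B\<close> until then, and there
  \<open>g\<close> is harmonic.\<close>

lemma hit_prob_le_harmonic:
  assumes g: "\<And>x. x \<in> verts G \<Longrightarrow> g x \<ge> 0"
    "\<And>x. x \<in> verts G \<Longrightarrow> x \<in> B \<Longrightarrow> g x = (\<Sum>e\<in>out_arcs G x. trans_prob G w e * g (head G e))"
    and a: "a \<ge> 0" and v: "v \<in> verts G"
    and \<Phi>: "\<And>l. walk G v l \<Longrightarrow> \<Phi> l \<Longrightarrow> wtrace c v l \<subseteq> B \<and> (\<exists>x\<in>visited G v l. g x \<ge> a)"
  shows "a * hit_prob G w N v \<Phi> \<le> g v"
  using v \<Phi>
proof (induction N arbitrary: v \<Phi>)
  case (0 v \<Phi>)
  then show ?case using g(1)[of v] 0(2)[of "[]"] by (auto simp: visited_def)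
next
  case (Suc N v \<Phi>)
  show ?case
  proof (cases "g v \<ge> a")
    case True
    have "a * hit_prob G w (Suc N) v \<Phi> \<le> a * 1"
      using hit_prob_bounds[OF Suc.prems(1), of "Suc N" \<Phi>] a by (intro mult_left_mono) blast+
    then show ?thesis using True by simp
  next
    case False
    then have nil: "\<not> \<Phi> []" using Suc.prems(2)[of "[]"] Suc.prems(1) by (auto simp: visited_def)
    show ?thesis
    proof (cases "v \<in> B")
      case vB: True
      have "a * hit_prob G w (Suc N) v \<Phi> =
          (\<Sum>e\<in>out_arcs G v. trans_prob G w e * (a * hit_prob G w N (head G e) (\<lambda>l. \<Phi> (e # l))))"
        using nil by (simp add: sum_distrib_left mult.left_commute)
      also have "\<dots> \<le> (\<Sum>e\<in>out_arcs G v. trans_prob G w e * g (head G e))"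
      proof (intro sum_mono mult_left_mono)
        fix e assume e: "e \<in> out_arcs G v"
        show "a * hit_prob G w N (head G e) (\<lambda>l. \<Phi> (e # l)) \<le> g (head G e)"
        proof (rule Suc.IH)
          show "head G e \<in> verts G" using head_verts[OF out_arcsD(1)[OF e]] .
          fix l assume l: "walk G (head G e) l" "\<Phi> (e # l)"
          then have "wtrace c v (e # l) \<subseteq> B \<and> (\<exists>x\<in>visited G v (e # l). g x \<ge> a)"
            using Suc.prems(2)[of "e # l"] e by simp
          then show "wtrace c (head G e) l \<subseteq> B \<and> (\<exists>x\<in>visited G (head G e) l. g x \<ge> a)"
            using False curve_ends(2)[OF out_arcsD(1)[OF e]] by (auto simp: wtrace_def visited_def)
        qed
        show "0 \<le> trans_prob G w e" using trans_prob_pos[OF out_arcsD(1)[OF e]] by simp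
      qed
      also have "\<dots> = g v" using g(2)[OF Suc.prems(1) vB] by simp
      finally show ?thesis .
    next
      case False
      have "hit_prob G w (Suc N) v \<Phi> \<le> hit_prob G w (Suc N) v (\<lambda>_. False)"
        using Suc.prems False by (intro hit_prob_mono) (auto simp: wtrace_def)
      also have "\<dots> = 0" by (rule hit_prob_False) simp
      finally have "hit_prob G w (Suc N) v \<Phi> = 0"
        using hit_prob_bounds[OF Suc.prems(1), of "Suc N" \<Phi>] by (simp del: hit_prob.simps)
      then show ?thesis using g(1)[OF Suc.prems(1)] by (simp del: hit_prob.simps)
    qed
  qed
qed

text \<open>A walk that stays in \<open>B\<close> but not in \<open>D\<close> has used a killed
  edge, which contributes nothing to the inequality for \<open>H\<close>; all others contribute at
  most \<open>M\<close>. The set \<open>B'\<close> leaves room for the first vertex outside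
  \<open>B\<close>.\<close>

lemma hit_prob_le_killed:
  assumes H: "\<And>x. x \<in> verts G \<Longrightarrow> x \<in> D \<Longrightarrow> x \<in> B \<Longrightarrow>
      H x \<le> (\<Sum>e\<in>{e \<in> out_arcs G x. path_image (c e) \<subseteq> D}. trans_prob G w e * H (head G e))"
    and bound: "\<And>x. x \<in> verts G \<Longrightarrow> x \<in> D \<Longrightarrow> x \<in> B' \<Longrightarrow> H x \<le> M" and M: "M \<ge> 0"
    and BB: "\<And>x e. e \<in> out_arcs G x \<Longrightarrow> x \<in> B \<Longrightarrow> head G e \<in> B'"
    and v: "v \<in> verts G" "v \<in> D" "v \<in> B'"
    and \<Phi>: "\<And>l. walk G v l \<Longrightarrow> \<Phi> l \<Longrightarrow> wtrace c v l \<subseteq> B \<and> \<not> wtrace c v l \<subseteq> D"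
  shows "H v \<le> M * (1 - hit_prob G w N v \<Phi>)"
  using v \<Phi>
proof (induction N arbitrary: v \<Phi>)
  case (0 v \<Phi>)
  then show ?case using bound[of v] 0(4)[of "[]"] by (auto simp: wtrace_def)
next
  case (Suc N v \<Phi>)
  have nil: "\<not> \<Phi> []" using Suc.prems(1,2) Suc.prems(4)[of "[]"] by (auto simp: wtrace_def)
  show ?case
  proof (cases "v \<in> B")
    case True
    have hb: "0 \<le> M * (1 - hit_prob G w N (head G e) \<Psi>)" if "e \<in> out_arcs G v" for e \<Psi>
      using M hit_prob_bounds[OF head_verts[OF out_arcsD(1)[OF that]]] by simp
    have "H v \<le> (\<Sum>e\<in>{e \<in> out_arcs G v. path_image (c e) \<subseteq> D}. trans_prob G w e * H (head G e))"
      using H Suc.prems True by blast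
    also have "\<dots> \<le> (\<Sum>e\<in>{e \<in> out_arcs G v. path_image (c e) \<subseteq> D}.
        trans_prob G w e * (M * (1 - hit_prob G w N (head G e) (\<lambda>l. \<Phi> (e # l)))))"
    proof (intro sum_mono mult_left_mono)
      fix e assume "e \<in> {e \<in> out_arcs G v. path_image (c e) \<subseteq> D}"
      then have e: "e \<in> out_arcs G v" "path_image (c e) \<subseteq> D" by auto
      show "H (head G e) \<le> M * (1 - hit_prob G w N (head G e) (\<lambda>l. \<Phi> (e # l)))"
      proof (rule Suc.IH)
        show "head G e \<in> verts G" using head_verts[OF out_arcsD(1)[OF e(1)]] .
        show "head G e \<in> D" using curve_ends(2)[OF out_arcsD(1)[OF e(1)]] e(2) by blast
        show "head G e \<in> B'" using BB[OF e(1) True] .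
        fix l assume l: "walk G (head G e) l" "\<Phi> (e # l)"
        then have "wtrace c v (e # l) \<subseteq> B \<and> \<not> wtrace c v (e # l) \<subseteq> D"
          using Suc.prems(4)[of "e # l"] e by simp
        then show "wtrace c (head G e) l \<subseteq> B \<and> \<not> wtrace c (head G e) l \<subseteq> D"
          using e(2) Suc.prems(2) curve_ends(2)[OF out_arcsD(1)[OF e(1)]] by (auto simp: wtrace_def)
      qed
      show "0 \<le> trans_prob G w e" using trans_prob_pos[OF out_arcsD(1)[OF e(1)]] by simp
    qed
    also have "\<dots> \<le> (\<Sum>e\<in>out_arcs G v. trans_prob G w e * (M * (1 - hit_prob G w N (head G e) (\<lambda>l. \<Phi> (e # l)))))"
    proof (intro sum_mono2)
      show "0 \<le> trans_prob G w e * (M * (1 - hit_prob G w N (head G e) (\<lambda>l. \<Phi> (e # l))))"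
        if "e \<in> out_arcs G v - {e \<in> out_arcs G v. path_image (c e) \<subseteq> D}" for e
      proof (rule mult_nonneg_nonneg)
        have e: "e \<in> out_arcs G v" using that by blast
        show "0 \<le> trans_prob G w e" using trans_prob_pos[OF out_arcsD(1)[OF e]] by simp
        show "0 \<le> M * (1 - hit_prob G w N (head G e) (\<lambda>l. \<Phi> (e # l)))" using hb[OF e] .
      qed
    qed (use finite_out[OF Suc.prems(1)] in auto)
    also have "\<dots> = M * (\<Sum>e\<in>out_arcs G v. trans_prob G w e) -
        M * (\<Sum>e\<in>out_arcs G v. trans_prob G w e * hit_prob G w N (head G e) (\<lambda>l. \<Phi> (e # l)))"
      unfolding sum_distrib_left sum_subtractf[symmetric] by (intro sum.cong refl) (simp add: algebra_simps)
    also have "\<dots> = M * (1 - hit_prob G w (Suc N) v \<Phi>)"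
      using nil sum_trans_prob[OF Suc.prems(1)] by (simp add: algebra_simps)
    finally show ?thesis .
  next
    case False
    have "hit_prob G w (Suc N) v \<Phi> \<le> hit_prob G w (Suc N) v (\<lambda>_. False)"
      using Suc.prems False by (intro hit_prob_mono) (auto simp: wtrace_def)
    also have "\<dots> = 0" by (rule hit_prob_False) simp
    finally have "hit_prob G w (Suc N) v \<Phi> = 0"
      using hit_prob_bounds[OF Suc.prems(1), of "Suc N" \<Phi>] by (simp del: hit_prob.simps)
    then show ?thesis using bound[OF Suc.prems(1-3)] by (simp del: hit_prob.simps)
  qed
qed

section \<open>Harnack's inequality and Beurling's estimate\<close>

text \<open>
  Since \<open>g\<close> is harmonic, some walk from \<open>u\<close> leaves the disc without visiting values below \<open>g u\<close>, and the
  circuit of the walk from \<open>u\<^sub>0\<close> meets it.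
\<close>

lemma local_harnack:
  assumes \<eta>: "\<eta> \<ge> m" and u: "u \<in> verts G" "u\<^sub>0 \<in> verts G" "u\<^sub>0 \<in> ball u (10 * \<eta>)"
    and g: "\<And>x. x \<in> verts G \<Longrightarrow> g x \<ge> 0"
      "\<And>x. x \<in> verts G \<Longrightarrow> x \<in> ball u (22 * \<eta>) \<Longrightarrow> g x = (\<Sum>e\<in>out_arcs G x. trans_prob G w e * g (head G e))"
  shows "g u * p0 ^ 33 \<le> g u\<^sub>0"
proof -
  have \<eta>0: "\<eta> > 0" using \<eta> m by simp
  let ?B = "ball u (22 * \<eta>)"
  define up where "up l \<longleftrightarrow> walk G u l \<and> (\<forall>e\<in>set l. g (head G e) \<ge> g u)" for l
  \<comment> \<open>If all such walks ended in the disc, \<open>g\<close> would attain a maximum on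
    the finite set of their endpoints. Harmonicity passes the maximum on to all neighbours, so no
    walk from a maximum could leave this set, against \<open>walk_near\<close>.\<close>
  have "\<exists>k. up k \<and> walk_end G u k \<notin> ?B"
  proof (rule ccontr)
    assume "\<not> ?thesis"
    then have inB: "walk_end G u k \<in> ?B" if "up k" for k using that by blast
    define A where "A = walk_end G u ` {l. up l}"
    have AB: "A \<subseteq> verts G \<inter> ?B" using inB walk_end_verts by (auto simp: A_def up_def)
    have "finite A" using finite_subset[OF AB] locally_finite[of ?B] by blast
    moreover have "u \<in> A" using u by (auto simp: A_def up_def intro!: image_eqI[of _ _ "[]"])
    ultimately obtain x0 where x0: "x0 \<in> A" "\<And>x. x \<in> A \<Longrightarrow> g x \<le> g x0"
      using Max_in[of "g ` A"] Max_ge[of "g ` A"] by (metis (no_types, lifting) empty_iff finite_imageI image_iff image_is_empty)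
    have gu: "g u \<le> g x0" using x0(2)[OF \<open>u \<in> A\<close>] .
    have closed: "head G e \<in> A \<and> g (head G e) = g x0" if x: "x \<in> A" "g x = g x0" and e: "e \<in> out_arcs G x" for x e
    proof -
      obtain l where l: "up l" "x = walk_end G u l" using x(1) by (auto simp: A_def)
      have next_A: "head G f \<in> A" if f: "f \<in> out_arcs G x" "g (head G f) \<ge> g u" for f
      proof -
        have "up (l @ [f])" using l f head_verts[OF out_arcsD(1)[OF f(1)]] by (auto simp: up_def walk_append)
        moreover have "walk_end G u (l @ [f]) = head G f" by (simp add: walk_end_append)
        ultimately show ?thesis by (force simp: A_def)
      qed
      have le: "g (head G f) \<le> g x0" if f: "f \<in> out_arcs G x" for f
        using next_A[OF f] x0(2)[of "head G f"] gu by linarith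
      have xv: "x \<in> verts G" "x \<in> ?B" using AB x(1) by auto
      have "(\<Sum>f\<in>out_arcs G x. trans_prob G w f * (g x0 - g (head G f))) =
          g x0 * (\<Sum>f\<in>out_arcs G x. trans_prob G w f) - (\<Sum>f\<in>out_arcs G x. trans_prob G w f * g (head G f))"
        unfolding sum_distrib_left sum_subtractf[symmetric] by (intro sum.cong refl) (simp add: algebra_simps)
      also have "\<dots> = 0" using sum_trans_prob[OF xv(1)] g(2)[OF xv] x(2) by simp
      finally have s0: "(\<Sum>f\<in>out_arcs G x. trans_prob G w f * (g x0 - g (head G f))) = 0" .
      have nn: "0 \<le> trans_prob G w f * (g x0 - g (head G f))" if "f \<in> out_arcs G x" for f
        using le[OF that] trans_prob_pos[OF out_arcsD(1)[OF that]] by (intro mult_nonneg_nonneg) auto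
      have "trans_prob G w e * (g x0 - g (head G e)) = 0"
        using s0 e sum_nonneg_eq_0_iff[of "out_arcs G x" "\<lambda>f. trans_prob G w f * (g x0 - g (head G f))",
          OF finite_out[OF xv(1)] nn] by blast
      then have "g (head G e) = g x0" using trans_prob_pos[OF out_arcsD(1)[OF e]] by simp
      then show ?thesis using next_A[OF e] gu by simp
    qed
    have stay: "walk_end G x l \<in> A" if "walk G x l" "x \<in> A" "g x = g x0" for x l
      using that by (induction l arbitrary: x) (use closed in auto)
    have "x0 \<in> verts G" using AB x0(1) by blast
    \<comment> \<open>A point at distance \<open>30 * \<eta>\<close>, approached up to
      \<open>3 * \<eta>\<close>, is outside the disc of radius \<open>22 * \<eta>\<close>.\<close>
    then obtain l where l: "walk G x0 l" "walk_end G x0 l \<in> ball (u + of_real (30 * \<eta>)) (3 * \<eta>)"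
      using walk_near[OF _ \<eta>] by blast
    have "walk_end G x0 l \<in> ?B" using stay[OF l(1) x0(1)] AB by blast
    then have "dist u (u + of_real (30 * \<eta>)) < 25 * \<eta>"
      using l(2) dist_triangle[of u "u + of_real (30 * \<eta>)" "walk_end G x0 l"] by (simp add: dist_commute)
    then show False using \<eta>0 by (simp add: dist_norm)
  qed
  then obtain k where k: "up k" "walk_end G u k \<notin> ?B" by blast
  have wk: "walk G u k" using k(1) by (simp add: up_def)
  have kg: "g x \<ge> g u" if "x \<in> visited G u k" for x using that k(1) by (auto simp: visited_def up_def)
  obtain \<gamma> where \<gamma>: "path \<gamma>" "path_image \<gamma> = wtrace c u k" using trace_path[OF wk] by blast
  have "u\<^sub>0 \<in> ball u (10 * \<eta>)" by (rule u)
  from circuit[OF \<eta> u(2) this] obtain N where N: "p0 ^ 33 \<le> hit_prob G w N u\<^sub>0 (\<lambda>l. wtrace c u\<^sub>0 l \<subseteq> ball u (22 * \<eta>) \<and>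
    (\<forall>D. open D \<longrightarrow> simply_connected D \<longrightarrow> wtrace c u\<^sub>0 l \<subseteq> D \<longrightarrow> u \<in> D))" (is "_ \<le> hit_prob _ _ _ _ ?\<Phi>")
    unfolding reaches_def by blast
  have "g u * p0 ^ 33 \<le> g u * hit_prob G w N u\<^sub>0 ?\<Phi>" using N g(1)[OF u(1)] by (intro mult_left_mono) auto
  also have "\<dots> \<le> g u\<^sub>0"
  proof (rule hit_prob_le_harmonic[where B = ?B])
    fix l assume l: "walk G u\<^sub>0 l" "?\<Phi> l"
    have "wtrace c u k \<inter> wtrace c u\<^sub>0 l \<noteq> {}"
    proof (rule circuit_separates[OF _ _ _ l(1)])
      show "closed (wtrace c u k)" "Topological_Spaces.connected (wtrace c u k)"
        using \<gamma> closed_path_image connected_path_image by metis+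
      show "u \<in> wtrace c u k" by (simp add: wtrace_def)
      show "\<not> wtrace c u k \<subseteq> ?B" using walk_end_trace[OF wk] k(2) by blast
    qed (use l in blast)+
    then show "wtrace c u\<^sub>0 l \<subseteq> ?B \<and> (\<exists>x\<in>visited G u\<^sub>0 l. g x \<ge> g u)"
      using traces_meet[OF wk l(1)] kg l(2) by blast
  qed (use g u in auto)
  finally show ?thesis .
qed

text \<open>A circuit around a point outside the simply connected set \<open>D\<close> cannot stay
  in \<open>D\<close>, so the killed walk does not survive it. The radius 70 leaves room for one
  more edge, as \<open>22 * \<eta> + 44 * m\<close> is at most \<open>66 * \<eta>\<close>.\<close>

lemma beurling_step:
  assumes \<eta>: "\<eta> \<ge> m" and D: "open D" "simply_connected D" "\<zeta> \<notin> D"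
    and H: "\<And>x. x \<in> verts G \<Longrightarrow> x \<in> D \<Longrightarrow> x \<in> ball \<zeta> (22 * \<eta>) \<Longrightarrow>
      H x \<le> (\<Sum>e\<in>{e \<in> out_arcs G x. path_image (c e) \<subseteq> D}. trans_prob G w e * H (head G e))"
    and bound: "\<And>x. x \<in> verts G \<Longrightarrow> x \<in> D \<Longrightarrow> x \<in> ball \<zeta> (70 * \<eta>) \<Longrightarrow> H x \<le> M" and M: "M \<ge> 0"
    and v: "v \<in> verts G" "v \<in> D" "v \<in> ball \<zeta> (10 * \<eta>)"
  shows "H v \<le> M * (1 - p0 ^ 33)"
proof -
  have \<eta>0: "\<eta> > 0" using \<eta> m by simp
  from circuit[OF \<eta> v(1,3)] obtain N where N: "p0 ^ 33 \<le> hit_prob G w N v (\<lambda>l. wtrace c v l \<subseteq> ball \<zeta> (22 * \<eta>) \<and>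
    (\<forall>D. open D \<longrightarrow> simply_connected D \<longrightarrow> wtrace c v l \<subseteq> D \<longrightarrow> \<zeta> \<in> D))" (is "_ \<le> hit_prob _ _ _ _ ?\<Phi>")
    unfolding reaches_def by blast
  have "H v \<le> M * (1 - hit_prob G w N v ?\<Phi>)"
  proof (rule hit_prob_le_killed[where D = D and B = "ball \<zeta> (22 * \<eta>)" and B' = "ball \<zeta> (70 * \<eta>)", OF H bound M])
    fix x e assume e: "e \<in> out_arcs G x" "x \<in> ball \<zeta> (22 * \<eta>)"
    have "dist x (head G e) \<le> 44 * m"
      using edge_length[OF out_arcsD(1)[OF e(1)], of x "head G e"] curve_ends[OF out_arcsD(1)[OF e(1)]] out_arcsD(2)[OF e(1)] by auto
    then show "head G e \<in> ball \<zeta> (70 * \<eta>)"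
      using e(2) dist_triangle[of \<zeta> "head G e" x] \<eta> \<eta>0 by simp
  qed (use v D \<eta>0 in auto)
  also have "\<dots> \<le> M * (1 - p0 ^ 33)" using N M by (intro mult_left_mono) auto
  finally show ?thesis .
qed

text \<open>Scales grow by the factor 7, so that the disc of radius \<open>70 * \<eta>\<close> of
  one scale is the starting disc, of radius \<open>10 * (7 * \<eta>)\<close>, of the next.\<close>

lemma beurling:
  assumes D: "open D" "simply_connected D" "\<zeta> \<notin> D"
    and H: "\<And>x. x \<in> verts G \<Longrightarrow> x \<in> D \<Longrightarrow> x \<in> ball \<zeta> \<rho> \<Longrightarrow>
      H x \<le> (\<Sum>e\<in>{e \<in> out_arcs G x. path_image (c e) \<subseteq> D}. trans_prob G w e * H (head G e))"
    and bound: "\<And>x. x \<in> verts G \<Longrightarrow> x \<in> D \<Longrightarrow> H x \<le> 1"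
    and \<eta>: "\<eta> \<ge> m" "22 * 7 ^ n * \<eta> \<le> \<rho>"
    and v: "v \<in> verts G" "v \<in> D" "v \<in> ball \<zeta> (10 * \<eta>)"
  shows "H v \<le> (1 - p0 ^ 33) ^ n"
  using \<eta> v
proof (induction n arbitrary: \<eta> v)
  case 0
  then show ?case using bound by simp
next
  case (Suc n)
  have \<eta>0: "\<eta> > 0" using Suc.prems(1) m by simp
  have "(1::real) \<le> 7 ^ Suc n" by (rule one_le_power) simp
  then have "1 * (22 * \<eta>) \<le> 7 ^ Suc n * (22 * \<eta>)" using \<eta>0 by (intro mult_right_mono) auto
  also have "\<dots> = 22 * 7 ^ Suc n * \<eta>" by simp
  also have "\<dots> \<le> \<rho>" by (rule Suc.prems(2))
  finally have le: "22 * \<eta> \<le> \<rho>" by simp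
  have "p0 ^ 33 \<le> 1" using p0 by (intro power_le_one) auto
  then have M: "0 \<le> (1 - p0 ^ 33) ^ n" by simp
  have "H v \<le> (1 - p0 ^ 33) ^ n * (1 - p0 ^ 33)"
  proof (rule beurling_step[OF Suc.prems(1) D _ _ M Suc.prems(3-5)])
    fix x assume x: "x \<in> verts G" "x \<in> D"
    show "H x \<le> (\<Sum>e\<in>{e \<in> out_arcs G x. path_image (c e) \<subseteq> D}. trans_prob G w e * H (head G e))" if "x \<in> ball \<zeta> (22 * \<eta>)"
      using H[OF x] that le by auto
    show "H x \<le> (1 - p0 ^ 33) ^ n" if "x \<in> ball \<zeta> (70 * \<eta>)"
      using Suc.prems(1,2) \<eta>0 x that by (intro Suc.IH[of "7 * \<eta>"]) auto
  qed
  then show ?case by (simp add: mult.commute)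
qed

end

section \<open>Restricted spanning trees\<close>

text \<open>A vertex that leads to no root has an infinite orbit in a finite set, and a repetition
  closes a cycle. Conversely, a closed walk can be rotated along the orbit of its starting point,
  which therefore never reaches a root.\<close>

lemma (in walk_graph) forest_iff_acyc:
  fixes D :: "complex set" and c :: "'e \<Rightarrow> real \<Rightarrow> complex" and f :: "complex \<Rightarrow> 'e"
  defines "X \<equiv> verts G \<inter> D" and "W \<equiv> wired_graph G c D"
    and "tgt \<equiv> arc_target (head G) {e. path_image (c e) \<subseteq> D}"
  assumes fin: "finite X" and f: "\<And>x. x \<in> X \<Longrightarrow> f x \<in> out_arcs G x"
    and heads: "\<And>e. e \<in> arcs G \<Longrightarrow> path_image (c e) \<subseteq> D \<Longrightarrow> head G e \<in> D"
  shows "forest (W\<lparr>arcs := f ` X\<rparr>) \<longleftrightarrow> acyc X (\<lambda>x. tgt (f x))"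
proof -
  let ?F = "\<lambda>x. tgt (f x)" and ?H = "W\<lparr>arcs := f ` X\<rparr>"
  have sel: "verts ?H = insert None (Some ` X)" "arcs ?H = f ` X" "tail ?H e = Some (tail G e)" "head ?H e = tgt e"
    "tail W e = Some (tail G e)" "head W e = tgt e" for e
    by (auto simp: W_def wired_graph_def X_def tgt_def arc_target_def)
  have tl: "tail G (f x) = x" if "x \<in> X" for x using f[OF that] by auto
  have tX: "tgt (f x) \<in> insert None (Some ` X)" if "x \<in> X" for x
    using f[OF that] heads[of "f x"] head_verts by (auto simp: tgt_def arc_target_def X_def)
  have wf: "wf_digraph ?H"
    by unfold_locales (use tl tX in \<open>auto simp: sel\<close>)
  interpret H: wf_digraph ?H by (rule wf)
  have snoc: "H.cas u (p @ [e]) (head ?H e)" if "H.cas u p (tail ?H e)" for u p e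
    using that by (induction p arbitrary: u) auto
  show ?thesis
  proof
    assume fo: "forest ?H"
    show "acyc X ?F"
    proof (rule ccontr)
      assume "\<not> acyc X ?F"
      then obtain x where x: "x \<in> X" "\<And>r. \<not> ends X ?F (Some x) r" by (auto simp: acyc_def)
      define y where "y n = ((\<lambda>x. the (?F x)) ^^ n) x" for n
      have y: "y n \<in> X \<and> (\<forall>r. \<not> ends X ?F (Some (y n)) r)" for n
      proof (induction n)
        case 0
        then show ?case using x by (simp add: y_def)
      next
        case (Suc n)
        have S: "y (Suc n) = the (?F (y n))" by (simp add: y_def)
        have "?F (y n) \<in> Some ` X"
        proof (rule ccontr)
          assume "?F (y n) \<notin> Some ` X"
          then have "ends X ?F (Some (y n)) (?F (y n))" using Suc by (intro ends.step ends.stop) auto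
          then show False using Suc by blast
        qed
        then have "?F (y n) = Some (y (Suc n))" "y (Suc n) \<in> X" unfolding S by auto
        then show ?case using Suc ends.step[of "y n" X ?F] by metis
      qed
      have Fy: "?F (y n) = Some (y (Suc n))" for n
      proof -
        have "?F (y n) \<in> Some ` X"
          using y[of n] ends.step[of "y n" X ?F "?F (y n)"] ends.stop[of "?F (y n)" X ?F] by blast
        then show ?thesis by (auto simp: y_def)
      qed
      have "\<not> inj y" using y fin finite_subset[of "range y" X] range_inj_infinite[of y] by blast
      then obtain i j where ij: "i < j" "y i = y j" by (metis linorder_inj_onI injI linorder_neqE_nat)
      have cas: "pre_digraph.cas ?H (Some (y i)) (map (\<lambda>k. f (y k)) [i..<i + n]) (Some (y (i + n)))" for n
      proof (induction n)
        case (Suc n)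
        have "pre_digraph.cas ?H (Some (y i)) (map (\<lambda>k. f (y k)) [i..<i + n] @ [f (y (i + n))]) (Some (y (i + Suc n)))"
          using Suc Fy[of "i + n"] tl y[of "i + n"] snoc[of "Some (y i)" "map (\<lambda>k. f (y k)) [i..<i + n]" "f (y (i + n))"]
          by (simp add: sel)
        then show ?case by simp
      qed simp
      have "pre_digraph.cas ?H (Some (y i)) (map (\<lambda>k. f (y k)) [i..<j]) (Some (y i))"
        using cas[of "j - i"] ij by simp
      then have "pre_digraph.awalk ?H (Some (y i)) (map (\<lambda>k. f (y k)) [i..<j]) (Some (y i))"
        using y unfolding H.awalk_def sel by auto
      then have "H.closed_w (map (\<lambda>k. f (y k)) [i..<j])"
        unfolding H.closed_w_def using ij by auto
      then show False using H.closed_w_imp_cycle fo unfolding forest_def by blast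
    qed
  next
    assume ac: "acyc X ?F"
    have no: "\<not> (p \<noteq> [] \<and> set p \<subseteq> f ` X \<and> pre_digraph.cas ?H u p u)" if "ends X ?F u r" for u r p
      using that
    proof (induction arbitrary: p rule: ends.induct)
      case (stop t p)
      then show ?case using tl by (cases p) (auto simp: sel)
    next
      case (step x r p)
      show ?case
      proof
        assume p: "p \<noteq> [] \<and> set p \<subseteq> f ` X \<and> pre_digraph.cas ?H (Some x) p (Some x)"
        then obtain e q where eq: "p = e # q" by (cases p) auto
        then have e: "e = f x" "pre_digraph.cas ?H (tgt e) q (Some x)"
          using p tl by (auto simp: sel)
        have "pre_digraph.cas ?H (?F x) (q @ [e]) (?F x)"
          using e tl[OF step.hyps(1)] snoc[of "?F x" q e] by (simp add: sel)
        then show False using step.IH[of "q @ [e]"] p eq by auto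
      qed
    qed
    show "forest ?H"
      unfolding forest_def
    proof
      assume "\<exists>p. pre_digraph.cycle ?H p"
      then obtain p u where p: "pre_digraph.awalk ?H u p u" "p \<noteq> []" by (auto simp: H.cycle_def)
      obtain r where "ends X ?F u r" using acyc_ends[OF ac] by blast
      then show False using no p unfolding H.awalk_def sel by blast
    qed
  qed
qed


lemma sum_filter_of_bool:
  fixes h :: "'a \<Rightarrow> real"
  assumes "finite A"
  shows "(\<Sum>x\<in>{x \<in> A. P x}. h x) = (\<Sum>x\<in>A. of_bool (P x) * h x)"
  unfolding sum.inter_filter[OF assms] by (intro sum.cong refl) auto

locale tree_domain = walk_graph G w for G :: "(complex, 'e) pre_digraph" and w :: "'e \<Rightarrow> real" +
  fixes c :: "'e \<Rightarrow> real \<Rightarrow> complex" and D :: "complex set"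
  assumes D: "open D" "finite (verts G \<inter> D)"
    and curves: "\<And>e. e \<in> arcs G \<Longrightarrow> path (c e) \<and> pathstart (c e) = tail G e \<and> pathfinish (c e) = head G e"
    and exits: "\<And>x. x \<in> verts G \<inter> D \<Longrightarrow>
      exits (out_arcs G) (\<lambda>_. arc_target (head G) {e. path_image (c e) \<subseteq> D}) (verts G \<inter> D) x"
begin

abbreviation "X \<equiv> verts G \<inter> D"
abbreviation "tgt \<equiv> arc_target (head G) {e. path_image (c e) \<subseteq> D}"
abbreviation "tree_sum R \<equiv> forest_sum (trans_prob G w) R (\<lambda>_. tgt) X"

lemma ends_on_curve: "e \<in> arcs G \<Longrightarrow> tail G e \<in> path_image (c e)" "e \<in> arcs G \<Longrightarrow> head G e \<in> path_image (c e)"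
  using curves pathstart_in_path_image pathfinish_in_path_image by metis+

text \<open>The curve of an edge that starts in \<open>D\<close> is connected, so it stays in
  \<open>D\<close> or meets the frontier. Thus every out-edge of a vertex of \<open>D\<close>
  survives, either kept or redirected.\<close>

lemma wired_arcs: "arcs (wired_graph G c D) = {e \<in> arcs G. tail G e \<in> D}"
proof -
  have "path_image (c e) \<subseteq> D \<or> path_image (c e) \<inter> frontier D \<noteq> {}" if e: "e \<in> arcs G" "tail G e \<in> D" for e
  proof (rule ccontr)
    assume neg: "\<not> ?thesis"
    have "Topological_Spaces.connected (path_image (c e))" using curves[OF e(1)] connected_path_image by blast
    then have "path_image (c e) \<inter> frontier D \<noteq> {}"
      using neg ends_on_curve(1)[OF e(1)] e(2) by (intro connected_Int_frontier) auto
    then show False using neg by blast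
  qed
  then show ?thesis using ends_on_curve(1) by (auto simp: wired_graph_def)
qed

text \<open>A tree is encoded by the out-edge chosen at each vertex, which turns sums over trees
  into forest sums.\<close>

definition choices :: "(complex \<Rightarrow> 'e) set" where
  "choices = {f \<in> PiE X (out_arcs G). acyc X (\<lambda>x. tgt (f x))}"

lemma finite_choices: "finite choices"
proof (rule finite_subset)
  show "choices \<subseteq> PiE X (out_arcs G)" by (auto simp: choices_def)
  show "finite (PiE X (out_arcs G))" using D(2) finite_out by (intro finite_PiE) blast+
qed

lemma tail_choice: "f \<in> PiE X (out_arcs G) \<Longrightarrow> x \<in> X \<Longrightarrow> f x \<in> arcs G \<and> tail G (f x) = x"
  by (drule PiE_mem, assumption) simp

lemma inj_choice: "f \<in> PiE X (out_arcs G) \<Longrightarrow> inj_on f X"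
  using tail_choice by (metis inj_onI)

lemma trees_eq: "wired_spanning_trees G c D = (\<lambda>f. f ` X) ` choices"
proof -
  let ?W = "wired_graph G c D"
  have sel: "verts ?W - {None} = Some ` X" "tail ?W e = Some (tail G e)" for e
    by (auto simp: wired_graph_def)
  have mem: "T \<in> wired_spanning_trees G c D \<longleftrightarrow> T \<subseteq> {e \<in> arcs G. tail G e \<in> D} \<and> forest (?W\<lparr>arcs := T\<rparr>) \<and>
      (\<forall>x\<in>X. \<exists>!e. e \<in> T \<and> tail G e = x)" for T
    unfolding wired_spanning_trees_def Let_def wired_arcs mem_Collect_eq sel by simp
  have fo: "forest (?W\<lparr>arcs := f ` X\<rparr>) \<longleftrightarrow> acyc X (\<lambda>x. tgt (f x))" if "f \<in> PiE X (out_arcs G)" for f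
    using D(2) PiE_mem[OF that] ends_on_curve(2) by (intro forest_iff_acyc) auto
  show ?thesis
  proof (intro equalityI subsetI)
    fix T assume "T \<in> (\<lambda>f. f ` X) ` choices"
    then obtain f where f: "f \<in> PiE X (out_arcs G)" "acyc X (\<lambda>x. tgt (f x))" "T = f ` X" by (auto simp: choices_def)
    have "\<exists>!e. e \<in> T \<and> tail G e = x" if "x \<in> X" for x
      using that tail_choice[OF f(1)] unfolding f(3) by (intro ex1I[of _ "f x"]) auto
    moreover have "T \<subseteq> {e \<in> arcs G. tail G e \<in> D}"
      using tail_choice[OF f(1)] unfolding f(3) by auto
    ultimately show "T \<in> wired_spanning_trees G c D" unfolding mem using fo[OF f(1)] f(2,3) by blast
  next
    fix T assume T: "T \<in> wired_spanning_trees G c D"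
    define f where "f = restrict (\<lambda>x. THE e. e \<in> T \<and> tail G e = x) X"
    have f1: "f x \<in> T \<and> tail G (f x) = x" if "x \<in> X" for x
      using T that theI'[of "\<lambda>e. e \<in> T \<and> tail G e = x"] unfolding mem f_def by auto
    have f2: "e = f (tail G e)" "tail G e \<in> X" if "e \<in> T" for e
    proof -
      show "tail G e \<in> X" using T that tail_verts unfolding mem by auto
      then show "e = f (tail G e)" using f1[of "tail G e"] T that unfolding mem by blast
    qed
    have "f \<in> PiE X (out_arcs G)"
      using f1 T unfolding mem by (intro PiE_I) (auto simp: f_def)
    moreover have "T = f ` X" using f1 f2 by blast
    ultimately show "T \<in> (\<lambda>f. f ` X) ` choices"
      using fo T unfolding choices_def mem by blast
  qed
qed

lemma inj_trees: "inj_on (\<lambda>f. f ` X) choices"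
proof (rule inj_onI)
  fix f g assume fg: "f \<in> choices" "g \<in> choices" "f ` X = g ` X"
  then have P: "f \<in> PiE X (out_arcs G)" "g \<in> PiE X (out_arcs G)" by (auto simp: choices_def)
  show "f = g"
  proof (rule PiE_ext[OF P])
    fix x assume x: "x \<in> X"
    then obtain y where "y \<in> X" "f x = g y" using fg(3) by blast
    then show "f x = g x" using tail_choice[OF P(1) x] tail_choice[OF P(2)] by metis
  qed
qed

lemma weight_tree: "f \<in> choices \<Longrightarrow> (\<Prod>e\<in>f ` X. trans_prob G w e) = (\<Prod>x\<in>X. trans_prob G w (f x))"
  using inj_choice by (subst prod.reindex) (auto simp: choices_def)

lemma sum_choices: "(\<Sum>f\<in>choices. \<Prod>x\<in>X. trans_prob G w (f x)) = tree_sum (out_arcs G)"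
  unfolding forest_sum_def choices_def using D(2) finite_out
  by (intro sum_filter_of_bool finite_PiE) blast+

lemma tree_sum_pos: "tree_sum (out_arcs G) > 0"
  using D(2) finite_out trans_prob_pos exits by (intro forest_sum_pos) auto

lemma sum_trees: "(\<Sum>T\<in>wired_spanning_trees G c D. \<Prod>e\<in>T. trans_prob G w e) = tree_sum (out_arcs G)"
  unfolding trees_eq sum.reindex[OF inj_trees] sum_choices[symmetric]
  by (intro sum.cong refl) (simp add: weight_tree)

lemma pmf_wired_ust: "pmf (wired_ust G w c D) T =
    (if T \<in> wired_spanning_trees G c D then (\<Prod>e\<in>T. trans_prob G w e) / tree_sum (out_arcs G) else 0)"
proof -
  have "0 \<le> (\<Prod>e\<in>T. trans_prob G w e)" if "T \<in> wired_spanning_trees G c D" for T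
  proof -
    have "T \<subseteq> arcs G" using that tail_choice unfolding trees_eq choices_def by auto
    then show ?thesis using trans_prob_pos by (intro prod_nonneg) (auto intro: less_imp_le)
  qed
  moreover have "finite (wired_spanning_trees G c D)" using finite_choices by (simp add: trees_eq)
  ultimately show ?thesis
    unfolding wired_ust_def using tree_sum_pos by (subst pmf_weighted_pmf) (auto simp: sum_trees)
qed

text \<open>That a tree restricts to \<open>S\<close> is a condition on the out-edge of each vertex
  of \<open>U\<close> separately. Because of this product form the mass of a restricted
  configuration is again a forest sum, with fewer out-edges in \<open>U\<close> and the same ones
  elsewhere.\<close>

definition forced :: "complex set \<Rightarrow> 'e set \<Rightarrow> complex \<Rightarrow> 'e set" where
  "forced U S x = (if x \<in> verts G \<inter> U then
     (if \<exists>e\<in>S. tail G e = x then {e \<in> S. tail G e = x} else {e \<in> out_arcs G x. \<not> path_image (c e) \<subseteq> U})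
     else out_arcs G x)"

text \<open>The condition does not mention the domain, so a set that is no possible restriction has
  mass 0 for all domains at once.\<close>

definition admissible :: "complex set \<Rightarrow> 'e set \<Rightarrow> bool" where
  "admissible U S \<longleftrightarrow> S \<subseteq> {e \<in> arcs G. path_image (c e) \<subseteq> U} \<and> inj_on (tail G) S"

lemma forced_subset: "admissible U S \<Longrightarrow> forced U S x \<subseteq> out_arcs G x"
  by (auto simp: forced_def admissible_def)

lemma pmf_restricted_ust:
  assumes U: "U \<subseteq> D"
  shows "pmf (restricted_ust G w c D U) S =
    (if admissible U S then tree_sum (forced U S) / tree_sum (out_arcs G) else 0)"
proof -
  let ?r = "\<lambda>T. {e \<in> T. path_image (c e) \<subseteq> U}"
  define Ch where "Ch = {f \<in> choices. ?r (f ` X) = S}"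
  have fin: "finite (wired_spanning_trees G c D)" using finite_choices by (simp add: trees_eq)
  have supp: "set_pmf (wired_ust G w c D) \<subseteq> wired_spanning_trees G c D"
    by (auto simp: set_pmf_eq pmf_wired_ust split: if_splits)
  have "pmf (restricted_ust G w c D U) S = measure (measure_pmf (wired_ust G w c D)) (?r -` {S})"
    unfolding restricted_ust_def by (rule pmf_map)
  also have "\<dots> = measure (measure_pmf (wired_ust G w c D)) ((\<lambda>f. f ` X) ` Ch)"
    using supp unfolding trees_eq Ch_def
    by (intro measure_prob_cong_0) (auto simp: set_pmf_eq)
  also have "\<dots> = (\<Sum>T\<in>(\<lambda>f. f ` X) ` Ch. pmf (wired_ust G w c D) T)"
    using finite_choices by (intro measure_measure_pmf_finite) (auto simp: Ch_def)
  also have "\<dots> = (\<Sum>f\<in>Ch. pmf (wired_ust G w c D) (f ` X))"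
    using inj_on_subset[OF inj_trees, of Ch] by (subst sum.reindex) (auto simp: Ch_def)
  also have "\<dots> = (\<Sum>f\<in>Ch. (\<Prod>x\<in>X. trans_prob G w (f x)) / tree_sum (out_arcs G))"
    by (intro sum.cong refl) (auto simp: pmf_wired_ust trees_eq Ch_def weight_tree)
  finally have eq: "pmf (restricted_ust G w c D U) S = (\<Sum>f\<in>Ch. \<Prod>x\<in>X. trans_prob G w (f x)) / tree_sum (out_arcs G)"
    by (simp add: sum_divide_distrib)
  show ?thesis
  proof (cases "admissible U S")
    case False
    have "Ch = {}"
    proof (rule ccontr)
      assume "Ch \<noteq> {}"
      then obtain f where f: "f \<in> PiE X (out_arcs G)" "?r (f ` X) = S" by (auto simp: Ch_def choices_def)
      have "S \<subseteq> {e \<in> arcs G. path_image (c e) \<subseteq> U}" using tail_choice[OF f(1)] f(2) by auto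
      moreover have "S \<subseteq> f ` X" using f(2) by blast
      moreover have "inj_on (tail G) (f ` X)" using tail_choice[OF f(1)] by (auto simp: inj_on_def)
      ultimately show False using False inj_on_subset unfolding admissible_def by blast
    qed
    then show ?thesis using eq False by simp
  next
    case True
    have ad: "\<And>e. e \<in> S \<Longrightarrow> e \<in> arcs G \<and> path_image (c e) \<subseteq> U" "inj_on (tail G) S"
      using True by (auto simp: admissible_def)
    have sub: "PiE X (forced U S) \<subseteq> PiE X (out_arcs G)" using forced_subset[OF True] by (intro PiE_mono)
    have "Ch = {f \<in> PiE X (forced U S). acyc X (\<lambda>x. tgt (f x))}"
    proof (intro equalityI subsetI)
      fix f assume "f \<in> Ch"
      then have f: "f \<in> PiE X (out_arcs G)" "acyc X (\<lambda>x. tgt (f x))" "?r (f ` X) = S" by (auto simp: Ch_def choices_def)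
      have "f x \<in> forced U S x" if x: "x \<in> X" for x
      proof (cases "x \<in> U")
        case xU: True
        show ?thesis
        proof (cases "\<exists>e\<in>S. tail G e = x")
          case True
          then obtain e where e: "e \<in> S" "tail G e = x" by blast
          then obtain y where "y \<in> X" "e = f y" using f(3) by blast
          then have "f x \<in> S" using e tail_choice[OF f(1)] by metis
          then show ?thesis using xU x True tail_choice[OF f(1) x] by (auto simp: forced_def)
        next
          case False
          have "\<not> path_image (c (f x)) \<subseteq> U" using False f(3) x tail_choice[OF f(1) x] by blast
          then show ?thesis using xU x False PiE_mem[OF f(1) x] by (auto simp: forced_def)
        qed
      next
        case False
        then show ?thesis using PiE_mem[OF f(1) x] by (simp add: forced_def)
      qed
      then show "f \<in> {f \<in> PiE X (forced U S). acyc X (\<lambda>x. tgt (f x))}"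
        using f(1,2) by (auto simp: PiE_iff)
    next
      fix f assume "f \<in> {f \<in> PiE X (forced U S). acyc X (\<lambda>x. tgt (f x))}"
      then have f: "f \<in> PiE X (forced U S)" "acyc X (\<lambda>x. tgt (f x))" "f \<in> PiE X (out_arcs G)" using sub by auto
      have "?r (f ` X) = S"
      proof (intro equalityI subsetI)
        fix e assume "e \<in> ?r (f ` X)"
        then obtain x where x: "x \<in> X" "e = f x" "path_image (c e) \<subseteq> U" by auto
        have "x \<in> U" using x(2,3) tail_choice[OF f(3) x(1)] ends_on_curve(1)[of e] by auto
        then show "e \<in> S" using PiE_mem[OF f(1) x(1)] x by (auto simp: forced_def split: if_splits)
      next
        fix e assume e: "e \<in> S"
        have t: "tail G e \<in> verts G \<inter> U" using ad(1)[OF e] ends_on_curve(1)[of e] tail_verts by auto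
        then have tX: "tail G e \<in> X" using U by auto
        have "f (tail G e) \<in> {e' \<in> S. tail G e' = tail G e}"
          using PiE_mem[OF f(1) tX] t e by (auto simp: forced_def split: if_splits)
        then have "f (tail G e) = e" using ad(2) e by (auto dest: inj_onD)
        then show "e \<in> ?r (f ` X)" using tX ad(1)[OF e] by (metis (mono_tags, lifting) image_eqI mem_Collect_eq)
      qed
      then show "f \<in> Ch" using f by (auto simp: Ch_def choices_def)
    qed
    moreover have "finite (PiE X (forced U S))"
      using D(2) finite_out finite_subset[OF forced_subset[OF True]] by (intro finite_PiE) auto
    ultimately have "(\<Sum>f\<in>Ch. \<Prod>x\<in>X. trans_prob G w (f x)) = tree_sum (forced U S)"
      unfolding forest_sum_def by (simp add: sum_filter_of_bool)
    then show ?thesis using eq True by simp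
  qed
qed

end

section \<open>Comparison of the restricted laws\<close>

lemma pmf_le_imp_prob_le:
  assumes "\<And>x. x \<in> A \<Longrightarrow> pmf p x \<le> k * pmf q x" "k \<ge> 0"
  shows "measure_pmf.prob p A \<le> k * measure_pmf.prob q A"
proof -
  have "ennreal (measure_pmf.prob p A) = (\<integral>\<^sup>+ x. ennreal (pmf p x) \<partial>count_space A)"
    by (simp add: nn_integral_pmf measure_pmf.emeasure_eq_measure)
  also have "\<dots> \<le> (\<integral>\<^sup>+ x. ennreal k * ennreal (pmf q x) \<partial>count_space A)"
    using assms by (intro nn_integral_mono) (auto simp: ennreal_mult[symmetric] intro!: ennreal_leI)
  also have "\<dots> = ennreal (k * measure_pmf.prob q A)"
    using assms(2) by (simp add: nn_integral_cmult nn_integral_pmf measure_pmf.emeasure_eq_measure ennreal_mult)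
  finally show ?thesis using assms(2) by (simp add: ennreal_le_iff)
qed

text \<open>Both laws are within \<open>t\<close> of \<open>d\<close> on every event, hence close to
  each other. Where their ratio is off by \<open>\<epsilon>\<close>, they differ by a proportion of
  order \<open>\<epsilon>\<close> of the mass, so such points carry little mass under either
  law.\<close>

lemma common_minorant_ratio:
  assumes \<epsilon>: "\<epsilon> > 0" and t: "0 \<le> t" "t \<le> 1 / 2" "2 * t * (2 + \<epsilon>) \<le> \<epsilon>\<^sup>2"
    and p: "\<And>x. (1 - t) * pmf p x \<le> pmf d x" and q: "\<And>x. (1 - t) * pmf q x \<le> pmf d x"
  defines "E \<equiv> {x. ereal (1 - \<epsilon>) \<le> pmf_ratio p q x \<and> pmf_ratio p q x \<le> ereal (1 + \<epsilon>)}"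
  shows "measure_pmf.prob p E \<ge> 1 - \<epsilon>" "measure_pmf.prob q E \<ge> 1 - \<epsilon>"
proof -
  define A where "A = {x. pmf p x > (1 + \<epsilon>) * pmf q x}"
  define B where "B = {x. pmf p x < (1 - \<epsilon>) * pmf q x}"
  let ?P = "measure_pmf.prob p" and ?Q = "measure_pmf.prob q" and ?D = "measure_pmf.prob d"
  have scaled: "(1 - t) * ?P S \<le> ?D S" "(1 - t) * ?Q S \<le> ?D S" for S
    using pmf_le_imp_prob_le[of S p "1 / (1 - t)" d] pmf_le_imp_prob_le[of S q "1 / (1 - t)" d] p q t
    by (auto simp: field_simps)
  have compl: "?P (- S) = 1 - ?P S" "?Q (- S) = 1 - ?Q S" "?D (- S) = 1 - ?D S" for S
    by (auto simp: measure_pmf.prob_compl[of S, simplified] Compl_eq_Diff_UNIV)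
  \<comment> \<open>The lower bounds for the complement give upper bounds, since all three laws have
    total mass 1.\<close>
  have upper: "?D S \<le> t + (1 - t) * ?P S" "?D S \<le> t + (1 - t) * ?Q S" for S
    using scaled[of "- S"] unfolding compl by (auto simp: algebra_simps)
  have A1: "(1 + \<epsilon>) * ?Q A \<le> ?P A"
    using pmf_le_imp_prob_le[of A q "1 / (1 + \<epsilon>)" p] \<epsilon> by (auto simp: A_def field_simps)
  have B1: "?P B \<le> (1 - \<epsilon>) * ?Q B" if "\<epsilon> \<le> 1"
    using pmf_le_imp_prob_le[of B p "1 - \<epsilon>" q] that by (auto simp: B_def)
  \<comment> \<open>For \<open>\<epsilon> > 1\<close> the lower bound on the ratio is negative and
    cannot fail.\<close>
  have B0: "B = {}" if "\<epsilon> > 1"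
  proof -
    have "(1 - \<epsilon>) * pmf q x \<le> 0" for x using that by (intro mult_nonpos_nonneg) auto
    then show ?thesis by (auto simp: B_def not_less intro: order_trans[OF _ pmf_nonneg])
  qed
  have "(1 - t) * ?P A \<le> t + (1 - t) * ?Q A" using scaled(1)[of A] upper(2)[of A] by linarith
  then have "(1 - t) * ((1 + \<epsilon>) * ?P A) \<le> (1 + \<epsilon>) * t + (1 - t) * ((1 + \<epsilon>) * ?Q A)"
    using mult_left_mono[of "(1 - t) * ?P A" "t + (1 - t) * ?Q A" "1 + \<epsilon>"] \<epsilon> by (simp add: algebra_simps)
  also have "\<dots> \<le> (1 + \<epsilon>) * t + (1 - t) * ?P A" using A1 t by (intro add_left_mono mult_left_mono) auto
  finally have PA: "(1 - t) * (\<epsilon> * ?P A) \<le> (1 + \<epsilon>) * t" by (simp add: algebra_simps)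
  have QA: "?Q A \<le> ?P A"
  proof -
    have "1 * ?Q A \<le> (1 + \<epsilon>) * ?Q A" using \<epsilon> by (intro mult_right_mono) auto
    then show ?thesis using A1 by simp
  qed
  have QB: "(1 - t) * (\<epsilon> * ?Q B) \<le> t \<and> ?P B \<le> ?Q B"
  proof (cases "\<epsilon> > 1")
    case True
    then show ?thesis using B0 t by simp
  next
    case False
    have "(1 - t) * ?Q B \<le> t + (1 - t) * ?P B" using scaled(2)[of B] upper(1)[of B] by linarith
    also have "\<dots> \<le> t + (1 - t) * ((1 - \<epsilon>) * ?Q B)" using B1 False t by (intro add_left_mono mult_left_mono) auto
    finally have "(1 - t) * (\<epsilon> * ?Q B) \<le> t" by (simp add: algebra_simps)
    moreover have "(1 - \<epsilon>) * ?Q B \<le> 1 * ?Q B" using \<epsilon> by (intro mult_right_mono) auto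
    ultimately show ?thesis using B1 False by auto
  qed
  have half: "\<epsilon> * x / 2 \<le> (1 - t) * (\<epsilon> * x)" if "x \<ge> 0" for x
  proof -
    have "1 / 2 * (\<epsilon> * x) \<le> (1 - t) * (\<epsilon> * x)" using t \<epsilon> that by (intro mult_right_mono) auto
    then show ?thesis by simp
  qed
  have "\<epsilon> * (?P A + ?Q B) / 2 \<le> t * (2 + \<epsilon>)"
    using half[of "?P A"] half[of "?Q B"] PA QB by (simp add: algebra_simps)
  then have "\<epsilon> * (?P A + ?Q B) \<le> \<epsilon> * \<epsilon>" using t(3) by (simp add: power2_eq_square)
  then have sum: "?P A + ?Q B \<le> \<epsilon>" using \<epsilon> by simp
  \<comment> \<open>Points where both masses vanish are left out: there the quotient is 0, possibly
    below \<open>1 - \<epsilon>\<close>, but neither law charges them.\<close>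
  have cover: "- E \<inter> {x. pmf p x \<noteq> 0 \<or> pmf q x \<noteq> 0} \<subseteq> A \<union> B"
  proof
    fix x assume x: "x \<in> - E \<inter> {x. pmf p x \<noteq> 0 \<or> pmf q x \<noteq> 0}"
    show "x \<in> A \<union> B"
    proof (cases "pmf q x = 0")
      case True
      then show ?thesis using x pmf_nonneg[of p x] by (auto simp: A_def less_le)
    next
      case False
      then have "pmf q x > 0" using pmf_nonneg[of q x] by (simp add: less_le)
      then show ?thesis using x by (auto simp: E_def A_def B_def pmf_ratio_def field_simps)
    qed
  qed
  have bound: "measure_pmf.prob r E \<ge> 1 - \<epsilon>" if "r = p \<or> r = q" for r
  proof -
    have "measure_pmf.prob r (- E) = measure_pmf.prob r (- E \<inter> set_pmf r)"
      by (simp add: measure_Int_set_pmf)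
    also have "\<dots> \<le> measure_pmf.prob r (A \<union> B)"
      using cover that by (intro measure_pmf.finite_measure_mono) (auto simp: set_pmf_iff)
    also have "\<dots> \<le> measure_pmf.prob r A + measure_pmf.prob r B"
      by (rule measure_Un_le) auto
    also have "\<dots> \<le> \<epsilon>" using sum QA QB that by auto
    finally show ?thesis using measure_pmf.prob_compl[of E r] by (simp add: Compl_eq_Diff_UNIV)
  qed
  show "?P E \<ge> 1 - \<epsilon>" "?Q E \<ge> 1 - \<epsilon>" using bound by auto
qed

section \<open>From the family of graphs to one graph at its smallest scale\<close>

lemma density_locally_finite:
  assumes "uniformly_bounded_density G" "\<delta> > 0" "bounded S"
  shows "finite (verts (G \<delta>) \<inter> S)"
proof -
  obtain B where B: "\<And>x. x \<in> S \<Longrightarrow> norm x \<le> B" using assms(3) bounded_iff by blast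
  obtain K :: nat where K: "B / \<delta> \<le> real K" using real_arch_simple by blast
  define J where "J = {- int K - 1..int K} \<times> {- int K - 1..int K}"
  let ?z = "\<lambda>(i, j). Complex (\<delta> * of_int i) (\<delta> * of_int j)"
  have "S \<subseteq> (\<Union>p\<in>J. cbox (?z p) (?z p + Complex \<delta> \<delta>))"
  proof
    fix x assume x: "x \<in> S"
    have b: "\<bar>Re x / \<delta>\<bar> \<le> real K" "\<bar>Im x / \<delta>\<bar> \<le> real K"
    proof -
      have "\<bar>Re x\<bar> \<le> B" "\<bar>Im x\<bar> \<le> B" using B[OF x] abs_Re_le_cmod[of x] abs_Im_le_cmod[of x] by linarith+
      then have "\<bar>Re x\<bar> / \<delta> \<le> B / \<delta>" "\<bar>Im x\<bar> / \<delta> \<le> B / \<delta>" using assms(2) by (intro divide_right_mono; simp)+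
      then show "\<bar>Re x / \<delta>\<bar> \<le> real K" "\<bar>Im x / \<delta>\<bar> \<le> real K" using K assms(2) by simp_all
    qed
    have fl: "\<delta> * of_int \<lfloor>y / \<delta>\<rfloor> \<le> y \<and> y \<le> \<delta> * of_int \<lfloor>y / \<delta>\<rfloor> + \<delta>" for y
    proof -
      have "of_int \<lfloor>y / \<delta>\<rfloor> \<le> y / \<delta>" "y / \<delta> \<le> of_int \<lfloor>y / \<delta>\<rfloor> + 1" by linarith+
      then have "of_int \<lfloor>y / \<delta>\<rfloor> * \<delta> \<le> y" "y \<le> (of_int \<lfloor>y / \<delta>\<rfloor> + 1) * \<delta>"
        unfolding pos_le_divide_eq[OF assms(2)] pos_divide_le_eq[OF assms(2)] .
      then show ?thesis by (simp add: algebra_simps)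
    qed
    have "(\<lfloor>Re x / \<delta>\<rfloor>, \<lfloor>Im x / \<delta>\<rfloor>) \<in> J" using b unfolding J_def abs_le_iff by (auto; linarith)
    moreover have "x \<in> cbox (?z (\<lfloor>Re x / \<delta>\<rfloor>, \<lfloor>Im x / \<delta>\<rfloor>)) (?z (\<lfloor>Re x / \<delta>\<rfloor>, \<lfloor>Im x / \<delta>\<rfloor>) + Complex \<delta> \<delta>)"
      using fl[of "Re x"] fl[of "Im x"] by (simp add: in_cbox_complex_iff)
    ultimately show "x \<in> (\<Union>p\<in>J. cbox (?z p) (?z p + Complex \<delta> \<delta>))" by blast
  qed
  then have "verts (G \<delta>) \<inter> S \<subseteq> (\<Union>p\<in>J. verts (G \<delta>) \<inter> cbox (?z p) (?z p + Complex \<delta> \<delta>))" by blast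
  moreover have "finite (\<Union>p\<in>J. verts (G \<delta>) \<inter> cbox (?z p) (?z p + Complex \<delta> \<delta>))"
    using assms(1,2) unfolding uniformly_bounded_density_def J_def by (intro finite_UN_I) auto
  ultimately show ?thesis using finite_subset by blast
qed

text \<open>The position at time \<open>t\<close> and the trace up to then are determined by the
  edges of the first \<open>jump_count\<close> jumps. From here on, holding times do not
  occur.\<close>

lemma (in walk_graph) reaches_of_crossing:
  assumes v: "v \<in> verts G" and p: "p \<ge> 0"
    and H: "measure (noise_space G w) {\<omega> \<in> space (noise_space G w). hits_before_exit G c v \<omega> B R} > p"
  shows "reaches G w p v (\<lambda>l. walk_end G v l \<in> B \<and> wtrace c v l \<subseteq> R)"
proof -
  have "\<exists>N. hit_prob G w N v (\<lambda>l. walk_end G v l \<in> B \<and> wtrace c v l \<subseteq> R) > p"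
  proof (rule hit_prob_exceeds[OF v p H])
    fix \<omega> assume "\<omega> \<in> {\<omega> \<in> space (noise_space G w). hits_before_exit G c v \<omega> B R}"
    then obtain t x where t: "x \<in> B" "random_walk G v \<omega> t = Some x" "walk_trace G c v \<omega> t \<subseteq> R"
      by (auto simp: hits_before_exit_def)
    have "walk_end G v (edges v \<omega> (jump_count G v \<omega> t)) = x"
      using t(2) by (auto simp: walk_end_edges random_walk_def split: if_splits)
    moreover have "wtrace c v (edges v \<omega> (jump_count G v \<omega> t)) = walk_trace G c v \<omega> t"
      by (auto simp: wtrace_def walk_trace_def edges_def)
    ultimately show "\<exists>n. walk_end G v (edges v \<omega> n) \<in> B \<and> wtrace c v (edges v \<omega> n) \<subseteq> R"
      using t by metis
  qed
  then show ?thesis unfolding reaches_def by (meson less_imp_le)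
qed

text \<open>The crossing hypothesis at scale \<open>\<eta>\<close> asks for
  \<open>\<delta> \<le> \<eta> * \<delta>\<^sub>1\<close>, so the smallest scale is
  \<open>\<delta> / \<delta>\<^sub>1\<close>. The constants \<open>p\<close> and
  \<open>\<delta>\<^sub>1\<close> serve all \<delta>; \<open>p\<close> is capped at 1 so that its
  powers decrease.\<close>

lemma crossing_graphs:
  fixes G :: "real \<Rightarrow> (complex, 'e) pre_digraph"
  assumes graph: "\<And>\<delta>. \<delta> > 0 \<Longrightarrow> weighted_graph (G \<delta>) (w \<delta>)"
    and embedding: "\<And>\<delta>. \<delta> > 0 \<Longrightarrow> good_embedding (G \<delta>) (c \<delta>)"
    and density: "uniformly_bounded_density G"
    and crossing: "uniform_crossing G w c"
  obtains p \<delta>\<^sub>1 where "0 < p" "p \<le> 1" "\<delta>\<^sub>1 > 0"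
    "\<And>\<delta>. \<delta> > 0 \<Longrightarrow> crossing_graph (G \<delta>) (w \<delta>) (c \<delta>) p (\<delta> / \<delta>\<^sub>1)"
proof -
  obtain p \<delta>\<^sub>1 where p: "p > 0" "\<delta>\<^sub>1 > 0" and X: "\<And>R A B z \<eta> \<delta> v. (R, A, B) \<in> crossings \<Longrightarrow> \<eta> > 0 \<Longrightarrow> 0 < \<delta> \<Longrightarrow> \<delta> \<le> \<eta> * \<delta>\<^sub>1 \<Longrightarrow>
      v \<in> verts (G \<delta>) \<inter> (\<lambda>x. z + \<eta> *\<^sub>R x) ` A \<Longrightarrow> measure (noise_space (G \<delta>) (w \<delta>))
         {\<omega> \<in> space (noise_space (G \<delta>) (w \<delta>)).
            hits_before_exit (G \<delta>) (c \<delta>) v \<omega> ((\<lambda>x. z + \<eta> *\<^sub>R x) ` B) ((\<lambda>x. z + \<eta> *\<^sub>R x) ` R)} > p"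
    using crossing unfolding uniform_crossing_def Let_def by fastforce
  have "crossing_graph (G \<delta>) (w \<delta>) (c \<delta>) (min p 1) (\<delta> / \<delta>\<^sub>1)" if \<delta>: "\<delta> > 0" for \<delta>
  proof -
    interpret walk_graph "G \<delta>" "w \<delta>" using graph[OF \<delta>] by unfold_locales
    have step: "reaches (G \<delta>) (w \<delta>) (min p 1) v (\<lambda>l. walk_end (G \<delta>) v l \<in> ball (a + of_real (2 * \<eta>) * d) (\<eta> / 4) \<and>
        wtrace (c \<delta>) v l \<subseteq> tube a (a + of_real (2 * \<eta>) * d) (\<eta> / 2))"
      if X1: "(R, ball \<alpha> (1/4), ball (\<alpha> + 2 * d) (1/4)) \<in> crossings" "R \<subseteq> tube \<alpha> (\<alpha> + 2 * d) (1/2)"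
        and \<eta>: "\<eta> \<ge> \<delta> / \<delta>\<^sub>1" and v: "v \<in> verts (G \<delta>)" "v \<in> ball a (\<eta> / 4)" for R \<alpha> d \<eta> v a
    proof -
      have \<eta>0: "\<eta> > 0" using \<eta> \<delta> p(2) divide_pos_pos[of \<delta> \<delta>\<^sub>1] by linarith
      have \<delta>\<eta>: "\<delta> \<le> \<eta> * \<delta>\<^sub>1" using \<eta> p(2) by (simp add: pos_divide_le_eq)
      \<comment> \<open>The similarity \<open>T\<close> scales by \<open>\<eta>\<close> and takes
        the centre \<open>\<alpha>\<close> of the starting ball to \<open>a\<close>.\<close>
      define z where "z = a - \<eta> *\<^sub>R \<alpha>"
      define T where "T = (\<lambda>x. z + \<eta> *\<^sub>R x)"
      have Tball: "T ` ball x (1/4) = ball (T x) (\<eta> / 4)" for x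
      proof (intro equalityI subsetI)
        fix y assume "y \<in> T ` ball x (1/4)"
        then obtain u where u: "dist x u < 1 / 4" "y = T u" by auto
        have "dist (T x) (T u) = \<eta> * dist x u"
          using \<eta>0 by (simp add: T_def dist_norm flip: scaleR_diff_right)
        then show "y \<in> ball (T x) (\<eta> / 4)" using u \<eta>0 by simp
      next
        fix y assume y: "y \<in> ball (T x) (\<eta> / 4)"
        define u where "u = (1 / \<eta>) *\<^sub>R (y - z)"
        have yu: "y = T u" using \<eta>0 by (simp add: u_def T_def)
        have "dist (T x) (T u) = \<eta> * dist x u"
          using \<eta>0 by (simp add: T_def dist_norm flip: scaleR_diff_right)
        then have "\<eta> * dist x u < \<eta> * (1 / 4)" using y yu by simp
        then have "dist x u < 1 / 4" using \<eta>0 by (simp only: mult_less_cancel_left_pos)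
        then show "y \<in> T ` ball x (1/4)" using yu by auto
      qed
      have Ta: "T \<alpha> = a" "T (\<alpha> + 2 * d) = a + of_real (2 * \<eta>) * d"
        by (auto simp: T_def z_def scaleR_conv_of_real algebra_simps)
      have TR: "T ` R \<subseteq> tube a (a + of_real (2 * \<eta>) * d) (\<eta> / 2)"
      proof (rule image_subsetI)
        fix x assume "x \<in> R"
        then have x: "x \<in> tube \<alpha> (\<alpha> + 2 * d) (1/2)" using X1(2) by blast
        have e: "Re (T x) = Re a + \<eta> * (Re x - Re \<alpha>)" "Im (T x) = Im a + \<eta> * (Im x - Im \<alpha>)"
          by (auto simp: T_def z_def algebra_simps)
        have mn: "min (Re \<alpha>) (Re \<alpha> + 2 * y) = Re \<alpha> + min 0 (2 * y)" "max (Re \<alpha>) (Re \<alpha> + 2 * y) = Re \<alpha> + max 0 (2 * y)"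
          "min (Im \<alpha>) (Im \<alpha> + 2 * y) = Im \<alpha> + min 0 (2 * y)" "max (Im \<alpha>) (Im \<alpha> + 2 * y) = Im \<alpha> + max 0 (2 * y)"
          "min (Re a) (Re a + 2 * \<eta> * y) = Re a + \<eta> * min 0 (2 * y)" "max (Re a) (Re a + 2 * \<eta> * y) = Re a + \<eta> * max 0 (2 * y)"
          "min (Im a) (Im a + 2 * \<eta> * y) = Im a + \<eta> * min 0 (2 * y)" "max (Im a) (Im a + 2 * \<eta> * y) = Im a + \<eta> * max 0 (2 * y)" for y
          using \<eta>0 by (auto simp: min_def max_def zero_le_mult_iff mult_le_0_iff)
        have "Re \<alpha> + min 0 (2 * Re d) - 1/2 \<le> Re x" "Re x \<le> Re \<alpha> + max 0 (2 * Re d) + 1/2"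
          "Im \<alpha> + min 0 (2 * Im d) - 1/2 \<le> Im x" "Im x \<le> Im \<alpha> + max 0 (2 * Im d) + 1/2"
          using x by (auto simp: tube_def mn)
        then have "\<eta> * (min 0 (2 * Re d) - 1/2) \<le> \<eta> * (Re x - Re \<alpha>)" "\<eta> * (Re x - Re \<alpha>) \<le> \<eta> * (max 0 (2 * Re d) + 1/2)"
          "\<eta> * (min 0 (2 * Im d) - 1/2) \<le> \<eta> * (Im x - Im \<alpha>)" "\<eta> * (Im x - Im \<alpha>) \<le> \<eta> * (max 0 (2 * Im d) + 1/2)"
          using \<eta>0 by (intro mult_left_mono; linarith)+
        then show "T x \<in> tube a (a + of_real (2 * \<eta>) * d) (\<eta> / 2)"
          unfolding tube_def by (simp add: e mn right_diff_distrib distrib_left)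
      qed
      have "v \<in> verts (G \<delta>) \<inter> T ` ball \<alpha> (1/4)" using v unfolding Tball Ta by blast
      then have "reaches (G \<delta>) (w \<delta>) p v (\<lambda>l. walk_end (G \<delta>) v l \<in> T ` ball (\<alpha> + 2 * d) (1/4) \<and> wtrace (c \<delta>) v l \<subseteq> T ` R)"
        using X[OF X1(1) \<eta>0 \<delta> \<delta>\<eta>, of v z] v(1) p(1) unfolding T_def[symmetric]
        by (intro reaches_of_crossing) auto
      then show ?thesis unfolding Tball Ta
        by (rule reaches_mono) (use v(1) TR in auto)
    qed
    have cr: "(cbox 0 (Complex 3 1), ball (Complex (1/2) (1/2)) (1/4), ball (Complex (1/2) (1/2) + 2 * 1) (1/4)) \<in> crossings"
      "(cbox 0 (Complex 3 1), ball (Complex (5/2) (1/2)) (1/4), ball (Complex (5/2) (1/2) + 2 * (-1)) (1/4)) \<in> crossings"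
      "(cbox 0 (Complex 1 3), ball (Complex (1/2) (1/2)) (1/4), ball (Complex (1/2) (1/2) + 2 * \<i>) (1/4)) \<in> crossings"
      "(cbox 0 (Complex 1 3), ball (Complex (1/2) (5/2)) (1/4), ball (Complex (1/2) (5/2) + 2 * (-\<i>)) (1/4)) \<in> crossings"
    proof -
      have "Complex (1/2) (1/2) + 2 * 1 = Complex (5/2) (1/2)" "Complex (5/2) (1/2) + 2 * (-1) = Complex (1/2) (1/2)"
        "Complex (1/2) (1/2) + 2 * \<i> = Complex (1/2) (5/2)" "Complex (1/2) (5/2) + 2 * (-\<i>) = Complex (1/2) (1/2)"
        by (auto simp: complex_eq_iff)
      then show "(cbox 0 (Complex 3 1), ball (Complex (1/2) (1/2)) (1/4), ball (Complex (1/2) (1/2) + 2 * 1) (1/4)) \<in> crossings"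
      "(cbox 0 (Complex 3 1), ball (Complex (5/2) (1/2)) (1/4), ball (Complex (5/2) (1/2) + 2 * (-1)) (1/4)) \<in> crossings"
      "(cbox 0 (Complex 1 3), ball (Complex (1/2) (1/2)) (1/4), ball (Complex (1/2) (1/2) + 2 * \<i>) (1/4)) \<in> crossings"
      "(cbox 0 (Complex 1 3), ball (Complex (1/2) (5/2)) (1/4), ball (Complex (1/2) (5/2) + 2 * (-\<i>)) (1/4)) \<in> crossings"
        unfolding crossings_def Let_def by auto
    qed
    have tb: "cbox 0 (Complex 3 1) \<subseteq> tube (Complex (1/2) (1/2)) (Complex (1/2) (1/2) + 2 * 1) (1/2)"
      "cbox 0 (Complex 3 1) \<subseteq> tube (Complex (5/2) (1/2)) (Complex (5/2) (1/2) + 2 * (-1)) (1/2)"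
      "cbox 0 (Complex 1 3) \<subseteq> tube (Complex (1/2) (1/2)) (Complex (1/2) (1/2) + 2 * \<i>) (1/2)"
      "cbox 0 (Complex 1 3) \<subseteq> tube (Complex (1/2) (5/2)) (Complex (1/2) (5/2) + 2 * (-\<i>)) (1/2)"
      by (auto simp: tube_def in_cbox_complex_iff)
    show ?thesis
    proof
      show "good_embedding (G \<delta>) (c \<delta>)" using embedding[OF \<delta>] .
      show "finite (verts (G \<delta>) \<inter> S)" if "bounded S" for S using density_locally_finite[OF density \<delta> that] .
      show "reaches (G \<delta>) (w \<delta>) (min p 1) v (\<lambda>l. walk_end (G \<delta>) v l \<in> ball (a + of_real (2 * \<eta>) * d) (\<eta> / 4) \<and>
        wtrace (c \<delta>) v l \<subseteq> tube a (a + of_real (2 * \<eta>) * d) (\<eta> / 2))"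
        if "d \<in> {1, -1, \<i>, -\<i>}" "\<eta> \<ge> \<delta> / \<delta>\<^sub>1" "v \<in> verts (G \<delta>)" "v \<in> ball a (\<eta> / 4)" for d a \<eta> v
      proof -
        from that(1) consider "d = 1" | "d = -1" | "d = \<i>" | "d = -\<i>" by blast
        then show ?thesis
          by cases (use step[OF cr(1) tb(1) that(2-4)] step[OF cr(2) tb(2) that(2-4)]
            step[OF cr(3) tb(3) that(2-4)] step[OF cr(4) tb(4) that(2-4)] in \<open>simp only:\<close>)+
      qed
    qed (use p \<delta> in auto)
  qed
  then show thesis using that[of "min p 1" \<delta>\<^sub>1] p by auto
qed

text \<open>Harmonicity is always asked near the whole of \<open>U\<close>, while the two places
  \<open>A\<close> and \<open>B\<close> that are compared may vary; this is what allows
  chaining.\<close>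

definition harnack_constant :: "complex set \<Rightarrow> real \<Rightarrow> (complex, 'e) pre_digraph \<Rightarrow> ('e \<Rightarrow> real) \<Rightarrow> real \<Rightarrow>
    complex set \<Rightarrow> complex set \<Rightarrow> bool" where
  "harnack_constant U r G w C A B \<longleftrightarrow> (\<forall>g. (\<forall>x\<in>verts G. g x \<ge> 0) \<longrightarrow>
     (\<forall>x\<in>verts G. (\<exists>y\<in>U. dist x y < r) \<longrightarrow> g x = (\<Sum>e\<in>out_arcs G x. trans_prob G w e * g (head G e))) \<longrightarrow>
     (\<forall>u\<in>verts G \<inter> A. \<forall>u'\<in>verts G \<inter> B. g u \<le> C * g u'))"

text \<open>\<open>C\<close> is fixed before the graph and so serves all small \<delta>.
  Comparability up to a constant independent of the graph is an equivalence relation on the points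
  of \<open>U\<close> with open classes, so connectedness leaves a single class, and compactness
  finitely many constants.\<close>

lemma harnack_chain:
  fixes U :: "complex set"
  assumes U: "Topological_Spaces.connected U" "bounded U" and \<eta>: "\<eta> > 0" and p: "0 < p"
  obtains C where "C > 0" "\<And>(G :: (complex, 'e) pre_digraph) w c m. crossing_graph G w c p m \<Longrightarrow> 3 * m \<le> \<eta> \<Longrightarrow>
    harnack_constant U (23 * \<eta>) G w C U U"
proof -
  define good where "good (G :: (complex, 'e) pre_digraph) w \<longleftrightarrow> (\<exists>c m. crossing_graph G w c p m \<and> 3 * m \<le> \<eta>)" for G w
  define R where "R x y \<longleftrightarrow> (\<exists>C>0. \<forall>(G :: (complex, 'e) pre_digraph) w. good G w \<longrightarrow>
      harnack_constant U (23 * \<eta>) G w C (ball x \<eta>) (ball y \<eta>) \<and> harnack_constant U (23 * \<eta>) G w C (ball y \<eta>) (ball x \<eta>))" for x y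
  have local: "R x y" if xy: "x \<in> U" "y \<in> U" "dist x y < \<eta>" for x y
  proof -
    have "harnack_constant U (23 * \<eta>) G w (1 / p ^ 33) (ball x \<eta>) (ball y \<eta>)"
      if G: "good G w" and xy: "x \<in> U" "dist x y < \<eta>" for G :: "(complex, 'e) pre_digraph" and w x y
    proof -
      obtain c m where cg: "crossing_graph G w c p m" and m3: "3 * m \<le> \<eta>" using G by (auto simp: good_def)
      interpret crossing_graph G w c p m by (rule cg)
      show ?thesis unfolding harnack_constant_def
      proof (intro allI impI ballI)
        fix g u u' assume g: "\<forall>x\<in>verts G. 0 \<le> g x"
          "\<forall>x\<in>verts G. (\<exists>y\<in>U. dist x y < 23 * \<eta>) \<longrightarrow> g x = (\<Sum>e\<in>out_arcs G x. trans_prob G w e * g (head G e))"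
          and u: "u \<in> verts G \<inter> ball x \<eta>" "u' \<in> verts G \<inter> ball y \<eta>"
        have "g u * p ^ 33 \<le> g u'"
        proof (rule local_harnack[of \<eta>])
          show "m \<le> \<eta>" using m3 crossing_graph.m[OF cg] by linarith
          have "dist u u' \<le> dist u x + dist x y + dist y u'"
            using dist_triangle[of u u' x] dist_triangle[of x u' y] by linarith
          then show "u' \<in> ball u (10 * \<eta>)" using u xy(2) \<eta> by (simp add: dist_commute)
          fix z assume z: "z \<in> verts G" "z \<in> ball u (22 * \<eta>)"
          \<comment> \<open>The disc of radius \<open>22 * \<eta>\<close> of the local inequality is
            centred at \<open>u\<close>, which is within \<open>\<eta>\<close> of the point
            \<open>x\<close> of \<open>U\<close>.\<close>
          have "dist z x < 23 * \<eta>" using z(2) u(1) dist_triangle[of z x u] by (simp add: dist_commute)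
          then show "g z = (\<Sum>e\<in>out_arcs G z. trans_prob G w e * g (head G e))" using g(2) z(1) xy(1) by blast
        qed (use g u in auto)
        then show "g u \<le> 1 / p ^ 33 * g u'" using p by (simp add: field_simps)
      qed
    qed
    from this[OF _ xy(1,3)] this[OF _ xy(2), of _ _ x] xy(3) show ?thesis
      unfolding R_def using p by (intro exI[of _ "1 / p ^ 33"]) (auto simp: dist_commute)
  qed
  have trans: "R x z" if xy: "R x y" and yz: "R y z" for x y z
  proof -
    obtain C1 where C1: "C1 > 0" "\<And>(G :: (complex, 'e) pre_digraph) w. good G w \<Longrightarrow>
      harnack_constant U (23 * \<eta>) G w C1 (ball x \<eta>) (ball y \<eta>) \<and> harnack_constant U (23 * \<eta>) G w C1 (ball y \<eta>) (ball x \<eta>)"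
      using xy unfolding R_def by blast
    obtain C2 where C2: "C2 > 0" "\<And>(G :: (complex, 'e) pre_digraph) w. good G w \<Longrightarrow>
      harnack_constant U (23 * \<eta>) G w C2 (ball y \<eta>) (ball z \<eta>) \<and> harnack_constant U (23 * \<eta>) G w C2 (ball z \<eta>) (ball y \<eta>)"
      using yz unfolding R_def by blast
    have mid: "harnack_constant U (23 * \<eta>) G w (D1 * D2) A B"
      if G: "good G w" and D: "harnack_constant U (23 * \<eta>) G w D1 A (ball y \<eta>)" "harnack_constant U (23 * \<eta>) G w D2 (ball y \<eta>) B" "D1 > 0"
      for G :: "(complex, 'e) pre_digraph" and w A B D1 D2
    proof -
      obtain c m where cg: "crossing_graph G w c p m" and m3: "3 * m \<le> \<eta>" using G by (auto simp: good_def)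
      interpret crossing_graph G w c p m by (rule cg)
      show ?thesis unfolding harnack_constant_def
      proof (intro allI impI ballI)
        fix g u u' assume g: "\<forall>x\<in>verts G. 0 \<le> g x"
          "\<forall>x\<in>verts G. (\<exists>y\<in>U. dist x y < 23 * \<eta>) \<longrightarrow> g x = (\<Sum>e\<in>out_arcs G x. trans_prob G w e * g (head G e))"
          and u: "u \<in> verts G \<inter> A" "u' \<in> verts G \<inter> B"
        \<comment> \<open>Transitivity passes through a vertex in the middle ball. It exists by
          \<open>walk_near\<close> at scale \<open>\<eta> / 3\<close>, which is the reason for
          \<open>3 * m \<le> \<eta>\<close>.\<close>
        obtain l where l: "walk G u l" "walk_end G u l \<in> ball y (3 * (\<eta> / 3))"
          using walk_near[of u "\<eta> / 3" y] u(1) m3 by auto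
        then have v: "walk_end G u l \<in> verts G \<inter> ball y \<eta>" using walk_end_verts by auto
        have "g u \<le> D1 * g (walk_end G u l)" using D(1) g u(1) v unfolding harnack_constant_def by blast
        also have "g (walk_end G u l) \<le> D2 * g u'" using D(2) g u(2) v unfolding harnack_constant_def by blast
        finally show "g u \<le> D1 * D2 * g u'" using D(3) by (simp add: mult.assoc)
      qed
    qed
    have mid': "harnack_constant U (23 * \<eta>) G w (C1 * C2) (ball x \<eta>) (ball z \<eta>)"
      "harnack_constant U (23 * \<eta>) G w (C1 * C2) (ball z \<eta>) (ball x \<eta>)" if "good G w" for G :: "(complex, 'e) pre_digraph" and w
      using mid[OF that, of C1 "ball x \<eta>" C2 "ball z \<eta>"] mid[OF that, of C2 "ball z \<eta>" C1 "ball x \<eta>"] C1 C2 that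
      by (auto simp: mult.commute)
    show ?thesis unfolding R_def using C1(1) C2(1) mid' by (intro exI[of _ "C1 * C2"]) auto
  qed
  have R: "R x y" if "x \<in> U" "y \<in> U" for x y
  proof (rule connected_equivalence_relation[OF U(1) that])
    show "R b a" if "R a b" for a b using that unfolding R_def by blast
    show "R a c" if "R a b" "R b c" for a b c using trans that by blast
    show "\<exists>T. openin (top_of_set U) T \<and> a \<in> T \<and> (\<forall>x\<in>T. R a x)" if "a \<in> U" for a
      using that local \<eta> by (intro exI[of _ "U \<inter> ball a \<eta>"]) (auto simp: openin_open_Int)
  qed
  have "compact (closure U)" using U(2) by (simp add: compact_closure)
  moreover have "closure U \<subseteq> (\<Union>x\<in>U. ball x \<eta>)"
  proof
    fix y assume "y \<in> closure U"
    then obtain x where "x \<in> U" "dist x y < \<eta>" using \<eta> closure_approachable[of y U] by blast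
    then show "y \<in> (\<Union>x\<in>U. ball x \<eta>)" by auto
  qed
  ultimately obtain N where N: "N \<subseteq> U" "finite N" "closure U \<subseteq> (\<Union>x\<in>N. ball x \<eta>)"
    using compactE_image[of "closure U" U "\<lambda>x. ball x \<eta>"] by auto
  have ex: "\<exists>C>0. \<forall>(G :: (complex, 'e) pre_digraph) w. good G w \<longrightarrow> harnack_constant U (23 * \<eta>) G w C (ball (fst q) \<eta>) (ball (snd q) \<eta>)"
    if "q \<in> N \<times> N" for q
  proof -
    have "fst q \<in> U" "snd q \<in> U" using that N(1) by auto
    then have "R (fst q) (snd q)" by (rule R)
    then obtain C where "C > 0" "\<And>(G :: (complex, 'e) pre_digraph) w. good G w \<Longrightarrow>
        harnack_constant U (23 * \<eta>) G w C (ball (fst q) \<eta>) (ball (snd q) \<eta>)"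
      unfolding R_def by blast
    then show ?thesis by blast
  qed
  have "\<exists>C. \<forall>q\<in>N \<times> N. C q > 0 \<and> (\<forall>(G :: (complex, 'e) pre_digraph) w. good G w \<longrightarrow> harnack_constant U (23 * \<eta>) G w (C q) (ball (fst q) \<eta>) (ball (snd q) \<eta>))"
    by (intro bchoice ballI ex)
  then obtain C where C0: "\<forall>q\<in>N \<times> N. C q > 0 \<and> (\<forall>(G :: (complex, 'e) pre_digraph) w. good G w \<longrightarrow> harnack_constant U (23 * \<eta>) G w (C q) (ball (fst q) \<eta>) (ball (snd q) \<eta>))" ..
  have C: "C q > 0" "good G w \<Longrightarrow> harnack_constant U (23 * \<eta>) G w (C q) (ball (fst q) \<eta>) (ball (snd q) \<eta>)"
    if "q \<in> N \<times> N" for q and G :: "(complex, 'e) pre_digraph" and w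
    using bspec[OF C0 that] by simp_all
  \<comment> \<open>The sum bounds every \<open>C q\<close>; the summand 1 keeps it positive if
    \<open>N\<close> is empty.\<close>
  define C' where "C' = 1 + (\<Sum>q\<in>N \<times> N. C q)"
  have sum0: "(\<Sum>q\<in>N \<times> N. C q) \<ge> 0" using C(1) by (intro sum_nonneg) (auto intro: less_imp_le)
  have C'ge: "C q \<le> C'" if "q \<in> N \<times> N" for q
    using member_le_sum[of q "N \<times> N" C] that C(1) N(2) by (force simp: C'_def intro: less_imp_le)
  show thesis
  proof (rule that[of C'])
    show "C' > 0" using sum0 by (simp add: C'_def)
    fix G :: "(complex, 'e) pre_digraph" and w c m
    assume cg: "crossing_graph G w c p m" "3 * m \<le> \<eta>"
    then have G: "good G w" by (auto simp: good_def)
    show "harnack_constant U (23 * \<eta>) G w C' U U"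
      unfolding harnack_constant_def
    proof (intro allI impI ballI)
      fix g u u' assume g: "\<forall>x\<in>verts G. 0 \<le> g x"
        "\<forall>x\<in>verts G. (\<exists>y\<in>U. dist x y < 23 * \<eta>) \<longrightarrow> g x = (\<Sum>e\<in>out_arcs G x. trans_prob G w e * g (head G e))"
        and u: "u \<in> verts G \<inter> U" "u' \<in> verts G \<inter> U"
      obtain x where x: "x \<in> N" "u \<in> ball x \<eta>" using u(1) N(3) closure_subset[of U] by blast
      obtain y where y: "y \<in> N" "u' \<in> ball y \<eta>" using u(2) N(3) closure_subset[of U] by blast
      have q: "(x, y) \<in> N \<times> N" using x y by simp
      have "harnack_constant U (23 * \<eta>) G w (C (x, y)) (ball x \<eta>) (ball y \<eta>)" using C(2)[OF q G] by simp
      then have "g u \<le> C (x, y) * g u'"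
        using g u x(2) y(2) unfolding harnack_constant_def by blast
      also have "\<dots> \<le> C' * g u'" using C'ge[OF q] g(1) u(2) by (intro mult_right_mono) auto
      finally show "g u \<le> C' * g u'" .
    qed
  qed
qed

section \<open>Comparison of a domain with a smaller one\<close>

context nested_killing
begin

text \<open>The probability of reaching \<open>U\<close> before the cemetery: with the vertices of
  \<open>U\<close> as additional roots, it is 1 minus the proportion of forests in which the vertex
  hangs below \<open>None\<close>.\<close>

lemma escape_function:
  obtains h where "\<And>x. 0 \<le> h x" "\<And>x. h x \<le> 1" "\<And>x. x \<in> U \<Longrightarrow> h x = 1"
    "\<And>x. x \<in> X - U \<Longrightarrow> h x = (\<Sum>e\<in>{e \<in> Out x. e \<in> E}. wt e * h (dst e))"
proof -
  let ?A = "X - U" and ?t = "\<lambda>_. arc_target dst E"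
  define s where "s = forest_sum wt Out ?t ?A"
  define k where "k t = 1 - forest_sum_to wt Out ?t ?A None t / s" for t
  have s: "s > 0" unfolding s_def
    using fin wt exits_mono[OF exits, of _ "X - U"] by (intro forest_sum_pos) auto
  have nn: "\<And>x e. x \<in> ?A \<Longrightarrow> e \<in> Out x \<Longrightarrow> 0 \<le> wt e" using nonneg by blast
  have kN: "k None = 0" using s by (simp add: k_def s_def forest_sum_to_outside)
  have "k (Some x) = (\<Sum>e\<in>{e \<in> Out x. e \<in> E}. wt e * k (Some (dst e)))" if x: "x \<in> ?A" for x
  proof -
    have xX: "x \<in> X" using x by blast
    have "forest_sum_to wt Out ?t ?A None (Some x) = (\<Sum>e\<in>Out x. wt e * forest_sum_to wt Out ?t ?A None (arc_target dst E e))"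
      using forest_sum_to_harmonic[of ?A x Out wt ?t None] x fin wt(2)[OF xX] by simp
    then have "k (Some x) = (\<Sum>e\<in>Out x. wt e) - (\<Sum>e\<in>Out x. wt e * forest_sum_to wt Out ?t ?A None (arc_target dst E e)) / s"
      using wt(2)[OF xX] by (simp add: k_def)
    also have "\<dots> = (\<Sum>e\<in>Out x. wt e * k (arc_target dst E e))"
      by (simp add: k_def right_diff_distrib sum_subtractf sum_divide_distrib)
    also have "\<dots> = (\<Sum>e\<in>Out x. if e \<in> E then wt e * k (Some (dst e)) else 0)"
      using kN by (intro sum.cong refl) (auto simp: arc_target_def)
    also have "\<dots> = (\<Sum>e\<in>{e \<in> Out x. e \<in> E}. wt e * k (Some (dst e)))"
      using fin(2)[OF xX] by (simp add: sum.inter_filter)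
    finally show ?thesis .
  qed
  moreover have "k (Some x) = 1" if "x \<in> U" for x
    using that by (simp add: k_def forest_sum_to_outside image_iff)
  moreover have "0 \<le> k t" "k t \<le> 1" for t
    using forest_sum_to_le[of ?A Out wt ?t None t, OF nn] forest_sum_to_nonneg[of ?A Out wt ?t None t, OF nn] s
    by (auto simp: k_def s_def)
  ultimately show thesis using that[of "\<lambda>x. k (Some x)"] by blast
qed

end

text \<open>A walk to within \<open>3 * m\<close> of the real point \<open>B + 3 * m\<close> ends
  with real part above the bound \<open>B\<close> of \<open>D\<close>, so it has left
  \<open>D\<close> on the way.\<close>

lemma (in crossing_graph) exits_bounded:
  assumes D: "bounded D" and x: "x \<in> verts G \<inter> D"
  shows "exits (out_arcs G) (\<lambda>_. arc_target (head G) {e. path_image (c e) \<subseteq> D}) (verts G \<inter> D) x"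
proof -
  obtain B where B: "\<And>x. x \<in> D \<Longrightarrow> norm x \<le> B" using D bounded_iff by blast
  obtain l where l: "walk G x l" "walk_end G x l \<in> ball (of_real (B + 3 * m)) (3 * m)"
    using walk_near[of x m] x by blast
  have "walk_end G x l \<notin> D"
  proof
    assume "walk_end G x l \<in> D"
    then have "Re (walk_end G x l) \<le> B" using B complex_Re_le_cmod[of "walk_end G x l"] by (meson order_trans)
    moreover have "\<bar>Re (of_real (B + 3 * m) - walk_end G x l)\<bar> < 3 * m"
      using l(2) abs_Re_le_cmod[of "of_real (B + 3 * m) - walk_end G x l"] by (simp add: dist_norm)
    ultimately show False by simp
  qed
  with l(1) show ?thesis using x
  proof (induction l arbitrary: x)
    case Nil
    then show ?case by simp
  next
    case (Cons e l)
    then have e: "e \<in> out_arcs G x" by simp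
    show ?case
    proof (cases "path_image (c e) \<subseteq> D")
      case True
      then have h: "head G e \<in> verts G \<inter> D" using curve_ends(2)[of e] head_verts[of e] e by auto
      then have "exits (out_arcs G) (\<lambda>_. arc_target (head G) {e. path_image (c e) \<subseteq> D}) (verts G \<inter> D) (head G e)"
        using Cons by simp
      then show ?thesis using exits.go[of e "out_arcs G" x "\<lambda>_. arc_target (head G) {e. path_image (c e) \<subseteq> D}" "head G e"] e True h
          arc_target_def[of "head G" "{e. path_image (c e) \<subseteq> D}" e] by simp
    next
      case False
      then show ?thesis using exits.out[of e "out_arcs G" x "\<lambda>_. arc_target (head G) {e. path_image (c e) \<subseteq> D}" "verts G \<inter> D"] e
          arc_target_def[of "head G" "{e. path_image (c e) \<subseteq> D}" e] by auto
    qed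
  qed
qed

context crossing_graph
begin

lemma tree_domain:
  assumes "open D" "bounded D"
  shows "tree_domain G w c D"
proof
  show "path (c e) \<and> pathstart (c e) = tail G e \<and> pathfinish (c e) = head G e" if "e \<in> arcs G" for e
    using curve[OF that] by simp
qed (use assms locally_finite exits_bounded in auto)

text \<open>Edges have length at most \<open>44 * m\<close>. So \<open>88 * m \<le> \<rho>\<close>
  keeps edges that start within \<open>\<rho> / 2\<close> of \<open>U\<close> inside
  \<open>D\<close>, while \<open>5 * m \<le> \<eta>\<close> and \<open>r \<le> \<eta>\<close> put
  the head of an edge that leaves \<open>D\<close> within \<open>44 * m + r < 10 * \<eta>\<close> of
  a point outside \<open>D'\<close>, where Beurling's estimate starts.\<close>

lemma restricted_ust_minorant:
  assumes D: "open D" "D \<subseteq> D'" and D': "open D'" "bounded D'" "simply_connected D'"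
    and \<rho>: "\<And>x. x \<in> U \<Longrightarrow> ball x \<rho> \<subseteq> D" "\<rho> > 0" "88 * m \<le> \<rho>"
    and harnack: "harnack_constant U (\<rho> / 2) G w C U U" "C \<ge> 0"
    and \<eta>: "5 * m \<le> \<eta>" "22 * 7 ^ n * \<eta> \<le> \<rho>" and r: "r \<le> \<eta>"
    and close: "\<And>y. y \<in> frontier D \<Longrightarrow> y \<in> D' \<Longrightarrow> \<exists>\<zeta>. \<zeta> \<notin> D' \<and> dist y \<zeta> \<le> r"
    and \<kappa>: "\<kappa> = (1 - p0 ^ 33) ^ n" "\<kappa> < 1"
  shows "(1 - C * \<kappa> / (1 - \<kappa>)) * pmf (restricted_ust G w c D' U) S \<le> pmf (restricted_ust G w c D U) S"
proof -
  have \<eta>0: "\<eta> > 0" using \<eta>(1) m by linarith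
  have bD: "bounded D" using D D' bounded_subset by blast
  interpret A: tree_domain G w c D by (rule tree_domain[OF D(1) bD])
  interpret B: tree_domain G w c D' by (rule tree_domain[OF D'(1,2)])
  have UD: "U \<subseteq> D" using \<rho>(1,2) by (metis centre_in_ball subset_eq)
  have \<kappa>0: "0 \<le> \<kappa>"
  proof -
    have "p0 ^ 33 \<le> 1" using p0 by (intro power_le_one) auto
    then show ?thesis by (simp add: \<kappa>(1))
  qed
  have len: "dist x y \<le> 44 * m" if "e \<in> out_arcs G x" "y \<in> path_image (c e)" for x y e
    using edge_length[OF out_arcsD(1)[OF that(1)] _ that(2), of x] curve_ends(1)[OF out_arcsD(1)[OF that(1)]] that(1) by simp
  have near: "path_image (c e) \<subseteq> D" if e: "e \<in> out_arcs G x" and x: "\<exists>y\<in>U. dist x y < \<rho> / 2" for x e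
  proof
    fix z assume z: "z \<in> path_image (c e)"
    obtain y where y: "y \<in> U" "dist x y < \<rho> / 2" using x by blast
    have "dist y z < \<rho>" using len[OF e z] y(2) \<rho>(3) dist_triangle[of y z x] by (simp add: dist_commute)
    then show "z \<in> D" using \<rho>(1)[OF y(1)] by auto
  qed
  have near_U: "path_image (c e) \<subseteq> D" if "e \<in> out_arcs G x" "x \<in> U" for x e
    using near[OF that(1)] that(2) \<rho>(2) by (metis dist_self half_gt_zero)
  have exit_edge: "\<exists>\<zeta>. \<zeta> \<notin> D' \<and> dist \<zeta> (head G e) < 10 * \<eta>"
    if e: "e \<in> out_arcs G x" "x \<in> D" "path_image (c e) \<subseteq> D'" "\<not> path_image (c e) \<subseteq> D" for x e
  proof -
    have ea: "e \<in> arcs G" "tail G e = x" using e(1) by auto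
    have "path_image (c e) \<inter> frontier D \<noteq> {}"
      using curve(1)[OF ea(1)] connected_path_image curve_ends(1)[OF ea(1)] ea(2) e(2,4)
      by (intro connected_Int_frontier) auto
    then obtain y where y: "y \<in> path_image (c e)" "y \<in> frontier D" by blast
    then obtain \<zeta> where \<zeta>: "\<zeta> \<notin> D'" "dist y \<zeta> \<le> r" using close e(3) by blast
    have "dist y (head G e) \<le> 44 * m" using edge_length[OF ea(1) y(1) curve_ends(2)[OF ea(1)]] .
    then have "dist \<zeta> (head G e) < 10 * \<eta>"
      using \<zeta>(2) r \<eta>(1) m dist_triangle[of \<zeta> "head G e" y] by (simp add: dist_commute)
    then show ?thesis using \<zeta>(1) by blast
  qed
  have far: "ball \<zeta> \<rho> \<inter> U = {}" if "\<zeta> \<notin> D'" for \<zeta>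
  proof (rule ccontr)
    assume "\<not> ?thesis"
    then obtain u where "u \<in> U" "dist \<zeta> u < \<rho>" by auto
    then have "\<zeta> \<in> D" using \<rho>(1)[of u] by (auto simp: dist_commute)
    then show False using that D(2) by blast
  qed
  have "(1::real) \<le> 7 ^ n" by (rule one_le_power) simp
  then have "1 * (22 * \<eta>) \<le> 7 ^ n * (22 * \<eta>)" using \<eta>0 by (intro mult_right_mono) auto
  then have \<eta>\<rho>: "22 * \<eta> \<le> \<rho>" using \<eta>(2) by (simp add: mult_ac)
  show ?thesis
  proof (cases "A.admissible U S")
    case adm: True
    have "(1 - C * \<kappa> / (1 - \<kappa>)) * (B.tree_sum (A.forced U S) * A.tree_sum (out_arcs G)) \<le>
      A.tree_sum (A.forced U S) * B.tree_sum (out_arcs G)"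
    \<comment> \<open>Without vertices in \<open>U\<close> there is no base point for Harnack's
      inequality, but then nothing is forced either.\<close>
    proof (cases "verts G \<inter> U = {}")
      case True
      then have "A.forced U S = out_arcs G" by (auto simp: A.forced_def)
      moreover have "C * \<kappa> / (1 - \<kappa>) \<ge> 0" using harnack(2) \<kappa>0 \<kappa>(2) by simp
      then have "(1 - C * \<kappa> / (1 - \<kappa>)) * (B.tree_sum (out_arcs G) * A.tree_sum (out_arcs G)) \<le>
          1 * (B.tree_sum (out_arcs G) * A.tree_sum (out_arcs G))"
        using A.tree_sum_pos B.tree_sum_pos by (intro mult_right_mono) auto
      ultimately show ?thesis by (simp add: mult.commute)
    next
      case False
      then obtain u\<^sub>0 where u0: "u\<^sub>0 \<in> verts G \<inter> U" by blast
      interpret N: nested_killing "trans_prob G w" "out_arcs G" "head G" "verts G \<inter> D'" "verts G \<inter> D"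
        "verts G \<inter> U" "{e. path_image (c e) \<subseteq> D'}" "{e. path_image (c e) \<subseteq> D}"
      proof
        show "finite (verts G \<inter> D')" using B.D(2) .
        show "finite (out_arcs G x)" if "x \<in> verts G \<inter> D'" for x using finite_out that by blast
        show "verts G \<inter> D \<subseteq> verts G \<inter> D'" "verts G \<inter> U \<subseteq> verts G \<inter> D" using D(2) UD by auto
        show "0 < trans_prob G w e" if "e \<in> out_arcs G x" for x e using trans_prob_pos out_arcsD(1)[OF that] .
        show "sum (trans_prob G w) (out_arcs G x) = 1" if "x \<in> verts G \<inter> D'" for x using sum_trans_prob that by blast
        show "head G e \<in> verts G \<inter> D'" if "e \<in> out_arcs G x" "e \<in> {e. path_image (c e) \<subseteq> D'}" for x e
          using that head_verts[OF out_arcsD(1)[OF that(1)]] curve_ends(2)[OF out_arcsD(1)[OF that(1)]] by blast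
        show "e \<in> {e. path_image (c e) \<subseteq> D'} \<and> head G e \<in> verts G \<inter> D"
          if "e \<in> out_arcs G x" "e \<in> {e. path_image (c e) \<subseteq> D}" for x e
          using that D(2) head_verts[OF out_arcsD(1)[OF that(1)]] curve_ends(2)[OF out_arcsD(1)[OF that(1)]] by blast
        show "out_arcs G x \<subseteq> {e. path_image (c e) \<subseteq> D}" if "x \<in> verts G \<inter> U" for x using near_U that by blast
        show "head G e \<notin> verts G \<inter> U" if x: "x \<in> verts G \<inter> D" "e \<in> out_arcs G x" "e \<in> {e. path_image (c e) \<subseteq> D'}"
          "e \<notin> {e. path_image (c e) \<subseteq> D}" for x e
        proof -
          obtain \<zeta> where "\<zeta> \<notin> D'" "dist \<zeta> (head G e) < 10 * \<eta>" using exit_edge x by blast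
          moreover have "10 * \<eta> \<le> \<rho>" using \<eta>\<rho> \<eta>0 by linarith
          ultimately have "head G e \<in> ball \<zeta> \<rho>" by simp
          then show ?thesis using far[OF \<open>\<zeta> \<notin> D'\<close>] by blast
        qed
        show "exits (out_arcs G) (\<lambda>_. arc_target (head G) {e. path_image (c e) \<subseteq> D'}) (verts G \<inter> D') x"
          if "x \<in> verts G \<inter> D'" for x using B.exits that .
      qed
      obtain h where h: "\<And>x. 0 \<le> h x" "\<And>x. h x \<le> 1" "\<And>x. x \<in> verts G \<inter> U \<Longrightarrow> h x = 1"
        "\<And>x. x \<in> verts G \<inter> D' - verts G \<inter> U \<Longrightarrow>
          h x = (\<Sum>e\<in>{e \<in> out_arcs G x. e \<in> {e. path_image (c e) \<subseteq> D'}}. trans_prob G w e * h (head G e))"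
        using N.escape_function by blast
      show ?thesis
      proof (rule N.nested_comparison[OF _ _ u0 harnack(2) \<kappa>0 \<kappa>(2)])
        show "A.forced U S x \<subseteq> out_arcs G x" for x by (rule A.forced_subset[OF adm])
        show "A.forced U S x = out_arcs G x" if "x \<notin> verts G \<inter> U" for x
          unfolding A.forced_def using that by (rule if_not_P)
        show "g u \<le> C * g u\<^sub>0" if g: "\<And>x. x \<in> verts G \<inter> D \<Longrightarrow> 0 \<le> g x"
          "\<And>x. x \<in> verts G \<inter> D \<Longrightarrow> out_arcs G x \<subseteq> {e. path_image (c e) \<subseteq> D} \<Longrightarrow>
            g x = (\<Sum>e\<in>out_arcs G x. trans_prob G w e * g (head G e))" and u: "u \<in> verts G \<inter> U" for g u
        proof -
          \<comment> \<open>Extended by 0, because \<open>harnack_constant\<close> asks for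
            nonnegativity on all vertices; near \<open>U\<close> all neighbours lie in
            \<open>D\<close>, so harmonicity is not affected there.\<close>
          define g' where "g' x = (if x \<in> D then g x else 0)" for x
          have g'h: "g' x = (\<Sum>e\<in>out_arcs G x. trans_prob G w e * g' (head G e))"
            if x: "x \<in> verts G" "\<exists>y\<in>U. dist x y < \<rho> / 2" for x
          proof -
            obtain y where y: "y \<in> U" "dist x y < \<rho> / 2" using x(2) by blast
            have "x \<in> D" using \<rho>(1)[OF y(1)] y(2) \<rho>(2) by (auto simp: dist_commute)
            moreover have "head G e \<in> D" if "e \<in> out_arcs G x" for e
              using near[OF that x(2)] curve_ends(2)[OF out_arcsD(1)[OF that]] by blast
            moreover have "out_arcs G x \<subseteq> {e. path_image (c e) \<subseteq> D}" using near x(2) by blast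
            ultimately show ?thesis using g(2)[of x] x(1) by (simp add: g'_def)
          qed
          have "\<forall>x\<in>verts G. g' x \<ge> 0" using g(1) by (simp add: g'_def)
          then have "g' u \<le> C * g' u\<^sub>0"
            using harnack(1) g'h u u0 unfolding harnack_constant_def by blast
          then show ?thesis using u u0 UD by (auto simp: g'_def split: if_splits)
        qed
        show "0 \<le> h x" for x by (rule h)
        show "h x = 1" if "x \<in> verts G \<inter> U" for x using h(3)[OF that] .
        show "h x = (\<Sum>e\<in>{e \<in> out_arcs G x. e \<in> {e. path_image (c e) \<subseteq> D'}}. trans_prob G w e * h (head G e))"
          if "x \<in> verts G \<inter> D' - verts G \<inter> U" for x using h(4)[OF that] .
        show "h (head G e) \<le> \<kappa>" if x: "x \<in> verts G \<inter> D" "e \<in> out_arcs G x" "e \<in> {e. path_image (c e) \<subseteq> D'}"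
          "e \<notin> {e. path_image (c e) \<subseteq> D}" for x e
        proof -
          obtain \<zeta> where \<zeta>: "\<zeta> \<notin> D'" "dist \<zeta> (head G e) < 10 * \<eta>" using exit_edge x by blast
          \<comment> \<open>The disc of radius \<open>\<rho>\<close> around \<open>\<zeta>\<close>
            misses \<open>U\<close>, so \<open>h\<close> satisfies the equation of the walk killed
            outside \<open>D'\<close> at all scales used.\<close>
          show ?thesis unfolding \<kappa>(1)
          proof (rule beurling[OF D'(1,3) \<zeta>(1), where \<rho> = \<rho> and \<eta> = \<eta>])
            show "m \<le> \<eta>" using \<eta>(1) m by linarith
            show "h y \<le> (\<Sum>e\<in>{e \<in> out_arcs G y. path_image (c e) \<subseteq> D'}. trans_prob G w e * h (head G e))"
              if "y \<in> verts G" "y \<in> D'" "y \<in> ball \<zeta> \<rho>" for y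
            proof -
              have "y \<notin> U" using that(3) far[OF \<zeta>(1)] by blast
              then show ?thesis using h(4)[of y] that by auto
            qed
            show "head G e \<in> verts G" "head G e \<in> D'" "head G e \<in> ball \<zeta> (10 * \<eta>)"
              using head_verts[OF out_arcsD(1)[OF x(2)]] curve_ends(2)[OF out_arcsD(1)[OF x(2)]] x(3) \<zeta>(2) by auto
          qed (use h \<eta>(2) in auto)
        qed
      qed
    qed
    note key = this
    have "B.admissible U S" using adm by (simp add: A.admissible_def B.admissible_def)
    then have pB: "pmf (restricted_ust G w c D' U) S = B.tree_sum (A.forced U S) / B.tree_sum (out_arcs G)"
      using B.pmf_restricted_ust[of U S] UD D(2) by simp
    have pA: "pmf (restricted_ust G w c D U) S = A.tree_sum (A.forced U S) / A.tree_sum (out_arcs G)"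
      using A.pmf_restricted_ust[OF UD, of S] adm by simp
    have "a * (b / q) \<le> p / s" if "a * (b * s) \<le> p * q" "q > 0" "s > 0" for a b p q s :: real
      using that by (simp add: pos_divide_le_eq pos_le_divide_eq mult_ac)
    from this[OF key B.tree_sum_pos A.tree_sum_pos] show ?thesis unfolding pA pB .
  next
    case False
    then have "\<not> B.admissible U S" by (simp add: A.admissible_def B.admissible_def)
    then show ?thesis using B.pmf_restricted_ust[of U S] UD D(2) by simp
  qed
qed

end

lemma hausdorff_distance_close:
  fixes A B :: "complex set"
  assumes "bounded A" "bounded B" "closed B" "B \<noteq> {}" "hausdorff_distance A B < r" "y \<in> A"
  shows "\<exists>z\<in>B. dist y z \<le> r"
proof -
  obtain b where b: "b \<in> B" using assms(4) by blast
  have "bdd_above ((\<lambda>a. infdist a B) ` A)"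
  proof -
    obtain M where M: "\<And>a. a \<in> A \<Longrightarrow> dist b a \<le> M" using assms(1) bounded_any_center by metis
    have "infdist a B \<le> M" if "a \<in> A" for a
      using infdist_le[OF b, of a] M[OF that] by (simp add: dist_commute)
    then show ?thesis by (auto intro!: bdd_aboveI2)
  qed
  then have "infdist y B \<le> (SUP a\<in>A. infdist a B)" using assms(6) by (intro cSUP_upper) auto
  then have "infdist y B < r" using assms(5) by (simp add: hausdorff_distance_def)
  moreover obtain z where "z \<in> B" "infdist y B = dist y z"
    using infdist_attains_inf[OF assms(3,4)] by blast
  ultimately show ?thesis by (intro bexI[of _ z]) auto
qed

lemma hausdorff_distance_commute: "hausdorff_distance A B = hausdorff_distance B A"
  by (simp add: hausdorff_distance_def max.commute)

theorem corollary5p1: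
  fixes G :: "real \<Rightarrow> (complex, 'e) pre_digraph"
    and w :: "real \<Rightarrow> 'e \<Rightarrow> real"
    and c :: "real \<Rightarrow> 'e \<Rightarrow> real \<Rightarrow> complex"
  assumes graph: "\<And>\<delta>. \<delta> > 0 \<Longrightarrow> weighted_graph (G \<delta>) (w \<delta>)"
    and embedding: "\<And>\<delta>. \<delta> > 0 \<Longrightarrow> good_embedding (G \<delta>) (c \<delta>)"
    and density: "uniformly_bounded_density G"
    and connected: "\<And>\<delta>. \<delta> > 0 \<Longrightarrow> walk_connected (G \<delta>) (w \<delta>)"
    and crossing: "uniform_crossing G w c"
  shows "\<forall>U V. \<forall>\<epsilon>>0. open U \<and> simply_connected U \<and> open V \<and> simply_connected V \<and> closure U \<subseteq> V \<longrightarrow>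
    (\<exists>r>0. \<exists>\<delta>\<^sub>0>0. \<forall>D\<^sub>1 D\<^sub>2.
       bounded_sc_domain D\<^sub>1 \<and> bounded_sc_domain D\<^sub>2 \<and> V \<subseteq> D\<^sub>1 \<inter> D\<^sub>2 \<and>
       hausdorff_distance (frontier D\<^sub>1) (frontier D\<^sub>2) < r \<longrightarrow>
       (\<forall>\<delta>. 0 < \<delta> \<and> \<delta> < \<delta>\<^sub>0 \<longrightarrow>
          (let \<nu>\<^sub>1 = restricted_ust (G \<delta>) (w \<delta>) (c \<delta>) D\<^sub>1 U;
               \<nu>\<^sub>2 = restricted_ust (G \<delta>) (w \<delta>) (c \<delta>) D\<^sub>2 U;
               E = {S. ereal (1 - \<epsilon>) \<le> pmf_ratio \<nu>\<^sub>1 \<nu>\<^sub>2 S \<and> pmf_ratio \<nu>\<^sub>1 \<nu>\<^sub>2 S \<le> ereal (1 + \<epsilon>)}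
           in measure_pmf.prob \<nu>\<^sub>1 E \<ge> 1 - \<epsilon> \<and> measure_pmf.prob \<nu>\<^sub>2 E \<ge> 1 - \<epsilon>)))"
proof (intro allI impI)
  fix U V :: "complex set" and \<epsilon> :: real
  assume \<epsilon>: "\<epsilon> > 0" and UV: "open U \<and> simply_connected U \<and> open V \<and> simply_connected V \<and> closure U \<subseteq> V"
  obtain p \<delta>\<^sub>1 where p: "0 < p" "p \<le> 1" "\<delta>\<^sub>1 > 0"
    and cg: "\<And>\<delta>. \<delta> > 0 \<Longrightarrow> crossing_graph (G \<delta>) (w \<delta>) (c \<delta>) p (\<delta> / \<delta>\<^sub>1)"
    using crossing_graphs[OF graph embedding density crossing] by blast
  show "\<exists>r>0. \<exists>\<delta>\<^sub>0>0. \<forall>D\<^sub>1 D\<^sub>2.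
       bounded_sc_domain D\<^sub>1 \<and> bounded_sc_domain D\<^sub>2 \<and> V \<subseteq> D\<^sub>1 \<inter> D\<^sub>2 \<and>
       hausdorff_distance (frontier D\<^sub>1) (frontier D\<^sub>2) < r \<longrightarrow>
       (\<forall>\<delta>. 0 < \<delta> \<and> \<delta> < \<delta>\<^sub>0 \<longrightarrow>
          (let \<nu>\<^sub>1 = restricted_ust (G \<delta>) (w \<delta>) (c \<delta>) D\<^sub>1 U;
               \<nu>\<^sub>2 = restricted_ust (G \<delta>) (w \<delta>) (c \<delta>) D\<^sub>2 U;
               E = {S. ereal (1 - \<epsilon>) \<le> pmf_ratio \<nu>\<^sub>1 \<nu>\<^sub>2 S \<and> pmf_ratio \<nu>\<^sub>1 \<nu>\<^sub>2 S \<le> ereal (1 + \<epsilon>)}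
           in measure_pmf.prob \<nu>\<^sub>1 E \<ge> 1 - \<epsilon> \<and> measure_pmf.prob \<nu>\<^sub>2 E \<ge> 1 - \<epsilon>))"
  \<comment> \<open>No bounded domain contains an unbounded \<open>V\<close>, so that case is
    vacuous.\<close>
  proof (cases "bounded V")
    case False
    then have "\<not> (V \<subseteq> D\<^sub>1 \<and> bounded_sc_domain D\<^sub>1)" for D\<^sub>1
      using bounded_subset by (auto simp: bounded_sc_domain_def)
    then show ?thesis by (intro exI[of _ 1] conjI) auto
  next
    case True
    have bU: "bounded U" using bounded_subset[OF True] UV closure_subset[of U] by (meson order_trans)
    have cU: "Topological_Spaces.connected U" using UV simply_connected_imp_connected by blast
    have "compact (closure U)" using bU by (simp add: compact_closure)
    then obtain \<rho> where \<rho>: "\<rho> > 0" "\<And>x y. x \<in> closure U \<Longrightarrow> y \<in> - V \<Longrightarrow> \<rho> \<le> dist x y"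
      using separate_compact_closed[of "closure U" "- V"] UV by (metis closed_Compl disjoint_eq_subset_Compl double_compl)
    have ballV: "ball x \<rho> \<subseteq> V" if "x \<in> U" for x
    proof
      fix y assume "y \<in> ball x \<rho>"
      then show "y \<in> V" using \<rho>(2)[of x y] that closure_subset[of U] by (cases "y \<in> V") auto
    qed
    \<comment> \<open>The Harnack chain at this scale asks for harmonicity within
      \<open>23 * \<eta>H = \<rho> / 2\<close> of \<open>U\<close>, the range in which edges stay in
      the intersection.\<close>
    define \<eta>H where "\<eta>H = \<rho> / 46"
    have \<eta>H: "\<eta>H > 0" "23 * \<eta>H = \<rho> / 2" using \<rho>(1) by (auto simp: \<eta>H_def)
    obtain C where C: "C > 0" and harnack: "\<And>(G :: (complex, 'e) pre_digraph) w c m. crossing_graph G w c p m \<Longrightarrow> 3 * m \<le> \<eta>H \<Longrightarrow>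
        harnack_constant U (\<rho> / 2) G w C U U"
      using harnack_chain[OF cU bU \<eta>H(1) p(1)] unfolding \<eta>H(2) by blast
    define t where "t = min (1 / 2) (\<epsilon>\<^sup>2 / (2 * (2 + \<epsilon>)))"
    have t: "0 < t" "t \<le> 1 / 2" "2 * t * (2 + \<epsilon>) \<le> \<epsilon>\<^sup>2"
    proof -
      show "0 < t" using \<epsilon> by (simp add: t_def)
      show "t \<le> 1 / 2" unfolding t_def by (rule min.cobounded1)
      have "t \<le> \<epsilon>\<^sup>2 / (2 * (2 + \<epsilon>))" by (simp add: t_def)
      then show "2 * t * (2 + \<epsilon>) \<le> \<epsilon>\<^sup>2" using \<epsilon> by (simp add: pos_le_divide_eq mult_ac)
    qed
    have q: "0 \<le> 1 - p ^ 33" "1 - p ^ 33 < 1" using p by (auto intro: power_le_one)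
    \<comment> \<open>So many scales make the return probability \<open>\<kappa>\<close> small
      enough for
      \<open>C * \<kappa> / (1 - \<kappa>) \<le> 2 * C * \<kappa> \<le> t\<close>.\<close>
    obtain n where n: "(1 - p ^ 33) ^ n < min (1 / 2) (t / (2 * C))"
      using real_arch_pow_inv[of "min (1 / 2) (t / (2 * C))" "1 - p ^ 33"] q(2) t(1) C by auto
    define \<kappa> where "\<kappa> = (1 - p ^ 33) ^ n"
    have \<kappa>: "0 \<le> \<kappa>" "\<kappa> \<le> 1 / 2" "\<kappa> \<le> t / (2 * C)" using q(1) n by (auto simp: \<kappa>_def)
    have \<kappa>t: "C * \<kappa> / (1 - \<kappa>) \<le> t"
    proof -
      have "2 * (C * \<kappa>) \<le> t" using \<kappa>(3) C by (simp add: pos_le_divide_eq mult_ac)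
      also have "2 * (C * \<kappa>) * (1 - \<kappa>) \<ge> 2 * (C * \<kappa>) * (1 / 2)" using \<kappa> C by (intro mult_left_mono) auto
      then have "C * \<kappa> \<le> 2 * (C * \<kappa>) * (1 - \<kappa>)" by simp
      then have "C * \<kappa> / (1 - \<kappa>) \<le> 2 * (C * \<kappa>)" using \<kappa>(2) by (simp add: pos_divide_le_eq)
      finally show ?thesis .
    qed
    \<comment> \<open>The largest starting scale for which \<open>n\<close> scales fit into the
      distance \<open>\<rho>\<close>. It also serves as the bound \<open>r\<close> on the Hausdorff
      distance.\<close>
    define \<eta> where "\<eta> = \<rho> / (22 * 7 ^ n)"
    have \<eta>: "\<eta> > 0" "22 * 7 ^ n * \<eta> \<le> \<rho>" using \<rho>(1) by (auto simp: \<eta>_def)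
    \<comment> \<open>The three terms yield \<open>3 * m \<le> \<eta>H\<close>,
      \<open>5 * m \<le> \<eta>\<close> and \<open>88 * m \<le> \<rho>\<close> for
      \<open>m = \<delta> / \<delta>\<^sub>1\<close>.\<close>
    define \<delta>\<^sub>0 where "\<delta>\<^sub>0 = \<delta>\<^sub>1 * min (\<eta>H / 3) (min (\<eta> / 5) (\<rho> / 88))"
    have \<delta>\<^sub>0: "\<delta>\<^sub>0 > 0" using p(3) \<eta>(1) \<eta>H(1) \<rho>(1) by (simp add: \<delta>\<^sub>0_def)
    have main: "1 - \<epsilon> \<le> measure_pmf.prob \<nu>\<^sub>1 E \<and> 1 - \<epsilon> \<le> measure_pmf.prob \<nu>\<^sub>2 E"
      if D: "bounded_sc_domain D\<^sub>1" "bounded_sc_domain D\<^sub>2" "V \<subseteq> D\<^sub>1 \<inter> D\<^sub>2"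
        "hausdorff_distance (frontier D\<^sub>1) (frontier D\<^sub>2) < \<eta>" and \<delta>: "0 < \<delta>" "\<delta> < \<delta>\<^sub>0"
        and \<nu>: "\<nu>\<^sub>1 = restricted_ust (G \<delta>) (w \<delta>) (c \<delta>) D\<^sub>1 U" "\<nu>\<^sub>2 = restricted_ust (G \<delta>) (w \<delta>) (c \<delta>) D\<^sub>2 U"
        and E: "E = {S. ereal (1 - \<epsilon>) \<le> pmf_ratio \<nu>\<^sub>1 \<nu>\<^sub>2 S \<and> pmf_ratio \<nu>\<^sub>1 \<nu>\<^sub>2 S \<le> ereal (1 + \<epsilon>)}"
      for D\<^sub>1 D\<^sub>2 \<delta> \<nu>\<^sub>1 \<nu>\<^sub>2 E
    proof -
      interpret crossing_graph "G \<delta>" "w \<delta>" "c \<delta>" p "\<delta> / \<delta>\<^sub>1" by (rule cg[OF \<delta>(1)])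
      have "\<delta> / \<delta>\<^sub>1 < min (\<eta>H / 3) (min (\<eta> / 5) (\<rho> / 88))"
        using \<delta>(2) p(3) unfolding \<delta>\<^sub>0_def pos_divide_less_eq[OF p(3)] by (simp only: mult.commute)
      then have m: "3 * (\<delta> / \<delta>\<^sub>1) \<le> \<eta>H" "5 * (\<delta> / \<delta>\<^sub>1) \<le> \<eta>" "88 * (\<delta> / \<delta>\<^sub>1) \<le> \<rho>" by linarith+
      let ?\<nu> = "restricted_ust (G \<delta>) (w \<delta>) (c \<delta>) (D\<^sub>1 \<inter> D\<^sub>2) U"
      have minorant: "(1 - t) * pmf (restricted_ust (G \<delta>) (w \<delta>) (c \<delta>) A U) S \<le> pmf ?\<nu> S"
        if A: "(A = D\<^sub>1 \<and> B = D\<^sub>2) \<or> (A = D\<^sub>2 \<and> B = D\<^sub>1)" for A B S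
      proof -
        have sc: "bounded_sc_domain A" "bounded_sc_domain B" "V \<subseteq> A \<inter> B" "D\<^sub>1 \<inter> D\<^sub>2 = A \<inter> B"
          and hd: "hausdorff_distance (frontier B) (frontier A) < \<eta>"
          using A D hausdorff_distance_commute[of "frontier D\<^sub>1" "frontier D\<^sub>2"] by auto
        have A': "open A" "bounded A" "simply_connected A" "A \<noteq> {}" and B': "open B" "bounded B"
          using sc by (auto simp: bounded_sc_domain_def)
        have fA: "frontier A \<noteq> {}"
          using A'(2,4) frontier_not_empty[of A] not_bounded_UNIV by metis
        have "(1 - C * \<kappa> / (1 - \<kappa>)) * pmf (restricted_ust (G \<delta>) (w \<delta>) (c \<delta>) A U) S \<le> pmf ?\<nu> S"
          unfolding sc(4)
        proof (rule restricted_ust_minorant[OF _ _ A'(1-3), where \<rho> = \<rho> and \<eta> = \<eta> and r = \<eta> and n = n])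
          show "ball x \<rho> \<subseteq> A \<inter> B" if "x \<in> U" for x using ballV[OF that] sc(3) by blast
          show "harnack_constant U (\<rho> / 2) (G \<delta>) (w \<delta>) C U U" using harnack[OF cg[OF \<delta>(1)] m(1)] .
          show "\<exists>\<zeta>. \<zeta> \<notin> A \<and> dist y \<zeta> \<le> \<eta>" if y: "y \<in> frontier (A \<inter> B)" "y \<in> A" for y
          proof -
            \<comment> \<open>A frontier point of the intersection that lies in the open set
              \<open>A\<close> belongs to the frontier of \<open>B\<close>. So it is close to the
              frontier of \<open>A\<close>, whose points are outside \<open>A\<close>.\<close>
            have "y \<notin> frontier A" using y(2) A'(1) frontier_disjoint_eq by blast
            then have "y \<in> frontier B" using y(1) frontier_Int_subset by blast
            then obtain \<zeta> where "\<zeta> \<in> frontier A" "dist y \<zeta> \<le> \<eta>"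
              using hausdorff_distance_close[OF compact_imp_bounded compact_imp_bounded frontier_closed fA hd,
                OF compact_frontier_bounded compact_frontier_bounded] A'(2) B'(2) by blast
            then show ?thesis using A'(1) frontier_disjoint_eq by blast
          qed
          show "\<kappa> = (1 - p ^ 33) ^ n" by (rule \<kappa>_def)
        qed (use A' B' \<rho>(1) m \<eta> C \<kappa> in auto)
        moreover have "(1 - t) * pmf (restricted_ust (G \<delta>) (w \<delta>) (c \<delta>) A U) S \<le>
            (1 - C * \<kappa> / (1 - \<kappa>)) * pmf (restricted_ust (G \<delta>) (w \<delta>) (c \<delta>) A U) S"
          using \<kappa>t by (intro mult_right_mono) auto
        ultimately show ?thesis by linarith
      qed
      have "(1 - t) * pmf \<nu>\<^sub>1 S \<le> pmf ?\<nu> S" "(1 - t) * pmf \<nu>\<^sub>2 S \<le> pmf ?\<nu> S" for S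
        using minorant[of D\<^sub>1 D\<^sub>2] minorant[of D\<^sub>2 D\<^sub>1] unfolding \<nu> by auto
      then show ?thesis
        using common_minorant_ratio[OF \<epsilon> less_imp_le[OF t(1)] t(2,3), of \<nu>\<^sub>1 ?\<nu> \<nu>\<^sub>2] unfolding E by blast
    qed
    show ?thesis
    proof (rule exI[of _ \<eta>], rule conjI[OF \<eta>(1)], rule exI[of _ \<delta>\<^sub>0], rule conjI[OF \<delta>\<^sub>0],
        intro allI impI, elim conjE)
      fix D\<^sub>1 D\<^sub>2 \<delta>
      assume "bounded_sc_domain D\<^sub>1" "bounded_sc_domain D\<^sub>2" "V \<subseteq> D\<^sub>1 \<inter> D\<^sub>2"
        "hausdorff_distance (frontier D\<^sub>1) (frontier D\<^sub>2) < \<eta>" "0 < \<delta>" "\<delta> < \<delta>\<^sub>0"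
      from main[OF this refl refl refl]
      show "let \<nu>\<^sub>1 = restricted_ust (G \<delta>) (w \<delta>) (c \<delta>) D\<^sub>1 U;
               \<nu>\<^sub>2 = restricted_ust (G \<delta>) (w \<delta>) (c \<delta>) D\<^sub>2 U;
               E = {S. ereal (1 - \<epsilon>) \<le> pmf_ratio \<nu>\<^sub>1 \<nu>\<^sub>2 S \<and> pmf_ratio \<nu>\<^sub>1 \<nu>\<^sub>2 S \<le> ereal (1 + \<epsilon>)}
           in measure_pmf.prob \<nu>\<^sub>1 E \<ge> 1 - \<epsilon> \<and> measure_pmf.prob \<nu>\<^sub>2 E \<ge> 1 - \<epsilon>"
        unfolding Let_def .
    qed
  qed
qed

end
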